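(* Let $k$ be a field of characteristic zero and let $A$ be a $k$-algebra with an idempotent $e\in A$. Suppose that $A/AeA$ is an Artinian local $k$-algebra and let $S$ be the quotient of $A/AeA$ by its radical. Suppose that the derived quotient $A/^{\mathbb{L}}AeA$ is cohomologically locally finite. Then there is an isomorphism, functorial in the ungraded Artinian local $k$-algebra $\Gamma$, $$\mathrm{Def}^{\mathrm{cl}}_A(S)(\Gamma)\;\cong\;\frac{\mathrm{Hom}_{\mathbf{Art}_k}(A/AeA,\Gamma)}{(\text{inner automorphisms of }\Gamma)}.$$
   Context: Modules are right modules; $\otimes$ is over $k$. "$k$-algebra" means ungraded associative unital algebra. An Artinian local $k$-algebra is an augmented finite-dimensional (not necessarily commutative) $k$-algebra whose augmentation ideal is nilpotent (so it is local with residue field $k$); $\mathbf{Art}_k$ is the category of these with augmentation-preserving maps. Hence $S$ is a one-dimensional $A$-module. Inner automorphisms of $\Gamma$ (conjugations by units of $\Gamma$) act on the Hom-set by postcomposition, and the quotient is the orbit set. A complex is cohomologically locally finite if each cohomology space is finite-dimensional. Derived quotient (Braun–Chuang–Lazarev). An $A$-dga is a dga $R$ with a dga map $A\to R$. The derived quotient $A/^{\mathbb{L}}AeA$ is the universal $A$-dga homotopy annihilating $e$: the initial object of the homotopy (derived) category of $A$-dgas $R$ in which the image of $e$ vanishes in $H^0(R)$. It exists and is unique up to quasi-isomorphism of $A$-dgas. Classical deformations: a classical deformation of $S$ over $\Gamma$ is a pair $(\tilde S,f)$ with $\tilde S$ an $A\otimes\Gamma$-module, flat over $\Gamma$, and $f:\tilde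 S\otimes_\Gamma k\to S$ an isomorphism of $A$-modules. An isomorphism $(\tilde S_1,f_1)\to(\tilde S_2,f_2)$ is an isomorphism $\phi$ of $A\otimes\Gamma$-modules with $f_1=f_2\circ(\phi\otimes_\Gamma k)$. $\mathrm{Def}^{\mathrm{cl}}_A(S)(\Gamma)$ is the set of isomorphism classes.
   Formalization: Γ acts on deformations from the left (right modules over A⊗Γ^op, same for commutative Γ), since with right A⊗Γ-modules the formula fails when A/AeA is not isomorphic to its opposite; flatness is tested on Γ-modules inside the type of Γ, enough by the ideal criterion. *)

theory Defs
  imports "HOL-Algebra.Module" "HOL-Algebra.QuotRing" "HOL-Algebra.Ideal_Product"
    "HOL-Algebra.Free_Abelian_Groups"
begin

section \<open>Algebras over a field\<close>

text \<open>The locale \<open>algebra\<close> of the library covers commutative algebras only; the record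
  \<open>module\<close> extends \<open>ring\<close> and so also carries the data of a noncommutative algebra.\<close>

locale k_algebra = field K + module K A + A: ring A
  for K :: "('k, 'x) ring_scheme" and A :: "('k, 'a, 'y) module_scheme" +
  assumes smult_mult_left:
      "\<lbrakk>c \<in> carrier K; x \<in> carrier A; y \<in> carrier A\<rbrakk> \<Longrightarrow>
        (c \<odot>\<^bsub>A\<^esub> x) \<otimes>\<^bsub>A\<^esub> y = c \<odot>\<^bsub>A\<^esub> (x \<otimes>\<^bsub>A\<^esub> y)"
    and smult_mult_right:
      "\<lbrakk>c \<in> carrier K; x \<in> carrier A; y \<in> carrier A\<rbrakk> \<Longrightarrow>
        x \<otimes>\<^bsub>A\<^esub> (c \<odot>\<^bsub>A\<^esub> y) = c \<odot>\<^bsub>A\<^esub> (x \<otimes>\<^bsub>A\<^esub> y)"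

definition char_zero :: "('k, 'x) ring_scheme \<Rightarrow> bool" where
  "char_zero K \<longleftrightarrow> (\<forall>n::nat. n > 0 \<longrightarrow> [n] \<cdot>\<^bsub>K\<^esub> \<one>\<^bsub>K\<^esub> \<noteq> \<zero>\<^bsub>K\<^esub>)"

definition self_algebra :: "'k ring \<Rightarrow> ('k, 'k) module" where
  "self_algebra K = \<lparr>carrier = carrier K, mult = mult K, one = one K, ring.zero = ring.zero K,
     add = add K, smult = mult K\<rparr>"

text \<open>Morphisms are extensional functions, so that two morphisms are equal as soon as they agree
  on the carrier. This matters wherever morphisms are counted: in the Hom-sets below and in the
  uniqueness part of initiality.\<close>

definition alg_hom ::
  "'k ring \<Rightarrow> ('k, 'a, 'y) module_scheme \<Rightarrow> ('k, 'b, 'z) module_scheme \<Rightarrow> ('a \<Rightarrow> 'b) set" where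
  "alg_hom K A B = {f \<in> ring_hom A B. f \<in> extensional (carrier A) \<and>
     (\<forall>c \<in> carrier K. \<forall>x \<in> carrier A. f (c \<odot>\<^bsub>A\<^esub> x) = c \<odot>\<^bsub>B\<^esub> f x)}"

definition finite_dimensional :: "'k ring \<Rightarrow> ('k, 'm, 'y) module_scheme \<Rightarrow> bool" where
  "finite_dimensional K M \<longleftrightarrow> (\<exists>B. finite B \<and> B \<subseteq> carrier M \<and>
     (\<forall>x \<in> carrier M. \<exists>c \<in> B \<rightarrow> carrier K. x = (\<Oplus>\<^bsub>M\<^esub>b\<in>B. c b \<odot>\<^bsub>M\<^esub> b)))"

text \<open>Quotients of a module by a submodule, and of an algebra by a two-sided ideal.\<close>

definition coset_smult :: "('k, 'm, 'y) module_scheme \<Rightarrow> 'm set \<Rightarrow> 'k \<Rightarrow> 'm set \<Rightarrow> 'm set" where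
  "coset_smult M N c X = (\<Union>x\<in>X. N +>\<^bsub>M\<^esub> (c \<odot>\<^bsub>M\<^esub> x))"

definition quot_module :: "('k, 'm, 'y) module_scheme \<Rightarrow> 'm set \<Rightarrow> ('k, 'm set) module" where
  "quot_module M N = \<lparr>carrier = a_rcosets\<^bsub>M\<^esub> N, mult = undefined, one = undefined,
     ring.zero = N, add = set_add M, smult = coset_smult M N\<rparr>"

definition quot_algebra :: "('k, 'a, 'y) module_scheme \<Rightarrow> 'a set \<Rightarrow> ('k, 'a set) module" where
  "quot_algebra A I = \<lparr>carrier = carrier (A Quot I), mult = mult (A Quot I),
     one = one (A Quot I), ring.zero = ring.zero (A Quot I), add = add (A Quot I),
     smult = coset_smult A I\<rparr>"

text \<open>The algebra $A/AeA$.\<close>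

definition idem_quot :: "('k, 'a, 'y) module_scheme \<Rightarrow> 'a \<Rightarrow> ('k, 'a set) module" where
  "idem_quot A e = quot_algebra A (Idl\<^bsub>A\<^esub> {e})"

section \<open>Artinian local algebras\<close>

definition nilpotent_ideal :: "('a, 'y) ring_scheme \<Rightarrow> 'a set \<Rightarrow> bool" where
  "nilpotent_ideal R I \<longleftrightarrow> (\<exists>n. (ideal_prod R I ^^ n) (carrier R) = {\<zero>\<^bsub>R\<^esub>})"

text \<open>An object of the category of Artinian local algebras is a pair of an algebra and its
  augmentation.\<close>

type_synonym ('k, 'g) aug_alg = "('k, 'g) module \<times> ('g \<Rightarrow> 'k)"

definition artinian_local :: "'k ring \<Rightarrow> ('k, 'g) aug_alg \<Rightarrow> bool" where
  "artinian_local K G \<longleftrightarrow> k_algebra K (fst G) \<and> finite_dimensional K (fst G) \<and>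
     snd G \<in> alg_hom K (fst G) (self_algebra K) \<and>
     nilpotent_ideal (fst G) (a_kernel (fst G) K (snd G))"

definition art_hom ::
  "'k ring \<Rightarrow> ('k, 'g) aug_alg \<Rightarrow> ('k, 'h) aug_alg \<Rightarrow> ('g \<Rightarrow> 'h) set" where
  "art_hom K G H = {f \<in> alg_hom K (fst G) (fst H).
     \<forall>x \<in> carrier (fst G). snd H (f x) = snd G x}"

text \<open>Orbits of morphisms into \<open>G\<close> under postcomposition with inner automorphisms of \<open>G\<close>, and
  the induced maps between orbit sets.\<close>

definition inner_rel ::
  "'k ring \<Rightarrow> ('k, 'b) aug_alg \<Rightarrow> ('k, 'g) aug_alg \<Rightarrow> (('b \<Rightarrow> 'g) \<times> ('b \<Rightarrow> 'g)) set" where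
  "inner_rel K B G = {(f, f'). f \<in> art_hom K B G \<and> f' \<in> art_hom K B G \<and>
     (\<exists>u \<in> Units (fst G).
        f' = compose (carrier (fst B)) (\<lambda>x. u \<otimes>\<^bsub>fst G\<^esub> x \<otimes>\<^bsub>fst G\<^esub> inv\<^bsub>fst G\<^esub> u) f)}"

definition hom_mod_inner ::
  "'k ring \<Rightarrow> ('k, 'b) aug_alg \<Rightarrow> ('k, 'g) aug_alg \<Rightarrow> ('b \<Rightarrow> 'g) set set" where
  "hom_mod_inner K B G = art_hom K B G // inner_rel K B G"

definition hom_mod_inner_map ::
  "'k ring \<Rightarrow> ('k, 'b) aug_alg \<Rightarrow> ('k, 'h) aug_alg \<Rightarrow> ('g \<Rightarrow> 'h) \<Rightarrow>
    ('b \<Rightarrow> 'g) set \<Rightarrow> ('b \<Rightarrow> 'h) set" where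
  "hom_mod_inner_map K B H \<phi> C =
     (\<Union>f\<in>C. inner_rel K B H `` {compose (carrier (fst B)) \<phi> f})"

section \<open>Differential graded algebras\<close>

text \<open>A dga is stored as its total algebra together with the homogeneous components and the
  differential, which has degree 1.\<close>

record ('k, 'r) dga = "('k, 'r) module" +
  gr :: "int \<Rightarrow> 'r set"
  diff :: "'r \<Rightarrow> 'r"

locale dg_algebra = k_algebra K R
  for K :: "'k ring" and R :: "('k, 'r) dga" +
  assumes gr_submodule: "submodule (gr R n) K R"
    and gr_direct_sum: "x \<in> carrier R \<Longrightarrow>
      \<exists>!c. (\<forall>n. c n \<in> gr R n) \<and> finite {n. c n \<noteq> \<zero>\<^bsub>R\<^esub>} \<and>
        x = (\<Oplus>\<^bsub>R\<^esub>n\<in>{n. c n \<noteq> \<zero>\<^bsub>R\<^esub>}. c n)"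
    and gr_one: "\<one>\<^bsub>R\<^esub> \<in> gr R 0"
    and gr_mult: "\<lbrakk>x \<in> gr R m; y \<in> gr R n\<rbrakk> \<Longrightarrow> x \<otimes>\<^bsub>R\<^esub> y \<in> gr R (m + n)"
    and diff_gr: "x \<in> gr R n \<Longrightarrow> diff R x \<in> gr R (n + 1)"
    and diff_closed: "x \<in> carrier R \<Longrightarrow> diff R x \<in> carrier R"
    and diff_add: "\<lbrakk>x \<in> carrier R; y \<in> carrier R\<rbrakk> \<Longrightarrow>
      diff R (x \<oplus>\<^bsub>R\<^esub> y) = diff R x \<oplus>\<^bsub>R\<^esub> diff R y"
    and diff_smult: "\<lbrakk>c \<in> carrier K; x \<in> carrier R\<rbrakk> \<Longrightarrow>
      diff R (c \<odot>\<^bsub>R\<^esub> x) = c \<odot>\<^bsub>R\<^esub> diff R x"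
    and diff_diff: "x \<in> carrier R \<Longrightarrow> diff R (diff R x) = \<zero>\<^bsub>R\<^esub>"
    and leibniz: "\<lbrakk>x \<in> gr R n; y \<in> carrier R\<rbrakk> \<Longrightarrow>
      diff R (x \<otimes>\<^bsub>R\<^esub> y) = (diff R x \<otimes>\<^bsub>R\<^esub> y) \<oplus>\<^bsub>R\<^esub>
        (if even n then x \<otimes>\<^bsub>R\<^esub> diff R y else \<ominus>\<^bsub>R\<^esub> (x \<otimes>\<^bsub>R\<^esub> diff R y))"

definition dga_hom :: "'k ring \<Rightarrow> ('k, 'r) dga \<Rightarrow> ('k, 's) dga \<Rightarrow> ('r \<Rightarrow> 's) set" where
  "dga_hom K R R' = {f \<in> alg_hom K R R'. (\<forall>n. f ` gr R n \<subseteq> gr R' n) \<and>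
     (\<forall>x \<in> carrier R. f (diff R x) = diff R' (f x))}"

definition concentrated :: "('k, 'a) module \<Rightarrow> ('k, 'a) dga" where
  "concentrated A = \<lparr>carrier = carrier A, mult = mult A, one = one A, ring.zero = ring.zero A,
     add = add A, smult = smult A, gr = (\<lambda>n. if n = 0 then carrier A else {\<zero>\<^bsub>A\<^esub>}),
     diff = (\<lambda>_. \<zero>\<^bsub>A\<^esub>)\<rparr>"

definition cocycles :: "('k, 'r) dga \<Rightarrow> int \<Rightarrow> 'r set" where
  "cocycles R n = {x \<in> gr R n. diff R x = \<zero>\<^bsub>R\<^esub>}"

definition coboundaries :: "('k, 'r) dga \<Rightarrow> int \<Rightarrow> 'r set" where
  "coboundaries R n = diff R ` gr R (n - 1)"

definition cohomology :: "('k, 'r) dga \<Rightarrow> int \<Rightarrow> ('k, 'r set) module" where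
  "cohomology R n = quot_module (R\<lparr>carrier := cocycles R n\<rparr>) (coboundaries R n)"

definition cohomology_map ::
  "('k, 's) dga \<Rightarrow> ('r \<Rightarrow> 's) \<Rightarrow> int \<Rightarrow> 'r set \<Rightarrow> 's set" where
  "cohomology_map R' f n X = (\<Union>x\<in>X. coboundaries R' n +>\<^bsub>R'\<^esub> f x)"

definition quasi_iso :: "('k, 'r) dga \<Rightarrow> ('k, 's) dga \<Rightarrow> ('r \<Rightarrow> 's) \<Rightarrow> bool" where
  "quasi_iso R R' f \<longleftrightarrow> (\<forall>n. bij_betw (cohomology_map R' f n)
     (carrier (cohomology R n)) (carrier (cohomology R' n)))"

definition cohomologically_locally_finite :: "'k ring \<Rightarrow> ('k, 'r) dga \<Rightarrow> bool" where
  "cohomologically_locally_finite K R \<longleftrightarrow> (\<forall>n. finite_dimensional K (cohomology R n))"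

section \<open>The homotopy category of \<open>A\<close>-dgas\<close>

type_synonym ('k, 'a, 'r) under_dga = "('k, 'r) dga \<times> ('a \<Rightarrow> 'r)"

definition under_dga :: "'k ring \<Rightarrow> ('k, 'a) module \<Rightarrow> ('k, 'a, 'r) under_dga \<Rightarrow> bool" where
  "under_dga K A X \<longleftrightarrow> dg_algebra K (fst X) \<and> snd X \<in> dga_hom K (concentrated A) (fst X)"

definition under_hom ::
  "'k ring \<Rightarrow> ('k, 'a) module \<Rightarrow> ('k, 'a, 'r) under_dga \<Rightarrow> ('k, 'a, 'r) under_dga \<Rightarrow>
    ('r \<Rightarrow> 'r) set" where
  "under_hom K A X Y = {f \<in> dga_hom K (fst X) (fst Y). \<forall>a \<in> carrier A. f (snd X a) = snd Y a}"

definition under_weq ::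
  "'k ring \<Rightarrow> ('k, 'a) module \<Rightarrow> ('k, 'a, 'r) under_dga \<Rightarrow> ('k, 'a, 'r) under_dga \<Rightarrow>
    ('r \<Rightarrow> 'r) set" where
  "under_weq K A X Y = {f \<in> under_hom K A X Y. quasi_iso (fst X) (fst Y) f}"

text \<open>Localisation at the quasi-isomorphisms: a morphism from \<open>X\<close> to \<open>Z\<close> is a zigzag of steps,
  up to the congruence generated by the category laws and by cancellation of a weak equivalence
  against its formal inverse. A step \<open>Fwd f Y\<close> follows an arrow \<open>f\<close> to \<open>Y\<close>; a step \<open>Bwd w Y\<close>
  goes to \<open>Y\<close> against a weak equivalence \<open>w\<close> whose source is \<open>Y\<close>.\<close>

datatype ('o, 'f) zstep = Fwd 'f 'o | Bwd 'f 'o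

type_synonym ('k, 'a, 'r) zigzag =
  "(('k, 'a, 'r) under_dga, 'r \<Rightarrow> 'r) zstep list"

inductive zigzag ::
  "'k ring \<Rightarrow> ('k, 'a) module \<Rightarrow> ('k, 'a, 'r) under_dga \<Rightarrow> ('k, 'a, 'r) zigzag \<Rightarrow>
    ('k, 'a, 'r) under_dga \<Rightarrow> bool"
  for K A where
  zz_nil: "under_dga K A X \<Longrightarrow> zigzag K A X [] X"
| zz_fwd: "\<lbrakk>under_dga K A X; f \<in> under_hom K A X Y; zigzag K A Y p Z\<rbrakk> \<Longrightarrow>
    zigzag K A X (Fwd f Y # p) Z"
| zz_bwd: "\<lbrakk>under_dga K A X; w \<in> under_weq K A Y X; zigzag K A Y p Z\<rbrakk> \<Longrightarrow>
    zigzag K A X (Bwd w Y # p) Z"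

inductive ho_eq ::
  "'k ring \<Rightarrow> ('k, 'a) module \<Rightarrow> ('k, 'a, 'r) under_dga \<Rightarrow> ('k, 'a, 'r) zigzag \<Rightarrow>
    ('k, 'a, 'r) zigzag \<Rightarrow> ('k, 'a, 'r) under_dga \<Rightarrow> bool"
  for K A where
  ho_refl: "zigzag K A X p Z \<Longrightarrow> ho_eq K A X p p Z"
| ho_sym: "ho_eq K A X p q Z \<Longrightarrow> ho_eq K A X q p Z"
| ho_trans: "\<lbrakk>ho_eq K A X p q Z; ho_eq K A X q r Z\<rbrakk> \<Longrightarrow> ho_eq K A X p r Z"
| ho_fwd: "\<lbrakk>under_dga K A X; f \<in> under_hom K A X Y; ho_eq K A Y p q Z\<rbrakk> \<Longrightarrow>
    ho_eq K A X (Fwd f Y # p) (Fwd f Y # q) Z"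
| ho_bwd: "\<lbrakk>under_dga K A X; w \<in> under_weq K A Y X; ho_eq K A Y p q Z\<rbrakk> \<Longrightarrow>
    ho_eq K A X (Bwd w Y # p) (Bwd w Y # q) Z"
| ho_id: "zigzag K A X p Z \<Longrightarrow>
    ho_eq K A X (Fwd (restrict id (carrier (fst X))) X # p) p Z"
| ho_comp: "\<lbrakk>under_dga K A X; under_dga K A Y; f \<in> under_hom K A X Y; g \<in> under_hom K A Y W;
      zigzag K A W p Z\<rbrakk> \<Longrightarrow>
    ho_eq K A X (Fwd f Y # Fwd g W # p) (Fwd (compose (carrier (fst X)) g f) W # p) Z"
| ho_cancel_fwd: "\<lbrakk>under_dga K A Y; w \<in> under_weq K A X Y; zigzag K A X p Z\<rbrakk> \<Longrightarrow>
    ho_eq K A X (Fwd w Y # Bwd w X # p) p Z"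
| ho_cancel_bwd: "\<lbrakk>under_dga K A Y; w \<in> under_weq K A Y X; zigzag K A X p Z\<rbrakk> \<Longrightarrow>
    ho_eq K A X (Bwd w Y # Fwd w X # p) p Z"

definition annihilates_in_cohomology :: "('k, 'a, 'r) under_dga \<Rightarrow> 'a \<Rightarrow> bool" where
  "annihilates_in_cohomology X e \<longleftrightarrow>
     coboundaries (fst X) 0 +>\<^bsub>fst X\<^esub> snd X e = \<zero>\<^bsub>cohomology (fst X) 0\<^esub>"

text \<open>The derived quotient, as an initial object of the full subcategory of the homotopy category.
  Test objects are carried by subsets of the same type \<open>'r\<close>, so the notion is the intended one
  as soon as \<open>'r\<close> is infinite and at least as large as \<open>A\<close>: every \<open>A\<close>-dga needed for factorisations,
  cylinders and path objects then has a copy in \<open>'r\<close>.\<close>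

definition derived_quotient ::
  "'k ring \<Rightarrow> ('k, 'a) module \<Rightarrow> 'a \<Rightarrow> ('k, 'a, 'r) under_dga \<Rightarrow> bool" where
  "derived_quotient K A e Q \<longleftrightarrow> under_dga K A Q \<and> annihilates_in_cohomology Q e \<and>
     (\<forall>X. under_dga K A X \<and> annihilates_in_cohomology X e \<longrightarrow>
        (\<exists>p. zigzag K A Q p X) \<and>
        (\<forall>p q. zigzag K A Q p X \<and> zigzag K A Q q X \<longrightarrow> ho_eq K A Q p q X))"

section \<open>Modules and tensor products\<close>

text \<open>As for the library's record \<open>module\<close>, only the additive part of the underlying \<open>ring\<close>
  record is meaningful.\<close>

record ('a, 'm) rmod = "'m ring" +
  ract :: "'m \<Rightarrow> 'a \<Rightarrow> 'm"

locale right_module = R: ring R + M: abelian_group M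
  for R :: "('a, 'x) ring_scheme" and M :: "('a, 'm, 'y) rmod_scheme" +
  assumes ract_closed: "\<lbrakk>m \<in> carrier M; a \<in> carrier R\<rbrakk> \<Longrightarrow> ract M m a \<in> carrier M"
    and ract_add_left: "\<lbrakk>m \<in> carrier M; m' \<in> carrier M; a \<in> carrier R\<rbrakk> \<Longrightarrow>
      ract M (m \<oplus>\<^bsub>M\<^esub> m') a = ract M m a \<oplus>\<^bsub>M\<^esub> ract M m' a"
    and ract_add_right: "\<lbrakk>m \<in> carrier M; a \<in> carrier R; b \<in> carrier R\<rbrakk> \<Longrightarrow>
      ract M m (a \<oplus>\<^bsub>R\<^esub> b) = ract M m a \<oplus>\<^bsub>M\<^esub> ract M m b"
    and ract_mult: "\<lbrakk>m \<in> carrier M; a \<in> carrier R; b \<in> carrier R\<rbrakk> \<Longrightarrow>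
      ract M m (a \<otimes>\<^bsub>R\<^esub> b) = ract M (ract M m a) b"
    and ract_one: "m \<in> carrier M \<Longrightarrow> ract M m \<one>\<^bsub>R\<^esub> = m"

definition rmod_hom ::
  "('a, 'x) ring_scheme \<Rightarrow> ('a, 'm, 'y) rmod_scheme \<Rightarrow> ('a, 'n, 'z) rmod_scheme \<Rightarrow>
    ('m \<Rightarrow> 'n) set" where
  "rmod_hom R M N = {f \<in> carrier M \<rightarrow> carrier N.
     (\<forall>x \<in> carrier M. \<forall>y \<in> carrier M. f (x \<oplus>\<^bsub>M\<^esub> y) = f x \<oplus>\<^bsub>N\<^esub> f y) \<and>
     (\<forall>x \<in> carrier M. \<forall>a \<in> carrier R. f (ract M x a) = ract N (f x) a)}"

definition rmod_iso ::
  "('a, 'x) ring_scheme \<Rightarrow> ('a, 'm, 'y) rmod_scheme \<Rightarrow> ('a, 'n, 'z) rmod_scheme \<Rightarrow>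
    ('m \<Rightarrow> 'n) set" where
  "rmod_iso R M N = {f \<in> rmod_hom R M N. bij_betw f (carrier M) (carrier N)}"

text \<open>Right \<open>A\<close>-modules with a commuting left action of \<open>\<Gamma>\<close> that induces the same action of
  the ground field, that is, right modules over $A \otimes \Gamma^{op}$. Having \<open>\<Gamma>\<close> act on
  the side opposite to \<open>A\<close> makes the endomorphism ring of the free \<open>\<Gamma>\<close>-module of rank one act
  through \<open>\<Gamma>\<close> in the variance of right \<open>A\<close>-modules; for commutative \<open>\<Gamma>\<close> these are just right
  modules over $A \otimes \Gamma$.\<close>

record ('a, 'g, 'm) bimod = "('a, 'm) rmod" +
  lact :: "'g \<Rightarrow> 'm \<Rightarrow> 'm"

locale tensor_module = right_module A M + \<Gamma>: ring \<Gamma>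
  for K :: "'k ring" and A :: "('k, 'a) module" and \<Gamma> :: "('k, 'g) module"
    and M :: "('a, 'g, 'm) bimod" +
  assumes lact_closed: "\<lbrakk>g \<in> carrier \<Gamma>; m \<in> carrier M\<rbrakk> \<Longrightarrow> lact M g m \<in> carrier M"
    and lact_add_right: "\<lbrakk>g \<in> carrier \<Gamma>; m \<in> carrier M; m' \<in> carrier M\<rbrakk> \<Longrightarrow>
      lact M g (m \<oplus>\<^bsub>M\<^esub> m') = lact M g m \<oplus>\<^bsub>M\<^esub> lact M g m'"
    and lact_add_left: "\<lbrakk>g \<in> carrier \<Gamma>; h \<in> carrier \<Gamma>; m \<in> carrier M\<rbrakk> \<Longrightarrow>
      lact M (g \<oplus>\<^bsub>\<Gamma>\<^esub> h) m = lact M g m \<oplus>\<^bsub>M\<^esub> lact M h m"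
    and lact_mult: "\<lbrakk>g \<in> carrier \<Gamma>; h \<in> carrier \<Gamma>; m \<in> carrier M\<rbrakk> \<Longrightarrow>
      lact M (g \<otimes>\<^bsub>\<Gamma>\<^esub> h) m = lact M g (lact M h m)"
    and lact_one: "m \<in> carrier M \<Longrightarrow> lact M \<one>\<^bsub>\<Gamma>\<^esub> m = m"
    and lact_ract: "\<lbrakk>g \<in> carrier \<Gamma>; m \<in> carrier M; a \<in> carrier A\<rbrakk> \<Longrightarrow>
      ract M (lact M g m) a = lact M g (ract M m a)"
    and central: "\<lbrakk>c \<in> carrier K; m \<in> carrier M\<rbrakk> \<Longrightarrow>
      ract M m (c \<odot>\<^bsub>A\<^esub> \<one>\<^bsub>A\<^esub>) = lact M (c \<odot>\<^bsub>\<Gamma>\<^esub> \<one>\<^bsub>\<Gamma>\<^esub>) m"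

definition bimod_iso ::
  "('a, 'x) ring_scheme \<Rightarrow> ('g, 'y) ring_scheme \<Rightarrow> ('a, 'g, 'm) bimod \<Rightarrow> ('a, 'g, 'n) bimod \<Rightarrow>
    ('m \<Rightarrow> 'n) set" where
  "bimod_iso A \<Gamma> M N = {f \<in> rmod_iso A M N.
     \<forall>g \<in> carrier \<Gamma>. \<forall>x \<in> carrier M. f (lact M g x) = lact N g (f x)}"

text \<open>The tensor product $N \otimes_R M$ of a right and a left \<open>R\<close>-module: the free abelian group on
  pairs modulo the subgroup generated by the bilinearity and balancing relations.\<close>

definition tensor_rels ::
  "('g, 'x) ring_scheme \<Rightarrow> ('g, 'n, 'y) rmod_scheme \<Rightarrow> ('a, 'g, 'm) bimod \<Rightarrow>
    ('n \<times> 'm \<Rightarrow>\<^sub>0 int) set" where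
  "tensor_rels R N M =
     {frag_of (x \<oplus>\<^bsub>N\<^esub> x', y) - frag_of (x, y) - frag_of (x', y) | x x' y.
        x \<in> carrier N \<and> x' \<in> carrier N \<and> y \<in> carrier M} \<union>
     {frag_of (x, y \<oplus>\<^bsub>M\<^esub> y') - frag_of (x, y) - frag_of (x, y') | x y y'.
        x \<in> carrier N \<and> y \<in> carrier M \<and> y' \<in> carrier M} \<union>
     {frag_of (ract N x r, y) - frag_of (x, lact M r y) | x r y.
        x \<in> carrier N \<and> r \<in> carrier R \<and> y \<in> carrier M}"

definition tensor_free ::
  "('g, 'n, 'y) rmod_scheme \<Rightarrow> ('a, 'g, 'm) bimod \<Rightarrow> ('n \<times> 'm \<Rightarrow>\<^sub>0 int) monoid" where
  "tensor_free N M = free_Abelian_group (carrier N \<times> carrier M)"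

definition tensor_null ::
  "('g, 'x) ring_scheme \<Rightarrow> ('g, 'n, 'y) rmod_scheme \<Rightarrow> ('a, 'g, 'm) bimod \<Rightarrow>
    ('n \<times> 'm \<Rightarrow>\<^sub>0 int) set" where
  "tensor_null R N M = generate (tensor_free N M) (tensor_rels R N M)"

definition tensor ::
  "('g, 'x) ring_scheme \<Rightarrow> ('g, 'n, 'y) rmod_scheme \<Rightarrow> ('a, 'g, 'm) bimod \<Rightarrow>
    ('n \<times> 'm \<Rightarrow>\<^sub>0 int) set monoid" where
  "tensor R N M = tensor_free N M Mod tensor_null R N M"

definition tensor_class ::
  "('g, 'x) ring_scheme \<Rightarrow> ('g, 'n, 'y) rmod_scheme \<Rightarrow> ('a, 'g, 'm) bimod \<Rightarrow>
    ('n \<times> 'm \<Rightarrow>\<^sub>0 int) \<Rightarrow> ('n \<times> 'm \<Rightarrow>\<^sub>0 int) set" where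
  "tensor_class R N M z = tensor_null R N M #>\<^bsub>tensor_free N M\<^esub> z"

text \<open>The map $f \otimes g$ with target $N' \otimes_R M'$.\<close>

definition tensor_map ::
  "('g, 'x) ring_scheme \<Rightarrow> ('g, 'n', 'y) rmod_scheme \<Rightarrow> ('a, 'g, 'm') bimod \<Rightarrow>
    ('n \<Rightarrow> 'n') \<Rightarrow> ('m \<Rightarrow> 'm') \<Rightarrow> ('n \<times> 'm \<Rightarrow>\<^sub>0 int) set \<Rightarrow> ('n' \<times> 'm' \<Rightarrow>\<^sub>0 int) set" where
  "tensor_map R N' M' f g X =
     (\<Union>z\<in>X. tensor_class R N' M' (frag_extend (\<lambda>(x, y). frag_of (f x, g y)) z))"

text \<open>Flatness: tensoring preserves injectivity of maps of right \<open>\<Gamma>\<close>-modules. The test modules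
  are carried by subsets of the type of \<open>\<Gamma>\<close>; these include \<open>\<Gamma>\<close> and its right ideals, so by the
  ideal criterion larger test modules impose no further condition.\<close>

definition flat :: "('k, 'g) module \<Rightarrow> ('a, 'g, 'm) bimod \<Rightarrow> bool" where
  "flat \<Gamma> M \<longleftrightarrow> (\<forall>(N :: ('g, 'g) rmod) (N' :: ('g, 'g) rmod) i.
     right_module \<Gamma> N \<and> right_module \<Gamma> N' \<and> i \<in> rmod_hom \<Gamma> N N' \<and> inj_on i (carrier N) \<longrightarrow>
     inj_on (tensor_map \<Gamma> N' M i id) (carrier (tensor \<Gamma> N M)))"

section \<open>Base change\<close>

text \<open>A ring \<open>\<Delta>\<close> as a right \<open>\<Gamma>\<close>-module along \<open>\<phi> : \<Gamma> \<rightarrow> \<Delta>\<close>.\<close>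

definition along :: "('h, 'x) ring_scheme \<Rightarrow> ('g \<Rightarrow> 'h) \<Rightarrow> ('g, 'h) rmod" where
  "along \<Delta> \<phi> = \<lparr>carrier = carrier \<Delta>, mult = mult \<Delta>, one = one \<Delta>, ring.zero = ring.zero \<Delta>,
     add = add \<Delta>, ract = (\<lambda>x g. x \<otimes>\<^bsub>\<Delta>\<^esub> \<phi> g)\<rparr>"

text \<open>$\Delta \otimes_\Gamma M$ with its left \<open>\<Delta>\<close>-action and its right \<open>A\<close>-action. With the augmentation
  for \<open>\<phi>\<close> this is the reduction of \<open>M\<close> to the ground field.\<close>

definition base_change ::
  "('g, 'y) ring_scheme \<Rightarrow> ('h, 'x) ring_scheme \<Rightarrow> ('g \<Rightarrow> 'h) \<Rightarrow> ('a, 'g, 'm) bimod \<Rightarrow>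
    ('a, 'h, ('h \<times> 'm \<Rightarrow>\<^sub>0 int) set) bimod" where
  "base_change \<Gamma> \<Delta> \<phi> M = \<lparr>carrier = carrier (tensor \<Gamma> (along \<Delta> \<phi>) M),
     mult = undefined, one = undefined,
     ring.zero = one (tensor \<Gamma> (along \<Delta> \<phi>) M),
     add = mult (tensor \<Gamma> (along \<Delta> \<phi>) M),
     ract = (\<lambda>X a. tensor_map \<Gamma> (along \<Delta> \<phi>) M id (\<lambda>m. ract M m a) X),
     lact = (\<lambda>d X. tensor_map \<Gamma> (along \<Delta> \<phi>) M (\<lambda>x. d \<otimes>\<^bsub>\<Delta>\<^esub> x) id X)\<rparr>"

text \<open>The canonical map from $k \otimes_\Delta (\Delta \otimes_\Gamma M)$ to $k \otimes_\Gamma M$; it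
  sends $c \otimes (d \otimes m)$ to $c \delta(d) \otimes m$, where $\delta$ is the augmentation of
  $\Delta$. It does not depend on the chosen representatives.\<close>

definition reduce_base_change ::
  "'k ring \<Rightarrow> ('k, 'g) aug_alg \<Rightarrow> ('k, 'h) aug_alg \<Rightarrow> ('a, 'g, 'm) bimod \<Rightarrow>
    ('k \<times> ('h \<times> 'm \<Rightarrow>\<^sub>0 int) set \<Rightarrow>\<^sub>0 int) set \<Rightarrow> ('k \<times> 'm \<Rightarrow>\<^sub>0 int) set" where
  "reduce_base_change K G D M X =
     tensor_class (fst G) (along K (snd G)) M
       (frag_extend
          (\<lambda>(c, Y). frag_extend (\<lambda>(d, m). frag_of (c \<otimes>\<^bsub>K\<^esub> snd D d, m)) (SOME y. y \<in> Y))
          (SOME x. x \<in> X))"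

section \<open>Classical deformations\<close>

type_synonym ('k, 'a, 'g, 'm, 's) deform =
  "('a, 'g, 'm) bimod \<times> (('k \<times> 'm \<Rightarrow>\<^sub>0 int) set \<Rightarrow> 's)"

definition deformations ::
  "'k ring \<Rightarrow> ('k, 'a) module \<Rightarrow> ('a, 's) rmod \<Rightarrow> ('k, 'g) aug_alg \<Rightarrow>
    ('k, 'a, 'g, 'm, 's) deform set" where
  "deformations K A S G = {(M, f). tensor_module K A (fst G) M \<and> flat (fst G) M \<and>
     f \<in> rmod_iso A (base_change (fst G) K (snd G) M) S}"

definition deform_iso ::
  "'k ring \<Rightarrow> ('k, 'a) module \<Rightarrow> ('k, 'g) aug_alg \<Rightarrow>
    ('k, 'a, 'g, 'm, 's) deform \<Rightarrow> ('k, 'a, 'g, 'n, 's) deform \<Rightarrow> bool" where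
  "deform_iso K A G D D' \<longleftrightarrow> (\<exists>\<phi> \<in> bimod_iso A (fst G) (fst D) (fst D').
     \<forall>X \<in> carrier (base_change (fst G) K (snd G) (fst D)).
       snd D X = snd D' (tensor_map (fst G) (along K (snd G)) (fst D') id \<phi> X))"

definition Def_cl ::
  "'k ring \<Rightarrow> ('k, 'a) module \<Rightarrow> ('a, 's) rmod \<Rightarrow> ('k, 'g) aug_alg \<Rightarrow>
    ('k, 'a, 'g, 'm, 's) deform set set" where
  "Def_cl K A S G = deformations K A S G //
     {(D, D'). D \<in> deformations K A S G \<and> D' \<in> deformations K A S G \<and> deform_iso K A G D D'}"

definition deform_base_change ::
  "'k ring \<Rightarrow> ('k, 'g) aug_alg \<Rightarrow> ('k, 'h) aug_alg \<Rightarrow> ('g \<Rightarrow> 'h) \<Rightarrow>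
    ('k, 'a, 'g, 'm, 's) deform \<Rightarrow>
    ('k, 'a, 'h, ('h \<times> 'm \<Rightarrow>\<^sub>0 int) set, 's) deform" where
  "deform_base_change K G H \<phi> D =
     (base_change (fst G) (fst H) \<phi> (fst D), \<lambda>X. snd D (reduce_base_change K G H (fst D) X))"

text \<open>The tensor product lives in another type than the given deformation; the induced map on
  isomorphism classes collects its isomorphic copies in the type at hand.\<close>

definition Def_cl_map ::
  "'k ring \<Rightarrow> ('k, 'a) module \<Rightarrow> ('a, 's) rmod \<Rightarrow> ('k, 'g) aug_alg \<Rightarrow> ('k, 'h) aug_alg \<Rightarrow>
    ('g \<Rightarrow> 'h) \<Rightarrow> ('k, 'a, 'g, 'm, 's) deform set \<Rightarrow> ('k, 'a, 'h, 'm, 's) deform set" where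
  "Def_cl_map K A S G H \<phi> C = {D' \<in> deformations K A S H.
     \<exists>D \<in> C. deform_iso K A H (deform_base_change K G H \<phi> D) D'}"

section \<open>The simple module\<close>

definition right_ideal :: "'a set \<Rightarrow> ('a, 'x) ring_scheme \<Rightarrow> bool" where
  "right_ideal J R \<longleftrightarrow> additive_subgroup J R \<and>
     (\<forall>x \<in> J. \<forall>r \<in> carrier R. x \<otimes>\<^bsub>R\<^esub> r \<in> J)"

definition maximal_right_ideal :: "'a set \<Rightarrow> ('a, 'x) ring_scheme \<Rightarrow> bool" where
  "maximal_right_ideal J R \<longleftrightarrow> right_ideal J R \<and> J \<noteq> carrier R \<and>
     (\<forall>J'. right_ideal J' R \<and> J \<subseteq> J' \<longrightarrow> J' = J \<or> J' = carrier R)"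

definition jacobson_radical :: "('a, 'x) ring_scheme \<Rightarrow> 'a set" where
  "jacobson_radical R = carrier R \<inter> \<Inter> {J. maximal_right_ideal J R}"

text \<open>The quotient of $A/AeA$ by its radical, with \<open>A\<close> acting by right multiplication.\<close>

definition simple_quot :: "('k, 'a) module \<Rightarrow> 'a \<Rightarrow> ('a, 'a set set) rmod" where
  "simple_quot A e = (let B = idem_quot A e; J = jacobson_radical B; L = B Quot J in
     \<lparr>carrier = carrier L, mult = mult L, one = one L, ring.zero = ring.zero L, add = add L,
      ract = (\<lambda>X a. X \<otimes>\<^bsub>L\<^esub> (J +>\<^bsub>B\<^esub> (Idl\<^bsub>A\<^esub> {e} +>\<^bsub>A\<^esub> a)))\<rparr>)"

end

theory Submission
  imports Defs
begin

text \<open>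
  The simple module $S$ is one-dimensional: it is the ground field with \<open>A\<close> acting through the
  character $\chi$ obtained by composing $A \to A/AeA$ with the augmentation. A deformation
  $\tilde S$ of $S$ over $\Gamma$ is then free of rank one over $\Gamma$. Indeed, let \<open>b\<close> lift the
  generator of $S$. By Nakayama's lemma, which holds for all modules because the augmentation
  ideal is nilpotent, $\Gamma b = \tilde S$. If $g b = 0$, then $g \otimes b$ vanishes in
  $\Gamma \otimes \tilde S$, so by flatness it vanishes in $g\Gamma \otimes \tilde S$, and this
  says that $g = g z$ for some $z$ with $z b = 0$. Such a $z$ lies in the augmentation ideal, so
  $1 - z$ is a unit and $g = 0$ (lemmas \<open>annihilator_flat\<close> and \<open>framed_exists\<close>).

  On the basis element \<open>b\<close> the action of \<open>A\<close> reads $b \cdot a = r(a)\, b$. As the two actions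
  commute, \<open>r\<close> is an algebra homomorphism $A \to \Gamma$, and it lifts $\chi$. It maps \<open>e\<close> to an
  idempotent of the nilpotent augmentation ideal, that is to $0$, so it factors through $A/AeA$
  (lemma \<open>descend\<close>). A second lift of the same generator has the form $u b$ with \<open>u\<close> a unit of
  augmentation $1$, and replaces \<open>r\<close> by $u r u^{-1}$. Every unit is a central scalar times one of
  augmentation $1$, so these conjugations realise all inner automorphisms. Conversely, any such
  \<open>r\<close> turns $\Gamma$ itself into a deformation (lemma \<open>framed_regular\<close>).

  The relation between deformations and homomorphisms that \<open>framed\<close> expresses therefore induces
  a bijection between isomorphism classes and orbits. After base change along
  $\varphi : \Gamma \to \Delta$ the element $1 \otimes b$ is a basis on which \<open>A\<close> acts through
  $\varphi \circ r$ (lemma \<open>framed_base_change\<close>), which is the functoriality.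

  All computations in tensor products rest on one principle: an additive map on the free abelian
  group of pairs that sends the defining relations into a subgroup \<open>H\<close> sends every null element
  into \<open>H\<close> (lemma \<open>null_into_subgroup\<close>). Working with a subgroup \<open>H\<close> of the target, and not with
  the quotient by \<open>H\<close>, avoids the construction of quotient modules.
\<close>

section \<open>Maps out of free abelian groups\<close>

lemma (in abelian_group) minus_add_cancel:
  "\<lbrakk>x \<in> carrier G; y \<in> carrier G\<rbrakk> \<Longrightarrow> x \<ominus> y \<oplus> y = x"
  by (simp add: a_minus_def a_assoc l_neg)

lemma (in abelian_group) add_minus_minus_cancel:
  assumes "x \<in> carrier G" "y \<in> carrier G"
  shows "x \<oplus> y \<ominus> x \<ominus> y = \<zero>"
proof -
  have "x \<oplus> y \<ominus> x = y"
    using assms by (simp add: a_minus_def a_comm[of _ "\<ominus> x"] r_neg1)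
  then show ?thesis using assms by (simp add: a_minus_def r_neg)
qed

lemma keys_diff_subset:
  "Poly_Mapping.keys z \<subseteq> S \<Longrightarrow> Poly_Mapping.keys z' \<subseteq> S \<Longrightarrow> Poly_Mapping.keys (z - z') \<subseteq> S"
  using keys_diff[of z z'] by blast

lemma keys_add_subset:
  "Poly_Mapping.keys z \<subseteq> S \<Longrightarrow> Poly_Mapping.keys z' \<subseteq> S \<Longrightarrow> Poly_Mapping.keys (z + z') \<subseteq> S"
  using keys_add[of z z'] by blast

lemma hom_free_diff:
  assumes "group X" "h \<in> hom (free_Abelian_group S) X"
    "Poly_Mapping.keys z \<subseteq> S" "Poly_Mapping.keys z' \<subseteq> S"
  shows "h (z - z') = h z \<otimes>\<^bsub>X\<^esub> inv\<^bsub>X\<^esub> h z'"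
proof -
  interpret group_hom "free_Abelian_group S" X h
    using assms by (simp add: group_hom_def group_hom_axioms_def)
  have "h (z \<otimes>\<^bsub>free_Abelian_group S\<^esub> inv\<^bsub>free_Abelian_group S\<^esub> z') = h z \<otimes>\<^bsub>X\<^esub> inv\<^bsub>X\<^esub> h z'"
    using assms by (subst hom_mult) (auto simp del: carrier_free_Abelian_group_iff inv_free_Abelian_group
        simp flip: carrier_free_Abelian_group_iff[of _ S])
  then show ?thesis using assms by simp
qed

lemma hom_free_eq:
  assumes "group X" "h \<in> hom (free_Abelian_group S) X" "h' \<in> hom (free_Abelian_group S) X"
    "\<And>x. x \<in> S \<Longrightarrow> h (frag_of x) = h' (frag_of x)" "Poly_Mapping.keys z \<subseteq> S"
  shows "h z = h' z"
proof (rule free_Abelian_group_induct[OF assms(5)])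
  show "h 0 = h' 0"
    using hom_free_diff[OF assms(1,2), of 0 0] hom_free_diff[OF assms(1,3), of 0 0]
      hom_in_carrier[OF assms(2), of 0] hom_in_carrier[OF assms(3), of 0]
      group.r_inv[OF assms(1)] by simp
  show "h (x - y) = h' (x - y)"
    if "Poly_Mapping.keys x \<subseteq> S" "Poly_Mapping.keys y \<subseteq> S" "h x = h' x" "h y = h' y" for x y
    using that hom_free_diff assms(1-3) by metis
qed (rule assms(4))

definition free_ext ::
  "('b, 'y) ring_scheme \<Rightarrow> 'c set \<Rightarrow> ('c \<Rightarrow> 'b) \<Rightarrow> ('c \<Rightarrow>\<^sub>0 int) \<Rightarrow> 'b" where
  "free_ext X S f = (SOME h. h \<in> hom (free_Abelian_group S) (add_monoid X) \<and>
     (\<forall>x\<in>S. h (frag_of x) = f x))"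

lemma (in abelian_group)
  assumes "f \<in> S \<rightarrow> carrier G"
  shows free_ext_hom: "free_ext G S f \<in> hom (free_Abelian_group S) (add_monoid G)"
    and free_ext_of: "x \<in> S \<Longrightarrow> free_ext G S f (frag_of x) = f x"
proof -
  have "f ` S \<subseteq> carrier (add_monoid G)" using assms by auto
  then obtain h where "h \<in> hom (free_Abelian_group S) (add_monoid G)"
    "\<And>x. x \<in> S \<Longrightarrow> h (frag_of x) = f x"
    using comm_group.free_Abelian_group_universal[OF a_comm_group] by blast
  then have "\<exists>h. h \<in> hom (free_Abelian_group S) (add_monoid G) \<and> (\<forall>x\<in>S. h (frag_of x) = f x)"
    by blast
  from someI_ex[OF this]
  show "free_ext G S f \<in> hom (free_Abelian_group S) (add_monoid G)"
    and "x \<in> S \<Longrightarrow> free_ext G S f (frag_of x) = f x"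
    unfolding free_ext_def by auto
qed

lemma (in abelian_group)
  assumes "f \<in> S \<rightarrow> carrier G" "Poly_Mapping.keys z \<subseteq> S" "Poly_Mapping.keys z' \<subseteq> S"
  shows free_ext_closed: "free_ext G S f z \<in> carrier G"
    and free_ext_add: "free_ext G S f (z + z') = free_ext G S f z \<oplus> free_ext G S f z'"
    and free_ext_diff: "free_ext G S f (z - z') = free_ext G S f z \<ominus> free_ext G S f z'"
proof -
  note h = free_ext_hom[OF assms(1)]
  show "free_ext G S f z \<in> carrier G"
    using hom_in_carrier[OF h, of z] assms(2) by simp
  show "free_ext G S f (z + z') = free_ext G S f z \<oplus> free_ext G S f z'"
    using hom_mult[OF h, of z z'] assms(2,3) by simp
  show "free_ext G S f (z - z') = free_ext G S f z \<ominus> free_ext G S f z'"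
    using hom_free_diff[OF a_group h assms(2,3)] by (simp add: a_minus_def a_inv_def)
qed

section \<open>Tensor products by generators and relations\<close>

locale tensor_pair = tensor_module K A \<Gamma> M + N: right_module \<Gamma> N
  for K :: "'k ring" and A :: "('k, 'a) module" and \<Gamma> :: "('k, 'g) module"
    and M :: "('a, 'g, 'm) bimod" and N :: "('g, 'n) rmod"
begin

abbreviation gens where "gens \<equiv> carrier N \<times> carrier M"
abbreviation null where "null \<equiv> tensor_null \<Gamma> N M"
abbreviation cls where "cls \<equiv> tensor_class \<Gamma> N M"
abbreviation pure where "pure n m \<equiv> tensor_class \<Gamma> N M (frag_of (n, m))"

lemma rels_keys: "z \<in> tensor_rels \<Gamma> N M \<Longrightarrow> Poly_Mapping.keys z \<subseteq> gens"
  unfolding tensor_rels_def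
  by (elim UnE CollectE exE conjE; simp only:; intro keys_diff_subset)
     (auto simp: N.ract_closed lact_closed)

lemma null_subgroup: "subgroup null (free_Abelian_group gens)"
  unfolding tensor_null_def tensor_free_def
  using group.generate_is_subgroup[OF group_free_Abelian_group] rels_keys
  by (metis carrier_free_Abelian_group_iff subsetI)

lemma null_keys: "z \<in> null \<Longrightarrow> Poly_Mapping.keys z \<subseteq> gens"
  using subgroup.mem_carrier[OF null_subgroup] by simp

lemma null_zero: "0 \<in> null"
  using subgroup.one_closed[OF null_subgroup] by simp

lemma null_add: "z \<in> null \<Longrightarrow> z' \<in> null \<Longrightarrow> z + z' \<in> null"
  using subgroup.m_closed[OF null_subgroup] by simp

lemma null_uminus: "z \<in> null \<Longrightarrow> - z \<in> null"
  using subgroup.m_inv_closed[OF null_subgroup, of z] null_keys by simp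

lemma null_diff: "z \<in> null \<Longrightarrow> z' \<in> null \<Longrightarrow> z - z' \<in> null"
  using null_add[of z "- z'"] null_uminus by simp

lemma null_rels: "z \<in> tensor_rels \<Gamma> N M \<Longrightarrow> z \<in> null"
  unfolding tensor_null_def by (rule generate.incl)

lemma null_add_left:
  "\<lbrakk>x \<in> carrier N; x' \<in> carrier N; y \<in> carrier M\<rbrakk> \<Longrightarrow>
    frag_of (x \<oplus>\<^bsub>N\<^esub> x', y) - frag_of (x, y) - frag_of (x', y) \<in> null"
  by (rule null_rels) (auto simp: tensor_rels_def)

lemma null_add_right:
  "\<lbrakk>x \<in> carrier N; y \<in> carrier M; y' \<in> carrier M\<rbrakk> \<Longrightarrow>
    frag_of (x, y \<oplus>\<^bsub>M\<^esub> y') - frag_of (x, y) - frag_of (x, y') \<in> null"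
  by (rule null_rels) (auto simp: tensor_rels_def)

lemma null_balance:
  "\<lbrakk>x \<in> carrier N; g \<in> carrier \<Gamma>; y \<in> carrier M\<rbrakk> \<Longrightarrow>
    frag_of (ract N x g, y) - frag_of (x, lact M g y) \<in> null"
  by (rule null_rels) (auto simp: tensor_rels_def)

lemma cls_translates: "cls z = {n + z | n. n \<in> null}"
  unfolding tensor_class_def tensor_free_def r_coset_def by auto

lemma cls_mem: "z' \<in> cls z \<longleftrightarrow> z' - z \<in> null"
  unfolding cls_translates by (auto intro!: exI[of _ "z' - z"])

lemma cls_eq: "cls z = cls z' \<longleftrightarrow> z - z' \<in> null"
proof
  assume "cls z = cls z'"
  moreover have "z \<in> cls z" using null_zero by (simp add: cls_mem)
  ultimately show "z - z' \<in> null" by (simp add: cls_mem)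
next
  assume d: "z - z' \<in> null"
  have "w - z \<in> null \<longleftrightarrow> w - z' \<in> null" for w
    using null_add[OF _ d, of "w - z"] null_diff[OF _ d, of "w - z'"] by auto
  then show "cls z = cls z'" by (auto simp: cls_mem)
qed

lemma carrier_tensor: "carrier (tensor \<Gamma> N M) = cls ` {z. Poly_Mapping.keys z \<subseteq> gens}"
  unfolding tensor_def FactGroup_def RCOSETS_def tensor_class_def tensor_free_def by auto

lemma one_tensor: "\<one>\<^bsub>tensor \<Gamma> N M\<^esub> = cls 0"
  unfolding tensor_def FactGroup_def cls_translates by auto

lemma mult_tensor: "cls z \<otimes>\<^bsub>tensor \<Gamma> N M\<^esub> cls z' = cls (z + z')"
proof -
  have "cls z \<otimes>\<^bsub>tensor \<Gamma> N M\<^esub> cls z' = {x + y | x y. x \<in> cls z \<and> y \<in> cls z'}"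
    unfolding tensor_def FactGroup_def tensor_free_def set_mult_def by auto
  also have "\<dots> = cls (z + z')"
  proof (intro equalityI subsetI)
    fix w assume "w \<in> {x + y | x y. x \<in> cls z \<and> y \<in> cls z'}"
    then obtain x y where w: "w = x + y" and "x - z \<in> null" "y - z' \<in> null"
      by (auto simp: cls_mem)
    then have "(x - z) + (y - z') \<in> null" using null_add by blast
    moreover have "(x - z) + (y - z') = w - (z + z')" by (simp add: w)
    ultimately show "w \<in> cls (z + z')" by (simp add: cls_mem)
  next
    fix w assume "w \<in> cls (z + z')"
    then have "w - z' \<in> cls z" "z' \<in> cls z'" by (simp_all add: cls_mem null_zero algebra_simps)
    moreover have "w = (w - z') + z'" by simp
    ultimately show "w \<in> {x + y | x y. x \<in> cls z \<and> y \<in> cls z'}" by blast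
  qed
  finally show ?thesis .
qed

lemma pure_closed: "n \<in> carrier N \<Longrightarrow> m \<in> carrier M \<Longrightarrow> pure n m \<in> carrier (tensor \<Gamma> N M)"
  unfolding carrier_tensor by (intro imageI) simp

lemma pure_add_left:
  "\<lbrakk>x \<in> carrier N; x' \<in> carrier N; y \<in> carrier M\<rbrakk> \<Longrightarrow>
    pure (x \<oplus>\<^bsub>N\<^esub> x') y = pure x y \<otimes>\<^bsub>tensor \<Gamma> N M\<^esub> pure x' y"
  using null_add_left by (simp add: mult_tensor cls_eq diff_diff_eq)

lemma pure_add_right:
  "\<lbrakk>x \<in> carrier N; y \<in> carrier M; y' \<in> carrier M\<rbrakk> \<Longrightarrow>
    pure x (y \<oplus>\<^bsub>M\<^esub> y') = pure x y \<otimes>\<^bsub>tensor \<Gamma> N M\<^esub> pure x y'"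
  using null_add_right by (simp add: mult_tensor cls_eq diff_diff_eq)

lemma pure_balance:
  "\<lbrakk>x \<in> carrier N; g \<in> carrier \<Gamma>; y \<in> carrier M\<rbrakk> \<Longrightarrow> pure (ract N x g) y = pure x (lact M g y)"
  using null_balance by (simp add: cls_eq)

lemma pure_zero_left:
  assumes "y \<in> carrier M" shows "pure \<zero>\<^bsub>N\<^esub> y = cls 0"
proof -
  have "frag_of (\<zero>\<^bsub>N\<^esub> \<oplus>\<^bsub>N\<^esub> \<zero>\<^bsub>N\<^esub>, y) - frag_of (\<zero>\<^bsub>N\<^esub>, y) - frag_of (\<zero>\<^bsub>N\<^esub>, y) \<in> null"
    using assms by (intro null_add_left) auto
  then have "- frag_of (\<zero>\<^bsub>N\<^esub>, y) \<in> null" by simp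
  from null_uminus[OF this] show ?thesis by (simp add: cls_eq)
qed

lemma pure_zero_right:
  assumes "x \<in> carrier N" shows "pure x \<zero>\<^bsub>M\<^esub> = cls 0"
proof -
  have "frag_of (x, \<zero>\<^bsub>M\<^esub> \<oplus>\<^bsub>M\<^esub> \<zero>\<^bsub>M\<^esub>) - frag_of (x, \<zero>\<^bsub>M\<^esub>) - frag_of (x, \<zero>\<^bsub>M\<^esub>) \<in> null"
    using assms by (intro null_add_right) auto
  then have "- frag_of (x, \<zero>\<^bsub>M\<^esub>) \<in> null" by simp
  from null_uminus[OF this] show ?thesis by (simp add: cls_eq)
qed

text \<open>The universal property of the tensor product, stated relative to a subgroup \<open>H\<close> of the target.
  A balanced map into the quotient of \<open>X\<close> by \<open>H\<close> is replaced by a map into \<open>X\<close> that is additive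
  and balanced up to elements of \<open>H\<close>; this leaves room for arbitrary choices of
  representatives.\<close>
lemma null_into_subgroup:
  fixes X :: "('x, 'w) ring_scheme"
  assumes X: "abelian_group X" and H: "subgroup H (add_monoid X)"
    and f: "f \<in> gens \<rightarrow> carrier X"
    and addl: "\<And>x x' y. \<lbrakk>x \<in> carrier N; x' \<in> carrier N; y \<in> carrier M\<rbrakk> \<Longrightarrow>
      f (x \<oplus>\<^bsub>N\<^esub> x', y) \<ominus>\<^bsub>X\<^esub> f (x, y) \<ominus>\<^bsub>X\<^esub> f (x', y) \<in> H"
    and addr: "\<And>x y y'. \<lbrakk>x \<in> carrier N; y \<in> carrier M; y' \<in> carrier M\<rbrakk> \<Longrightarrow>
      f (x, y \<oplus>\<^bsub>M\<^esub> y') \<ominus>\<^bsub>X\<^esub> f (x, y) \<ominus>\<^bsub>X\<^esub> f (x, y') \<in> H"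
    and bal: "\<And>x g y. \<lbrakk>x \<in> carrier N; g \<in> carrier \<Gamma>; y \<in> carrier M\<rbrakk> \<Longrightarrow>
      f (ract N x g, y) \<ominus>\<^bsub>X\<^esub> f (x, lact M g y) \<in> H"
    and z: "z \<in> null"
  shows "free_ext X gens f z \<in> H"
proof -
  interpret X: abelian_group X by fact
  interpret h: group_hom "free_Abelian_group gens" "add_monoid X" "free_ext X gens f"
    using X.free_ext_hom[OF f] X.a_group by (simp add: group_hom_def group_hom_axioms_def)
  note simps = X.free_ext_diff[OF f] X.free_ext_of[OF f] keys_diff_subset
  have rels: "free_ext X gens f w \<in> H" if w: "w \<in> tensor_rels \<Gamma> N M" for w
    using w unfolding tensor_rels_def
    by (elim UnE CollectE exE conjE)
       (simp_all add: simps addl addr bal N.ract_closed lact_closed)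
  from z show ?thesis unfolding tensor_null_def tensor_free_def
  proof (induction rule: generate.induct)
    case one
    then show ?case using h.hom_one subgroup.one_closed[OF H] by simp
  next
    case (incl w)
    then show ?case using rels by blast
  next
    case (inv w)
    then show ?case
      using h.hom_inv[of w] rels_keys[of w] rels subgroup.m_inv_closed[OF H] by simp
  next
    case (eng w w')
    then have "Poly_Mapping.keys w \<subseteq> gens" "Poly_Mapping.keys w' \<subseteq> gens"
      using null_keys by (simp_all add: tensor_null_def tensor_free_def)
    then show ?case using eng X.free_ext_add[OF f] subgroup.m_closed[OF H] by simp
  qed
qed

lemma pure_null_into_subgroup:
  fixes X :: "('x, 'w) ring_scheme"
  assumes "abelian_group X" "subgroup H (add_monoid X)" "f \<in> gens \<rightarrow> carrier X"
    "\<And>x x' y. \<lbrakk>x \<in> carrier N; x' \<in> carrier N; y \<in> carrier M\<rbrakk> \<Longrightarrow>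
      f (x \<oplus>\<^bsub>N\<^esub> x', y) \<ominus>\<^bsub>X\<^esub> f (x, y) \<ominus>\<^bsub>X\<^esub> f (x', y) \<in> H"
    "\<And>x y y'. \<lbrakk>x \<in> carrier N; y \<in> carrier M; y' \<in> carrier M\<rbrakk> \<Longrightarrow>
      f (x, y \<oplus>\<^bsub>M\<^esub> y') \<ominus>\<^bsub>X\<^esub> f (x, y) \<ominus>\<^bsub>X\<^esub> f (x, y') \<in> H"
    "\<And>x g y. \<lbrakk>x \<in> carrier N; g \<in> carrier \<Gamma>; y \<in> carrier M\<rbrakk> \<Longrightarrow>
      f (ract N x g, y) \<ominus>\<^bsub>X\<^esub> f (x, lact M g y) \<in> H"
    and "n \<in> carrier N" "m \<in> carrier M" "pure n m = cls 0"
  shows "f (n, m) \<in> H"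
proof -
  have "free_ext X gens f (frag_of (n, m)) \<in> H"
    using assms by (intro null_into_subgroup) (auto simp: cls_eq)
  then show ?thesis using assms abelian_group.free_ext_of[of X f gens "(n, m)"] by simp
qed

end

lemma keys_frag_extend:
  assumes "\<And>x. x \<in> S \<Longrightarrow> Poly_Mapping.keys (f x) \<subseteq> T" "Poly_Mapping.keys z \<subseteq> S"
  shows "Poly_Mapping.keys (frag_extend f z) \<subseteq> T"
  by (rule free_Abelian_group_induct[OF assms(2)])
     (simp_all add: frag_extend_diff assms(1) keys_diff_subset)

lemma frag_extend_is_hom:
  assumes "\<And>x. x \<in> S \<Longrightarrow> Poly_Mapping.keys (f x) \<subseteq> T"
  shows "frag_extend f \<in> hom (free_Abelian_group S) (free_Abelian_group T)"
  using keys_frag_extend[of S f T, OF assms]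
  by (auto simp: hom_def frag_extend_add subset_iff)

text \<open>The value of \<open>tensor_map\<close> is a union over representatives of a class. All of them contribute
  the same class because the induced map of free abelian groups preserves the defining
  relations.\<close>
lemma tensor_map_class:
  assumes P: "tensor_pair K A \<Gamma> M N" and P': "tensor_pair K' A' \<Gamma> M' N'"
    and f: "f \<in> rmod_hom \<Gamma> N N'"
    and g: "g \<in> carrier M \<rightarrow> carrier M'"
    and g_add: "\<And>x y. \<lbrakk>x \<in> carrier M; y \<in> carrier M\<rbrakk> \<Longrightarrow> g (x \<oplus>\<^bsub>M\<^esub> y) = g x \<oplus>\<^bsub>M'\<^esub> g y"
    and g_lact: "\<And>c x. \<lbrakk>c \<in> carrier \<Gamma>; x \<in> carrier M\<rbrakk> \<Longrightarrow> g (lact M c x) = lact M' c (g x)"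
    and z: "Poly_Mapping.keys z \<subseteq> carrier N \<times> carrier M"
  shows "tensor_map \<Gamma> N' M' f g (tensor_class \<Gamma> N M z) =
    tensor_class \<Gamma> N' M' (frag_extend (\<lambda>(x, y). frag_of (f x, g y)) z)"
proof -
  interpret P: tensor_pair K A \<Gamma> M N by fact
  interpret P': tensor_pair K' A' \<Gamma> M' N' by fact
  let ?e = "frag_extend (\<lambda>(x, y). frag_of (f x, g y))"
  have fc: "f x \<in> carrier N'" if "x \<in> carrier N" for x
    using f that by (auto simp: rmod_hom_def)
  have gc: "g x \<in> carrier M'" if "x \<in> carrier M" for x
    using g that by auto
  have rels: "?e w \<in> P'.null" if w: "w \<in> tensor_rels \<Gamma> N M" for w
  proof -
    have "?e w \<in> tensor_rels \<Gamma> N' M'"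
      using w f fc gc unfolding tensor_rels_def
      apply (elim UnE CollectE exE conjE)
        apply (rule UnI1, rule UnI1, simp add: frag_extend_diff rmod_hom_def, blast)
       apply (rule UnI1, rule UnI2, simp add: frag_extend_diff rmod_hom_def g_add, blast)
      apply (rule UnI2, simp add: frag_extend_diff rmod_hom_def g_lact, blast)
      done
    then show ?thesis by (rule P'.null_rels)
  qed
  have null: "?e w \<in> P'.null" if w: "w \<in> P.null" for w
    using w unfolding tensor_null_def[of \<Gamma> N M] tensor_free_def
  proof (induction rule: generate.induct)
    case one then show ?case using P'.null_zero by simp
  next
    case (incl w) then show ?case using rels by blast
  next
    case (inv w)
    then show ?case using rels P.rels_keys[of w] P'.null_uminus by (simp add: frag_extend_minus)
  next
    case (eng w w') then show ?case using P'.null_add by (simp add: frag_extend_add)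
  qed
  have "P'.cls (?e w) = P'.cls (?e z)" if "w \<in> P.cls z" for w
    using null[of "w - z"] that by (simp add: P.cls_mem P'.cls_eq frag_extend_diff)
  moreover have "z \<in> P.cls z" using P.null_zero by (simp add: P.cls_mem)
  ultimately show ?thesis unfolding tensor_map_def by blast
qed

section \<open>Artinian local algebras\<close>

lemma (in ring) mult_one_minus:
  "\<lbrakk>y \<in> carrier R; x \<in> carrier R\<rbrakk> \<Longrightarrow> y \<otimes> (\<one> \<ominus> x) \<oplus> y \<otimes> x = y"
  by (simp add: a_minus_def r_distr r_minus a_assoc l_neg)

lemma (in ring) one_minus_one_minus:
  "y \<in> carrier R \<Longrightarrow> \<one> \<ominus> (\<one> \<ominus> y) = y"
  by (simp add: a_minus_def minus_add r_neg2)

locale artin = K: field K + \<Gamma>: ring \<Gamma>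
  for K :: "'k ring" and \<Gamma> :: "('k, 'g) module" +
  fixes \<epsilon> :: "'g \<Rightarrow> 'k"
  assumes alg: "k_algebra K \<Gamma>"
    and aug: "\<epsilon> \<in> alg_hom K \<Gamma> (self_algebra K)"
    and nil: "nilpotent_ideal \<Gamma> (a_kernel \<Gamma> K \<epsilon>)"
begin

definition max_ideal where "max_ideal = {x \<in> carrier \<Gamma>. \<epsilon> x = \<zero>\<^bsub>K\<^esub>}"
definition scalar where "scalar c = c \<odot>\<^bsub>\<Gamma>\<^esub> \<one>\<^bsub>\<Gamma>\<^esub>"

lemma module: "module K \<Gamma>"
  using alg unfolding k_algebra_def by blast

lemma aug_closed: "x \<in> carrier \<Gamma> \<Longrightarrow> \<epsilon> x \<in> carrier K"
  and aug_add: "x \<in> carrier \<Gamma> \<Longrightarrow> y \<in> carrier \<Gamma> \<Longrightarrow> \<epsilon> (x \<oplus>\<^bsub>\<Gamma>\<^esub> y) = \<epsilon> x \<oplus>\<^bsub>K\<^esub> \<epsilon> y"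
  and aug_mult: "x \<in> carrier \<Gamma> \<Longrightarrow> y \<in> carrier \<Gamma> \<Longrightarrow> \<epsilon> (x \<otimes>\<^bsub>\<Gamma>\<^esub> y) = \<epsilon> x \<otimes>\<^bsub>K\<^esub> \<epsilon> y"
  and aug_one: "\<epsilon> \<one>\<^bsub>\<Gamma>\<^esub> = \<one>\<^bsub>K\<^esub>"
  and aug_smult: "c \<in> carrier K \<Longrightarrow> x \<in> carrier \<Gamma> \<Longrightarrow> \<epsilon> (c \<odot>\<^bsub>\<Gamma>\<^esub> x) = c \<otimes>\<^bsub>K\<^esub> \<epsilon> x"
  using aug by (auto simp: alg_hom_def self_algebra_def ring_hom_def)

lemma aug_ring_hom: "\<epsilon> \<in> ring_hom \<Gamma> K"
  using aug by (auto simp: alg_hom_def self_algebra_def ring_hom_def)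

sublocale aug: ring_hom_ring \<Gamma> K \<epsilon>
  by (rule ring_hom_ringI2[OF \<Gamma>.ring_axioms K.ring_axioms aug_ring_hom])

lemma max_ideal_eq_kernel: "max_ideal = a_kernel \<Gamma> K \<epsilon>"
  unfolding max_ideal_def a_kernel_def' ..

lemma max_ideal_ideal: "ideal max_ideal \<Gamma>"
  using aug.kernel_is_ideal unfolding max_ideal_eq_kernel .

lemma scalar_closed: "c \<in> carrier K \<Longrightarrow> scalar c \<in> carrier \<Gamma>"
  unfolding scalar_def using module.smult_closed[OF module] by simp

lemma scalar_left:
  assumes "c \<in> carrier K" "x \<in> carrier \<Gamma>" shows "scalar c \<otimes>\<^bsub>\<Gamma>\<^esub> x = c \<odot>\<^bsub>\<Gamma>\<^esub> x"
  using assms k_algebra.smult_mult_left[OF alg, of c "\<one>\<^bsub>\<Gamma>\<^esub>" x] by (simp add: scalar_def)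

lemma scalar_right:
  assumes "c \<in> carrier K" "x \<in> carrier \<Gamma>" shows "x \<otimes>\<^bsub>\<Gamma>\<^esub> scalar c = c \<odot>\<^bsub>\<Gamma>\<^esub> x"
  using assms k_algebra.smult_mult_right[OF alg, of c x "\<one>\<^bsub>\<Gamma>\<^esub>"] by (simp add: scalar_def)

lemma aug_scalar: "c \<in> carrier K \<Longrightarrow> \<epsilon> (scalar c) = c"
  by (simp add: scalar_def aug_smult aug_one)

lemma scalar_mult:
  assumes "c \<in> carrier K" "d \<in> carrier K" shows "scalar c \<otimes>\<^bsub>\<Gamma>\<^esub> scalar d = scalar (c \<otimes>\<^bsub>K\<^esub> d)"
  using assms scalar_left[OF assms(1) scalar_closed[OF assms(2)]]
    module.smult_assoc1[OF module, of c d "\<one>\<^bsub>\<Gamma>\<^esub>"]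
  by (simp add: scalar_def)

lemma scalar_one: "scalar \<one>\<^bsub>K\<^esub> = \<one>\<^bsub>\<Gamma>\<^esub>"
  using module.smult_one[OF module] by (simp add: scalar_def)

text \<open>If the property failed at \<open>y\<close>, it would fail at some $y x_1$, then at some $y x_1 x_2$, and so
  on, with all $x_i$ in the augmentation ideal; but such products vanish from some length on. All
  uses of nilpotency go through this principle, with Nakayama's lemma as the main one.\<close>
lemma nilpotent_induct:
  assumes y: "y \<in> carrier \<Gamma>" and P0: "P \<zero>\<^bsub>\<Gamma>\<^esub>"
    and step: "\<And>y. \<lbrakk>y \<in> carrier \<Gamma>; \<And>x. x \<in> max_ideal \<Longrightarrow> P (y \<otimes>\<^bsub>\<Gamma>\<^esub> x)\<rbrakk> \<Longrightarrow> P y"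
  shows "P y"
proof -
  define J where "J j = (ideal_prod \<Gamma> max_ideal ^^ j) (carrier \<Gamma>)" for j
  obtain n where n: "J n = {\<zero>\<^bsub>\<Gamma>\<^esub>}"
    using nil unfolding nilpotent_ideal_def J_def max_ideal_eq_kernel by blast
  have ideal: "ideal (J j) \<Gamma>" for j
    by (induction j) (simp_all add: J_def \<Gamma>.oneideal \<Gamma>.ideal_prod_is_ideal max_ideal_ideal)
  have *: "\<forall>y\<in>carrier \<Gamma>. (\<forall>z\<in>J j. P (y \<otimes>\<^bsub>\<Gamma>\<^esub> z)) \<longrightarrow> P y" for j
  proof (induction j)
    case 0
    show ?case by (auto simp: J_def dest!: bspec[of _ _ "\<one>\<^bsub>\<Gamma>\<^esub>"])
  next
    case (Suc j)
    show ?case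
    proof (intro ballI impI)
      fix y assume y: "y \<in> carrier \<Gamma>" and P: "\<forall>z\<in>J (Suc j). P (y \<otimes>\<^bsub>\<Gamma>\<^esub> z)"
      show "P y"
      proof (rule step[OF y])
        fix x assume x: "x \<in> max_ideal"
        then have xc: "x \<in> carrier \<Gamma>" by (simp add: max_ideal_def)
        have "P (y \<otimes>\<^bsub>\<Gamma>\<^esub> x \<otimes>\<^bsub>\<Gamma>\<^esub> z)" if z: "z \<in> J j" for z
        proof -
          have "x \<otimes>\<^bsub>\<Gamma>\<^esub> z \<in> J (Suc j)" using x z by (simp add: J_def ideal_prod.prod)
          moreover have "z \<in> carrier \<Gamma>" using z ideal.Icarr[OF ideal] by blast
          ultimately show ?thesis using P y xc by (simp add: \<Gamma>.m_assoc)
        qed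
        then show "P (y \<otimes>\<^bsub>\<Gamma>\<^esub> x)" using Suc y xc by blast
      qed
    qed
  qed
  show ?thesis using *[of n] y P0 by (simp add: n)
qed

lemma one_minus_left_inv:
  assumes x: "x \<in> max_ideal"
  shows "\<exists>z\<in>carrier \<Gamma>. z \<otimes>\<^bsub>\<Gamma>\<^esub> (\<one>\<^bsub>\<Gamma>\<^esub> \<ominus>\<^bsub>\<Gamma>\<^esub> x) = \<one>\<^bsub>\<Gamma>\<^esub>"
proof -
  have xc: "x \<in> carrier \<Gamma>" using x by (simp add: max_ideal_def)
  show ?thesis
  proof (rule nilpotent_induct[of "\<one>\<^bsub>\<Gamma>\<^esub>" "\<lambda>y. \<exists>z\<in>carrier \<Gamma>. z \<otimes>\<^bsub>\<Gamma>\<^esub> (\<one>\<^bsub>\<Gamma>\<^esub> \<ominus>\<^bsub>\<Gamma>\<^esub> x) = y"])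
    show "\<exists>z\<in>carrier \<Gamma>. z \<otimes>\<^bsub>\<Gamma>\<^esub> (\<one>\<^bsub>\<Gamma>\<^esub> \<ominus>\<^bsub>\<Gamma>\<^esub> x) = \<zero>\<^bsub>\<Gamma>\<^esub>"
      using xc by (intro bexI[of _ "\<zero>\<^bsub>\<Gamma>\<^esub>"]) auto
    fix y assume y: "y \<in> carrier \<Gamma>"
      and "\<And>x'. x' \<in> max_ideal \<Longrightarrow> \<exists>z\<in>carrier \<Gamma>. z \<otimes>\<^bsub>\<Gamma>\<^esub> (\<one>\<^bsub>\<Gamma>\<^esub> \<ominus>\<^bsub>\<Gamma>\<^esub> x) = y \<otimes>\<^bsub>\<Gamma>\<^esub> x'"
    then obtain z where z: "z \<in> carrier \<Gamma>" "z \<otimes>\<^bsub>\<Gamma>\<^esub> (\<one>\<^bsub>\<Gamma>\<^esub> \<ominus>\<^bsub>\<Gamma>\<^esub> x) = y \<otimes>\<^bsub>\<Gamma>\<^esub> x"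
      using x by blast
    have "(y \<oplus>\<^bsub>\<Gamma>\<^esub> z) \<otimes>\<^bsub>\<Gamma>\<^esub> (\<one>\<^bsub>\<Gamma>\<^esub> \<ominus>\<^bsub>\<Gamma>\<^esub> x) = y \<otimes>\<^bsub>\<Gamma>\<^esub> (\<one>\<^bsub>\<Gamma>\<^esub> \<ominus>\<^bsub>\<Gamma>\<^esub> x) \<oplus>\<^bsub>\<Gamma>\<^esub> y \<otimes>\<^bsub>\<Gamma>\<^esub> x"
      using y z xc by (simp add: \<Gamma>.l_distr)
    also have "\<dots> = y" using y xc by (rule \<Gamma>.mult_one_minus)
    finally show "\<exists>z\<in>carrier \<Gamma>. z \<otimes>\<^bsub>\<Gamma>\<^esub> (\<one>\<^bsub>\<Gamma>\<^esub> \<ominus>\<^bsub>\<Gamma>\<^esub> x) = y" using y z by blast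
  qed simp
qed

text \<open>A left inverse of $1 - x$ is again of the form $1 - x'$ with $x'$ in the augmentation ideal, so
  it has a left inverse itself and both inverses are two-sided.\<close>
lemma one_minus_unit:
  assumes x: "x \<in> max_ideal" shows "\<one>\<^bsub>\<Gamma>\<^esub> \<ominus>\<^bsub>\<Gamma>\<^esub> x \<in> Units \<Gamma>"
proof -
  let ?u = "\<one>\<^bsub>\<Gamma>\<^esub> \<ominus>\<^bsub>\<Gamma>\<^esub> x"
  have xc: "x \<in> carrier \<Gamma>" using x by (simp add: max_ideal_def)
  then have uc: "?u \<in> carrier \<Gamma>" by simp
  obtain z where z: "z \<in> carrier \<Gamma>" "z \<otimes>\<^bsub>\<Gamma>\<^esub> ?u = \<one>\<^bsub>\<Gamma>\<^esub>" using one_minus_left_inv[OF x] by blast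
  define x' where "x' = \<ominus>\<^bsub>\<Gamma>\<^esub> (z \<otimes>\<^bsub>\<Gamma>\<^esub> x)"
  have "x' \<in> max_ideal"
    using x z xc by (simp add: x'_def max_ideal_def aug_mult aug_closed)
  moreover have "z = \<one>\<^bsub>\<Gamma>\<^esub> \<ominus>\<^bsub>\<Gamma>\<^esub> x'"
  proof -
    have "\<one>\<^bsub>\<Gamma>\<^esub> \<ominus>\<^bsub>\<Gamma>\<^esub> x' = z \<otimes>\<^bsub>\<Gamma>\<^esub> ?u \<oplus>\<^bsub>\<Gamma>\<^esub> z \<otimes>\<^bsub>\<Gamma>\<^esub> x"
      using xc z by (simp add: x'_def a_minus_def)
    also have "\<dots> = z" using z(1) xc by (rule \<Gamma>.mult_one_minus)
    finally show ?thesis by simp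
  qed
  ultimately obtain w where w: "w \<in> carrier \<Gamma>" "w \<otimes>\<^bsub>\<Gamma>\<^esub> z = \<one>\<^bsub>\<Gamma>\<^esub>"
    using one_minus_left_inv by metis
  have "w = w \<otimes>\<^bsub>\<Gamma>\<^esub> (z \<otimes>\<^bsub>\<Gamma>\<^esub> ?u)" using w z by simp
  also have "\<dots> = (w \<otimes>\<^bsub>\<Gamma>\<^esub> z) \<otimes>\<^bsub>\<Gamma>\<^esub> ?u" by (rule \<Gamma>.m_assoc[OF w(1) z(1) uc, symmetric])
  also have "\<dots> = ?u" using w uc by simp
  finally have "?u \<otimes>\<^bsub>\<Gamma>\<^esub> z = \<one>\<^bsub>\<Gamma>\<^esub>" using w by simp
  then show ?thesis unfolding Units_def using z uc by blast
qed

text \<open>An element of nonzero augmentation \<open>c\<close> is \<open>c\<close> times an element of augmentation $1$.\<close>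
lemma unit_if_aug_nonzero:
  assumes u: "u \<in> carrier \<Gamma>" and nz: "\<epsilon> u \<noteq> \<zero>\<^bsub>K\<^esub>" shows "u \<in> Units \<Gamma>"
proof -
  define c where "c = inv\<^bsub>K\<^esub> (\<epsilon> u)"
  have eu: "\<epsilon> u \<in> Units K" using aug_closed[OF u] nz K.field_Units by blast
  then have c: "c \<in> carrier K" "c \<otimes>\<^bsub>K\<^esub> \<epsilon> u = \<one>\<^bsub>K\<^esub>" "\<epsilon> u \<otimes>\<^bsub>K\<^esub> c = \<one>\<^bsub>K\<^esub>"
    unfolding c_def by simp_all
  let ?x = "\<one>\<^bsub>\<Gamma>\<^esub> \<ominus>\<^bsub>\<Gamma>\<^esub> scalar c \<otimes>\<^bsub>\<Gamma>\<^esub> u"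
  have sc: "scalar c \<in> carrier \<Gamma>" "scalar (\<epsilon> u) \<in> carrier \<Gamma>"
    using c aug_closed[OF u] by (simp_all add: scalar_closed)
  have "?x \<in> max_ideal"
    using c u sc aug_closed[OF u]
    by (simp add: max_ideal_def a_minus_def aug_add aug_one aug_mult aug_scalar K.r_neg)
  then have "\<one>\<^bsub>\<Gamma>\<^esub> \<ominus>\<^bsub>\<Gamma>\<^esub> ?x \<in> Units \<Gamma>" by (rule one_minus_unit)
  moreover have "\<one>\<^bsub>\<Gamma>\<^esub> \<ominus>\<^bsub>\<Gamma>\<^esub> ?x = scalar c \<otimes>\<^bsub>\<Gamma>\<^esub> u"
  proof -
    have "scalar c \<otimes>\<^bsub>\<Gamma>\<^esub> u \<in> carrier \<Gamma>" using sc u by simp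
    then show ?thesis by (rule \<Gamma>.one_minus_one_minus)
  qed
  moreover have "scalar (\<epsilon> u) \<in> Units \<Gamma>"
    unfolding Units_def using c sc eu aug_closed[OF u]
    by (auto simp: scalar_mult scalar_one intro!: bexI[of _ "scalar c"])
  ultimately have "scalar (\<epsilon> u) \<otimes>\<^bsub>\<Gamma>\<^esub> (scalar c \<otimes>\<^bsub>\<Gamma>\<^esub> u) \<in> Units \<Gamma>" by simp
  moreover have "scalar (\<epsilon> u) \<otimes>\<^bsub>\<Gamma>\<^esub> (scalar c \<otimes>\<^bsub>\<Gamma>\<^esub> u) = u"
    using c sc u aug_closed[OF u]
    by (simp add: scalar_mult scalar_one flip: \<Gamma>.m_assoc)
  ultimately show ?thesis by simp
qed

text \<open>The induction runs over the statement $y e = 0$: if it holds for $y e$ in place of \<open>y\<close>, then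
  $y e = y e e = 0$.\<close>
lemma idempotent_in_max_ideal:
  assumes e: "e \<in> max_ideal" and idem: "e \<otimes>\<^bsub>\<Gamma>\<^esub> e = e" shows "e = \<zero>\<^bsub>\<Gamma>\<^esub>"
proof -
  have ec: "e \<in> carrier \<Gamma>" using e by (simp add: max_ideal_def)
  have "\<one>\<^bsub>\<Gamma>\<^esub> \<otimes>\<^bsub>\<Gamma>\<^esub> e = \<zero>\<^bsub>\<Gamma>\<^esub>"
  proof (rule nilpotent_induct[of "\<one>\<^bsub>\<Gamma>\<^esub>" "\<lambda>y. y \<otimes>\<^bsub>\<Gamma>\<^esub> e = \<zero>\<^bsub>\<Gamma>\<^esub>"])
    fix y assume y: "y \<in> carrier \<Gamma>" and "\<And>x. x \<in> max_ideal \<Longrightarrow> y \<otimes>\<^bsub>\<Gamma>\<^esub> x \<otimes>\<^bsub>\<Gamma>\<^esub> e = \<zero>\<^bsub>\<Gamma>\<^esub>"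
    then have "y \<otimes>\<^bsub>\<Gamma>\<^esub> e \<otimes>\<^bsub>\<Gamma>\<^esub> e = \<zero>\<^bsub>\<Gamma>\<^esub>" using e by blast
    then show "y \<otimes>\<^bsub>\<Gamma>\<^esub> e = \<zero>\<^bsub>\<Gamma>\<^esub>" using y ec by (simp add: \<Gamma>.m_assoc idem)
  qed (use ec in auto)
  then show ?thesis using ec by simp
qed

text \<open>Scalars are central, so dividing a unit by its augmentation does not change the conjugation
  by it.\<close>
lemma normalise_unit:
  assumes u: "u \<in> Units \<Gamma>"
  shows "\<exists>v\<in>Units \<Gamma>. \<epsilon> v = \<one>\<^bsub>K\<^esub> \<and> (\<forall>x\<in>carrier \<Gamma>.
    v \<otimes>\<^bsub>\<Gamma>\<^esub> x \<otimes>\<^bsub>\<Gamma>\<^esub> inv\<^bsub>\<Gamma>\<^esub> v = u \<otimes>\<^bsub>\<Gamma>\<^esub> x \<otimes>\<^bsub>\<Gamma>\<^esub> inv\<^bsub>\<Gamma>\<^esub> u)"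
proof -
  have uc: "u \<in> carrier \<Gamma>" "inv\<^bsub>\<Gamma>\<^esub> u \<in> carrier \<Gamma>" using u by auto
  have "\<epsilon> u \<otimes>\<^bsub>K\<^esub> \<epsilon> (inv\<^bsub>\<Gamma>\<^esub> u) = \<one>\<^bsub>K\<^esub>"
    using u uc aug_mult[of u "inv\<^bsub>\<Gamma>\<^esub> u"] by (simp add: aug_one)
  then have c: "\<epsilon> (inv\<^bsub>\<Gamma>\<^esub> u) \<otimes>\<^bsub>K\<^esub> \<epsilon> u = \<one>\<^bsub>K\<^esub>"
    using uc by (simp add: aug_closed K.m_comm)
  define s where "s = scalar (\<epsilon> (inv\<^bsub>\<Gamma>\<^esub> u))"
  have sc: "s \<in> carrier \<Gamma>" using uc by (simp add: s_def scalar_closed aug_closed)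
  have s: "s \<otimes>\<^bsub>\<Gamma>\<^esub> x = x \<otimes>\<^bsub>\<Gamma>\<^esub> s" if "x \<in> carrier \<Gamma>" for x
    using that uc by (simp add: s_def scalar_left scalar_right aug_closed)
  define v where "v = s \<otimes>\<^bsub>\<Gamma>\<^esub> u"
  have vc: "v \<in> carrier \<Gamma>" using sc uc by (simp add: v_def)
  have ev: "\<epsilon> v = \<one>\<^bsub>K\<^esub>" using sc uc c by (simp add: v_def aug_mult aug_scalar aug_closed s_def)
  have v: "v \<in> Units \<Gamma>" using unit_if_aug_nonzero[OF vc] ev by simp
  have "v \<otimes>\<^bsub>\<Gamma>\<^esub> x \<otimes>\<^bsub>\<Gamma>\<^esub> inv\<^bsub>\<Gamma>\<^esub> v = u \<otimes>\<^bsub>\<Gamma>\<^esub> x \<otimes>\<^bsub>\<Gamma>\<^esub> inv\<^bsub>\<Gamma>\<^esub> u" if x: "x \<in> carrier \<Gamma>" for x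
  proof -
    have "u \<otimes>\<^bsub>\<Gamma>\<^esub> x \<otimes>\<^bsub>\<Gamma>\<^esub> inv\<^bsub>\<Gamma>\<^esub> u \<otimes>\<^bsub>\<Gamma>\<^esub> v = u \<otimes>\<^bsub>\<Gamma>\<^esub> x \<otimes>\<^bsub>\<Gamma>\<^esub> (inv\<^bsub>\<Gamma>\<^esub> u \<otimes>\<^bsub>\<Gamma>\<^esub> (u \<otimes>\<^bsub>\<Gamma>\<^esub> s))"
      using x uc sc s[OF uc(1)] by (simp add: v_def \<Gamma>.m_assoc)
    also have "\<dots> = u \<otimes>\<^bsub>\<Gamma>\<^esub> x \<otimes>\<^bsub>\<Gamma>\<^esub> s"
      using \<Gamma>.m_assoc[OF uc(2) uc(1) sc] u uc sc by simp
    also have "\<dots> = v \<otimes>\<^bsub>\<Gamma>\<^esub> x"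
      using x uc sc s[of "u \<otimes>\<^bsub>\<Gamma>\<^esub> x"] by (simp add: v_def \<Gamma>.m_assoc)
    finally have "v \<otimes>\<^bsub>\<Gamma>\<^esub> x \<otimes>\<^bsub>\<Gamma>\<^esub> inv\<^bsub>\<Gamma>\<^esub> v = u \<otimes>\<^bsub>\<Gamma>\<^esub> x \<otimes>\<^bsub>\<Gamma>\<^esub> inv\<^bsub>\<Gamma>\<^esub> u \<otimes>\<^bsub>\<Gamma>\<^esub> v \<otimes>\<^bsub>\<Gamma>\<^esub> inv\<^bsub>\<Gamma>\<^esub> v" by simp
    also have "\<dots> = u \<otimes>\<^bsub>\<Gamma>\<^esub> x \<otimes>\<^bsub>\<Gamma>\<^esub> inv\<^bsub>\<Gamma>\<^esub> u \<otimes>\<^bsub>\<Gamma>\<^esub> (v \<otimes>\<^bsub>\<Gamma>\<^esub> inv\<^bsub>\<Gamma>\<^esub> v)"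
      using x uc v vc by (intro \<Gamma>.m_assoc) auto
    also have "\<dots> = u \<otimes>\<^bsub>\<Gamma>\<^esub> x \<otimes>\<^bsub>\<Gamma>\<^esub> inv\<^bsub>\<Gamma>\<^esub> u" using x uc v by simp
    finally show ?thesis .
  qed
  then show ?thesis using v ev by blast
qed

text \<open>Elements outside the augmentation ideal \<open>I\<close> are units, so \<open>I\<close> is a maximal right ideal. It is
  contained in every other one \<open>J\<close>: otherwise $1 = j + i$ with \<open>j\<close> in \<open>J\<close> and \<open>i\<close> in \<open>I\<close>, and
  $j = 1 - i$ is a unit.\<close>
lemma jacobson_radical_max_ideal: "jacobson_radical \<Gamma> = max_ideal"
proof
  have right: "right_ideal max_ideal \<Gamma>"
    using max_ideal_ideal ideal.I_r_closed ideal.axioms(1) by (auto simp: right_ideal_def)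
  have unit_full: "J = carrier \<Gamma>" if J: "right_ideal J \<Gamma>" and u: "u \<in> J" "u \<in> Units \<Gamma>" for J u
  proof
    show "J \<subseteq> carrier \<Gamma>"
      using J additive_subgroup.a_subset by (auto simp: right_ideal_def)
    show "carrier \<Gamma> \<subseteq> J"
    proof
      fix x assume x: "x \<in> carrier \<Gamma>"
      then have "u \<otimes>\<^bsub>\<Gamma>\<^esub> (inv\<^bsub>\<Gamma>\<^esub> u \<otimes>\<^bsub>\<Gamma>\<^esub> x) \<in> J" using J u by (simp add: right_ideal_def)
      moreover have "u \<otimes>\<^bsub>\<Gamma>\<^esub> (inv\<^bsub>\<Gamma>\<^esub> u \<otimes>\<^bsub>\<Gamma>\<^esub> x) = (u \<otimes>\<^bsub>\<Gamma>\<^esub> inv\<^bsub>\<Gamma>\<^esub> u) \<otimes>\<^bsub>\<Gamma>\<^esub> x"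
        using u x by (intro \<Gamma>.m_assoc[symmetric]) auto
      ultimately show "x \<in> J" using u x by simp
    qed
  qed
  have "maximal_right_ideal max_ideal \<Gamma>"
    unfolding maximal_right_ideal_def
  proof (intro conjI right allI impI)
    show "max_ideal \<noteq> carrier \<Gamma>"
    proof
      assume "max_ideal = carrier \<Gamma>"
      then have "\<one>\<^bsub>\<Gamma>\<^esub> \<in> max_ideal" by simp
      then show False using aug_one by (simp add: max_ideal_def)
    qed
    fix J assume J: "right_ideal J \<Gamma> \<and> max_ideal \<subseteq> J"
    then have sub: "J \<subseteq> carrier \<Gamma>" using additive_subgroup.a_subset by (auto simp: right_ideal_def)
    show "J = max_ideal \<or> J = carrier \<Gamma>"
    proof (cases "J = max_ideal")
      case False
      then obtain u where u: "u \<in> J" "u \<notin> max_ideal" using J by blast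
      then have "u \<in> Units \<Gamma>" using sub by (intro unit_if_aug_nonzero) (auto simp: max_ideal_def)
      then show ?thesis using unit_full J u by blast
    qed simp
  qed
  then show "jacobson_radical \<Gamma> \<subseteq> max_ideal" by (auto simp: jacobson_radical_def)
  show "max_ideal \<subseteq> jacobson_radical \<Gamma>"
    unfolding jacobson_radical_def
  proof (intro subsetI IntI InterI)
    fix x assume x: "x \<in> max_ideal"
    then show xc: "x \<in> carrier \<Gamma>" by (simp add: max_ideal_def)
    fix J assume "J \<in> {J. maximal_right_ideal J \<Gamma>}"
    then have J: "right_ideal J \<Gamma>" "J \<noteq> carrier \<Gamma>"
      and maxJ: "\<And>J'. right_ideal J' \<Gamma> \<Longrightarrow> J \<subseteq> J' \<Longrightarrow> J' = J \<or> J' = carrier \<Gamma>"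
      by (auto simp: maximal_right_ideal_def)
    have subJ: "additive_subgroup J \<Gamma>" and subM: "additive_subgroup max_ideal \<Gamma>"
      using J right by (auto simp: right_ideal_def)
    interpret J: additive_subgroup J \<Gamma> by (rule subJ)
    interpret I: additive_subgroup max_ideal \<Gamma> by (rule subM)
    define J' where "J' = J <+>\<^bsub>\<Gamma>\<^esub> max_ideal"
    have J'_iff: "y \<in> J' \<longleftrightarrow> (\<exists>j\<in>J. \<exists>i\<in>max_ideal. y = j \<oplus>\<^bsub>\<Gamma>\<^esub> i)" for y
      by (auto simp: J'_def set_add_def set_mult_def)
    have "right_ideal J' \<Gamma>"
      unfolding right_ideal_def
    proof (intro conjI ballI)
      show "additive_subgroup J' \<Gamma>"
        unfolding J'_def by (rule \<Gamma>.add_additive_subgroups[OF subJ subM])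
      fix y c assume "y \<in> J'" and c: "c \<in> carrier \<Gamma>"
      then obtain j i where ji: "j \<in> J" "i \<in> max_ideal" "y = j \<oplus>\<^bsub>\<Gamma>\<^esub> i" using J'_iff by blast
      then have "y \<otimes>\<^bsub>\<Gamma>\<^esub> c = j \<otimes>\<^bsub>\<Gamma>\<^esub> c \<oplus>\<^bsub>\<Gamma>\<^esub> i \<otimes>\<^bsub>\<Gamma>\<^esub> c" using c by (simp add: \<Gamma>.l_distr)
      then show "y \<otimes>\<^bsub>\<Gamma>\<^esub> c \<in> J'" using ji c J right unfolding J'_iff right_ideal_def by blast
    qed
    moreover have "J \<subseteq> J'"
    proof
      fix j assume j: "j \<in> J"
      then have "j = j \<oplus>\<^bsub>\<Gamma>\<^esub> \<zero>\<^bsub>\<Gamma>\<^esub>" using J.a_Hcarr by simp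
      then show "j \<in> J'" unfolding J'_iff using j I.zero_closed by blast
    qed
    ultimately consider "J' = J" | "J' = carrier \<Gamma>" using maxJ by blast
    then show "x \<in> J"
    proof cases
      case 1
      have "x = \<zero>\<^bsub>\<Gamma>\<^esub> \<oplus>\<^bsub>\<Gamma>\<^esub> x" using xc by simp
      then have "x \<in> J'" unfolding J'_iff using x J.zero_closed by blast
      then show ?thesis by (simp add: 1)
    next
      case 2
      then obtain j i where ji: "j \<in> J" "i \<in> max_ideal" "\<one>\<^bsub>\<Gamma>\<^esub> = j \<oplus>\<^bsub>\<Gamma>\<^esub> i"
        using J'_iff by (metis \<Gamma>.one_closed)
      then have "\<one>\<^bsub>\<Gamma>\<^esub> \<ominus>\<^bsub>\<Gamma>\<^esub> i = j" by (simp add: a_minus_def \<Gamma>.a_assoc \<Gamma>.r_neg)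
      then have "j \<in> Units \<Gamma>" using one_minus_unit[OF ji(2)] by simp
      then show ?thesis using unit_full[OF J(1) ji(1)] J(2) by blast
    qed
  qed
qed

end

lemma artin_if_artinian_local:
  assumes "artinian_local K G" shows "artin K (fst G) (snd G)"
proof -
  have a: "k_algebra K (fst G)" using assms by (simp add: artinian_local_def)
  then interpret k_algebra K "fst G" .
  show ?thesis
    using assms by unfold_locales (auto simp: artinian_local_def)
qed

section \<open>Free modules of rank one\<close>

context tensor_module begin

lemma lact_zero_left: "m \<in> carrier M \<Longrightarrow> lact M \<zero>\<^bsub>\<Gamma>\<^esub> m = \<zero>\<^bsub>M\<^esub>"
  using lact_add_left[of "\<zero>\<^bsub>\<Gamma>\<^esub>" "\<zero>\<^bsub>\<Gamma>\<^esub>" m] lact_closed[of "\<zero>\<^bsub>\<Gamma>\<^esub>" m]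
  by (simp add: M.add.r_cancel_one')

lemma lact_zero_right: "g \<in> carrier \<Gamma> \<Longrightarrow> lact M g \<zero>\<^bsub>M\<^esub> = \<zero>\<^bsub>M\<^esub>"
  using lact_add_right[of g "\<zero>\<^bsub>M\<^esub>" "\<zero>\<^bsub>M\<^esub>"] lact_closed[of g "\<zero>\<^bsub>M\<^esub>"]
  by (simp add: M.add.r_cancel_one')

lemma lact_minus_left:
  assumes "g \<in> carrier \<Gamma>" "m \<in> carrier M" shows "lact M (\<ominus>\<^bsub>\<Gamma>\<^esub> g) m = \<ominus>\<^bsub>M\<^esub> lact M g m"
proof -
  have "lact M (\<ominus>\<^bsub>\<Gamma>\<^esub> g) m \<oplus>\<^bsub>M\<^esub> lact M g m = \<zero>\<^bsub>M\<^esub>"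
    using assms lact_add_left[of "\<ominus>\<^bsub>\<Gamma>\<^esub> g" g m] by (simp add: \<Gamma>.l_neg lact_zero_left)
  then show ?thesis using assms by (simp add: M.minus_equality lact_closed)
qed

lemma lact_minus_right:
  assumes "g \<in> carrier \<Gamma>" "m \<in> carrier M" shows "lact M g (\<ominus>\<^bsub>M\<^esub> m) = \<ominus>\<^bsub>M\<^esub> lact M g m"
proof -
  have "lact M g (\<ominus>\<^bsub>M\<^esub> m) \<oplus>\<^bsub>M\<^esub> lact M g m = \<zero>\<^bsub>M\<^esub>"
    using assms lact_add_right[of g "\<ominus>\<^bsub>M\<^esub> m" m] by (simp add: M.l_neg lact_zero_right)
  then show ?thesis using assms by (simp add: M.minus_equality lact_closed)
qed

lemma lact_diff_left:
  "\<lbrakk>g \<in> carrier \<Gamma>; h \<in> carrier \<Gamma>; m \<in> carrier M\<rbrakk> \<Longrightarrow>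
    lact M (g \<ominus>\<^bsub>\<Gamma>\<^esub> h) m = lact M g m \<ominus>\<^bsub>M\<^esub> lact M h m"
  by (simp add: a_minus_def lact_add_left lact_minus_left)

end

locale based_module = tensor_module K A \<Gamma> M
  for K :: "'k ring" and A :: "('k, 'a) module" and \<Gamma> :: "('k, 'g) module"
    and M :: "('a, 'g, 'm) bimod" +
  fixes b :: 'm
  assumes b_closed: "b \<in> carrier M"
    and b_basis: "bij_betw (\<lambda>g. lact M g b) (carrier \<Gamma>) (carrier M)"
begin

definition coord where "coord m = the_inv_into (carrier \<Gamma>) (\<lambda>g. lact M g b) m"

lemma coord_closed: "m \<in> carrier M \<Longrightarrow> coord m \<in> carrier \<Gamma>"
  unfolding coord_def using b_basis by (metis bij_betw_def subset_refl the_inv_into_into)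

lemma lact_coord: "m \<in> carrier M \<Longrightarrow> lact M (coord m) b = m"
  unfolding coord_def using b_basis f_the_inv_into_f_bij_betw by fastforce

lemma coord_lact_b: "g \<in> carrier \<Gamma> \<Longrightarrow> coord (lact M g b) = g"
  unfolding coord_def using b_basis the_inv_into_f_f[of "\<lambda>g. lact M g b"] by (simp add: bij_betw_def)

lemma coord_eqI: "g \<in> carrier \<Gamma> \<Longrightarrow> lact M g b = m \<Longrightarrow> coord m = g"
  using coord_lact_b by blast

lemma coord_add:
  "\<lbrakk>m \<in> carrier M; m' \<in> carrier M\<rbrakk> \<Longrightarrow> coord (m \<oplus>\<^bsub>M\<^esub> m') = coord m \<oplus>\<^bsub>\<Gamma>\<^esub> coord m'"
  by (rule coord_eqI) (simp_all add: coord_closed lact_add_left lact_coord b_closed)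

lemma coord_lact:
  "\<lbrakk>g \<in> carrier \<Gamma>; m \<in> carrier M\<rbrakk> \<Longrightarrow> coord (lact M g m) = g \<otimes>\<^bsub>\<Gamma>\<^esub> coord m"
  by (rule coord_eqI) (simp_all add: coord_closed lact_mult lact_coord b_closed)

lemma coord_b: "coord b = \<one>\<^bsub>\<Gamma>\<^esub>"
  by (rule coord_eqI) (simp_all add: lact_one b_closed)

lemma lact_b_inj: "\<lbrakk>g \<in> carrier \<Gamma>; h \<in> carrier \<Gamma>; lact M g b = lact M h b\<rbrakk> \<Longrightarrow> g = h"
  using coord_lact_b by metis

end

text \<open>For \<open>M\<close> free on \<open>b\<close> the map $n \mapsto n \otimes b$ identifies \<open>N\<close> with $N \otimes M$. The
  inverse \<open>contract\<close> is defined on the free abelian group of pairs and sends $(n, g b)$ to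
  $n g$.\<close>
locale based_pair = based_module K A \<Gamma> M b + N: right_module \<Gamma> N
  for K :: "'k ring" and A :: "('k, 'a) module" and \<Gamma> :: "('k, 'g) module"
    and M :: "('a, 'g, 'm) bimod" and b :: 'm and N :: "('g, 'n) rmod"
begin

sublocale tensor_pair K A \<Gamma> M N ..

definition contract where "contract = free_ext N gens (\<lambda>(n, m). ract N n (coord m))"

lemma contract_fun: "(\<lambda>(n, m). ract N n (coord m)) \<in> gens \<rightarrow> carrier N"
  by (auto simp: N.ract_closed coord_closed)

lemmas contract_hom = N.M.free_ext_hom[OF contract_fun, folded contract_def]
lemmas contract_closed = N.M.free_ext_closed[OF contract_fun, folded contract_def]
lemmas contract_add = N.M.free_ext_add[OF contract_fun, folded contract_def]
lemmas contract_diff = N.M.free_ext_diff[OF contract_fun, folded contract_def]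

lemma contract_of:
  "\<lbrakk>n \<in> carrier N; m \<in> carrier M\<rbrakk> \<Longrightarrow> contract (frag_of (n, m)) = ract N n (coord m)"
  using N.M.free_ext_of[OF contract_fun, of "(n, m)"] by (simp add: contract_def)

lemma contract_of_b: "n \<in> carrier N \<Longrightarrow> contract (frag_of (n, b)) = n"
  by (simp add: contract_of b_closed coord_b N.ract_one)

text \<open>The map $(n, g b) \mapsto n g$ is bilinear and balanced on the nose, so the subgroup of the
  universal property is trivial.\<close>
lemma contract_null: "z \<in> null \<Longrightarrow> contract z = \<zero>\<^bsub>N\<^esub>"
proof -
  assume z: "z \<in> null"
  have "free_ext N gens (\<lambda>(n, m). ract N n (coord m)) z \<in> {\<zero>\<^bsub>N\<^esub>}"
  proof (rule null_into_subgroup[OF N.M.abelian_group_axioms _ contract_fun _ _ _ z])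
    show "subgroup {\<zero>\<^bsub>N\<^esub>} (add_monoid N)"
      using group.triv_subgroup[OF N.M.a_group] by simp
  next
    fix x x' y assume "x \<in> carrier N" "x' \<in> carrier N" "y \<in> carrier M"
    then have "ract N (x \<oplus>\<^bsub>N\<^esub> x') (coord y) \<ominus>\<^bsub>N\<^esub> ract N x (coord y) \<ominus>\<^bsub>N\<^esub> ract N x' (coord y) = \<zero>\<^bsub>N\<^esub>"
      by (simp add: N.ract_add_left N.ract_closed coord_closed N.M.add_minus_minus_cancel)
    then show "(case (x \<oplus>\<^bsub>N\<^esub> x', y) of (n, m) \<Rightarrow> ract N n (coord m)) \<ominus>\<^bsub>N\<^esub>
      (case (x, y) of (n, m) \<Rightarrow> ract N n (coord m)) \<ominus>\<^bsub>N\<^esub>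
      (case (x', y) of (n, m) \<Rightarrow> ract N n (coord m)) \<in> {\<zero>\<^bsub>N\<^esub>}" by simp
  next
    fix x y y' assume "x \<in> carrier N" "y \<in> carrier M" "y' \<in> carrier M"
    then have "ract N x (coord (y \<oplus>\<^bsub>M\<^esub> y')) \<ominus>\<^bsub>N\<^esub> ract N x (coord y) \<ominus>\<^bsub>N\<^esub> ract N x (coord y') = \<zero>\<^bsub>N\<^esub>"
      by (simp add: coord_add N.ract_add_right N.ract_closed coord_closed N.M.add_minus_minus_cancel)
    then show "(case (x, y \<oplus>\<^bsub>M\<^esub> y') of (n, m) \<Rightarrow> ract N n (coord m)) \<ominus>\<^bsub>N\<^esub>
      (case (x, y) of (n, m) \<Rightarrow> ract N n (coord m)) \<ominus>\<^bsub>N\<^esub>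
      (case (x, y') of (n, m) \<Rightarrow> ract N n (coord m)) \<in> {\<zero>\<^bsub>N\<^esub>}" by simp
  next
    fix x g y assume "x \<in> carrier N" "g \<in> carrier \<Gamma>" "y \<in> carrier M"
    then show "(case (ract N x g, y) of (n, m) \<Rightarrow> ract N n (coord m)) \<ominus>\<^bsub>N\<^esub>
      (case (x, lact M g y) of (n, m) \<Rightarrow> ract N n (coord m)) \<in> {\<zero>\<^bsub>N\<^esub>}"
      by (simp add: coord_lact N.ract_mult N.ract_closed coord_closed N.M.r_neg a_minus_def)
  qed
  then show ?thesis by (simp add: contract_def)
qed

lemma contract_cls:
  assumes "w \<in> cls z" "Poly_Mapping.keys z \<subseteq> gens" shows "contract w = contract z"
proof -
  have d: "w - z \<in> null" using assms by (simp add: cls_mem)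
  have "contract ((w - z) + z) = contract (w - z) \<oplus>\<^bsub>N\<^esub> contract z"
    using assms(2) null_keys[OF d] by (rule contract_add[rotated])
  then show ?thesis using contract_null[OF d] contract_closed[OF assms(2) assms(2)] by simp
qed

lemma cls_contract:
  assumes "Poly_Mapping.keys z \<subseteq> gens" shows "cls z = pure (contract z) b"
  using assms
proof (rule free_Abelian_group_induct)
  have "contract (frag_of (\<zero>\<^bsub>N\<^esub>, b) - frag_of (\<zero>\<^bsub>N\<^esub>, b)) = \<zero>\<^bsub>N\<^esub>"
    using b_closed by (subst contract_diff) (auto simp: contract_of_b N.M.r_neg a_minus_def)
  then show "cls 0 = pure (contract 0) b" using pure_zero_left[OF b_closed] by simp
next
  fix x y assume k: "Poly_Mapping.keys x \<subseteq> gens" "Poly_Mapping.keys y \<subseteq> gens"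
    and IH: "cls x = pure (contract x) b" "cls y = pure (contract y) b"
  have c: "contract x \<in> carrier N" "contract y \<in> carrier N" using k contract_closed by auto
  let ?d = "contract x \<ominus>\<^bsub>N\<^esub> contract y"
  have "pure (?d \<oplus>\<^bsub>N\<^esub> contract y) b = cls (frag_of (?d, b) + frag_of (contract y, b))"
    using c b_closed by (subst pure_add_left) (simp_all add: mult_tensor)
  moreover have "?d \<oplus>\<^bsub>N\<^esub> contract y = contract x"
    using c by (rule N.M.minus_add_cancel)
  ultimately have 1: "frag_of (contract x, b) - (frag_of (?d, b) + frag_of (contract y, b)) \<in> null"
    by (simp add: cls_eq)
  have 2: "x - frag_of (contract x, b) \<in> null" "y - frag_of (contract y, b) \<in> null"
    using IH by (simp_all add: cls_eq)
  from null_diff[OF null_add[OF 1 2(1)] 2(2)] have "x - y - frag_of (?d, b) \<in> null"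
    by (simp add: algebra_simps)
  then show "cls (x - y) = pure (contract (x - y)) b" using k by (simp add: cls_eq contract_diff)
next
  fix p assume pg: "p \<in> gens"
  define n m where "n = fst p" and "m = snd p"
  with pg have p: "p = (n, m)" "n \<in> carrier N" "m \<in> carrier M" by auto
  then have "pure n (lact M (coord m) b) = pure (ract N n (coord m)) b"
    using pure_balance coord_closed b_closed by simp
  then show "cls (frag_of p) = pure (contract (frag_of p)) b"
    using p by (simp add: lact_coord contract_of)
qed

lemma pure_b_inj:
  assumes "n \<in> carrier N" "n' \<in> carrier N" "pure n b = pure n' b" shows "n = n'"
proof -
  have "frag_of (n, b) \<in> cls (frag_of (n', b))"
    using assms(3) by (simp add: cls_eq cls_mem)
  from contract_cls[OF this] show ?thesis using assms b_closed by (simp add: contract_of_b)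
qed

lemma carrier_tensor_based: "carrier (tensor \<Gamma> N M) = (\<lambda>n. pure n b) ` carrier N"
proof (intro equalityI subsetI)
  fix X assume "X \<in> carrier (tensor \<Gamma> N M)"
  then obtain z where "X = cls z" "Poly_Mapping.keys z \<subseteq> gens" by (auto simp: carrier_tensor)
  then show "X \<in> (\<lambda>n. pure n b) ` carrier N" using cls_contract contract_closed by blast
qed (auto simp: pure_closed b_closed)

end

text \<open>Through the identification of $N \otimes M$ with \<open>N\<close>, tensoring with \<open>M\<close> becomes the identity
  on maps.\<close>
lemma (in based_module) flat: "flat \<Gamma> M"
  unfolding flat_def
proof (intro allI impI, elim conjE)
  fix N N' :: "('g, 'g) rmod" and i
  assume N: "right_module \<Gamma> N" and N': "right_module \<Gamma> N'"
    and i: "i \<in> rmod_hom \<Gamma> N N'" and inj: "inj_on i (carrier N)"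
  interpret P: based_pair K A \<Gamma> M b N
    using N by (simp add: based_pair_def based_module_axioms)
  interpret P': based_pair K A \<Gamma> M b N'
    using N' by (simp add: based_pair_def based_module_axioms)
  have eq: "tensor_map \<Gamma> N' M i id (P.pure n b) = P'.pure (i n) b" if "n \<in> carrier N" for n
    using that b_closed i
    by (subst tensor_map_class[OF P.tensor_pair_axioms P'.tensor_pair_axioms i]) auto
  show "inj_on (tensor_map \<Gamma> N' M i id) (carrier (tensor \<Gamma> N M))"
  proof (rule inj_onI)
    fix X Y assume "X \<in> carrier (tensor \<Gamma> N M)" "Y \<in> carrier (tensor \<Gamma> N M)"
      and XY: "tensor_map \<Gamma> N' M i id X = tensor_map \<Gamma> N' M i id Y"
    then obtain n n' where n: "n \<in> carrier N" "X = P.pure n b" "n' \<in> carrier N" "Y = P.pure n' b"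
      unfolding P.carrier_tensor_based by blast
    then have "i n = i n'" using XY i by (intro P'.pure_b_inj) (auto simp: eq rmod_hom_def)
    then show "X = Y" using n inj by (auto dest: inj_onD)
  qed
qed

section \<open>One-dimensional modules and reduction to the ground field\<close>

lemma right_module_along:
  assumes "ring \<Gamma>" "ring \<Delta>" "\<phi> \<in> ring_hom \<Gamma> \<Delta>"
  shows "right_module \<Gamma> (along \<Delta> \<phi>)"
proof -
  interpret \<Gamma>: ring \<Gamma> by fact
  interpret \<Delta>: ring \<Delta> by fact
  interpret \<phi>: ring_hom_ring \<Gamma> \<Delta> \<phi> by (rule ring_hom_ringI2) fact+
  have "abelian_group (along \<Delta> \<phi>)"
    by (rule abelian_groupI)
       (auto simp: along_def \<Delta>.a_ac intro: bexI[of _ "\<ominus>\<^bsub>\<Delta>\<^esub> _"] \<Delta>.l_neg)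
  then show ?thesis
    by (intro right_module.intro right_module_axioms.intro)
       (simp_all add: along_def \<Gamma>.ring_axioms \<Delta>.l_distr \<Delta>.r_distr \<Delta>.m_assoc)
qed

lemma along_simps:
  "carrier (along \<Delta> \<phi>) = carrier \<Delta>" "add (along \<Delta> \<phi>) = add \<Delta>"
  "\<zero>\<^bsub>along \<Delta> \<phi>\<^esub> = \<zero>\<^bsub>\<Delta>\<^esub>" "ract (along \<Delta> \<phi>) x g = x \<otimes>\<^bsub>\<Delta>\<^esub> \<phi> g"
  by (simp_all add: along_def)

lemma base_change_simps:
  "carrier (base_change \<Gamma> \<Delta> \<phi> M) = carrier (tensor \<Gamma> (along \<Delta> \<phi>) M)"
  "add (base_change \<Gamma> \<Delta> \<phi> M) = mult (tensor \<Gamma> (along \<Delta> \<phi>) M)"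
  "\<zero>\<^bsub>base_change \<Gamma> \<Delta> \<phi> M\<^esub> = \<one>\<^bsub>tensor \<Gamma> (along \<Delta> \<phi>) M\<^esub>"
  by (simp_all add: base_change_def)

lemma id_rmod_hom: "right_module \<Gamma> N \<Longrightarrow> id \<in> rmod_hom \<Gamma> N N"
  by (auto simp: rmod_hom_def)

lemma base_change_ract_pure:
  assumes P: "tensor_pair K A \<Gamma> M (along \<Delta> \<phi>)"
    and "d \<in> carrier \<Delta>" "m \<in> carrier M" "a \<in> carrier A"
  shows "ract (base_change \<Gamma> \<Delta> \<phi> M) (tensor_class \<Gamma> (along \<Delta> \<phi>) M (frag_of (d, m))) a =
    tensor_class \<Gamma> (along \<Delta> \<phi>) M (frag_of (d, ract M m a))"
proof -
  interpret tensor_pair K A \<Gamma> M "along \<Delta> \<phi>" by fact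
  show ?thesis
    unfolding base_change_def using assms(2-)
    by (simp, subst tensor_map_class[OF P P])
       (auto simp: ract_closed ract_add_left lact_ract id_rmod_hom N.right_module_axioms along_simps)
qed

text \<open>A right module \<open>S\<close> that is a copy of the ground field, by \<open>\<sigma>\<close>, on which \<open>A\<close> acts through the
  character \<open>\<chi>\<close>.\<close>
locale point =
  fixes K :: "'k ring" and A :: "('k, 'a) module" and S :: "('a, 's) rmod"
    and \<sigma> :: "'k \<Rightarrow> 's" and \<chi> :: "'a \<Rightarrow> 'k"
  assumes K_field: "field K" and A_alg: "k_algebra K A"
    and \<sigma>_bij: "bij_betw \<sigma> (carrier K) (carrier S)"
    and \<sigma>_add: "\<lbrakk>c \<in> carrier K; d \<in> carrier K\<rbrakk> \<Longrightarrow> \<sigma> (c \<oplus>\<^bsub>K\<^esub> d) = \<sigma> c \<oplus>\<^bsub>S\<^esub> \<sigma> d"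
    and \<sigma>_ract: "\<lbrakk>c \<in> carrier K; a \<in> carrier A\<rbrakk> \<Longrightarrow> ract S (\<sigma> c) a = \<sigma> (c \<otimes>\<^bsub>K\<^esub> \<chi> a)"
    and \<chi>_closed: "a \<in> carrier A \<Longrightarrow> \<chi> a \<in> carrier K"
    and \<chi>_scalar: "c \<in> carrier K \<Longrightarrow> \<chi> (c \<odot>\<^bsub>A\<^esub> \<one>\<^bsub>A\<^esub>) = c"
begin

lemma \<sigma>_inj: "\<lbrakk>c \<in> carrier K; d \<in> carrier K; \<sigma> c = \<sigma> d\<rbrakk> \<Longrightarrow> c = d"
  using \<sigma>_bij by (auto simp: bij_betw_def dest: inj_onD)

lemma scalar_A_closed: "c \<in> carrier K \<Longrightarrow> c \<odot>\<^bsub>A\<^esub> \<one>\<^bsub>A\<^esub> \<in> carrier A"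
  using A_alg unfolding k_algebra_def by (blast intro: module.smult_closed ring.ring_simprules)

end

text \<open>The link between a deformation and a homomorphism. The last condition says that \<open>b\<close> lifts the
  generator of \<open>S\<close>. It prescribes the structure map on the elements $c \otimes b$ because these
  exhaust the special fibre, while the values elsewhere are arbitrary.\<close>
definition framed ::
  "'k ring \<Rightarrow> ('k, 'a) module \<Rightarrow> ('k \<Rightarrow> 's) \<Rightarrow> ('k, 'g) aug_alg \<Rightarrow> ('a \<Rightarrow> 'g) \<Rightarrow>
    ('k, 'a, 'g, 'm, 's) deform \<Rightarrow> 'm \<Rightarrow> bool" where
  "framed K A \<sigma> G r D b \<longleftrightarrow> based_module K A (fst G) (fst D) b \<and>
     (\<forall>a\<in>carrier A. r a \<in> carrier (fst G) \<and> ract (fst D) b a = lact (fst D) (r a) b) \<and>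
     (\<forall>c\<in>carrier K. snd D (tensor_class (fst G) (along K (snd G)) (fst D) (frag_of (c, b))) = \<sigma> c)"

locale residue_pair = artin K \<Gamma> \<epsilon> + tensor_module K A \<Gamma> M
  for K :: "'k ring" and A :: "('k, 'a) module" and \<Gamma> :: "('k, 'g) module"
    and \<epsilon> :: "'g \<Rightarrow> 'k" and M :: "('a, 'g, 'm) bimod"
begin

sublocale res: tensor_pair K A \<Gamma> M "along K \<epsilon>"
  by (intro tensor_pair.intro tensor_module_axioms right_module_along aug_ring_hom
      \<Gamma>.ring_axioms K.ring_axioms)

lemma scalar_add:
  "\<lbrakk>c \<in> carrier K; d \<in> carrier K\<rbrakk> \<Longrightarrow> scalar (c \<oplus>\<^bsub>K\<^esub> d) = scalar c \<oplus>\<^bsub>\<Gamma>\<^esub> scalar d"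
  unfolding scalar_def using module.smult_l_distr[OF module] by simp

lemma pure_scalar:
  assumes "c \<in> carrier K" "m \<in> carrier M"
  shows "res.pure c m = res.pure \<one>\<^bsub>K\<^esub> (lact M (scalar c) m)"
  using res.pure_balance[of "\<one>\<^bsub>K\<^esub>" "scalar c" m] assms
  by (simp add: along_simps scalar_closed aug_scalar)

lemma pure_lact:
  assumes "g \<in> carrier \<Gamma>" "m \<in> carrier M"
  shows "res.pure \<one>\<^bsub>K\<^esub> (lact M g m) = res.pure (\<epsilon> g) m"
  using res.pure_balance[of "\<one>\<^bsub>K\<^esub>" g m] assms by (simp add: along_simps aug_closed)

text \<open>As the augmentation is surjective, every tensor over the ground field reduces to a single pure
  one.\<close>
lemma pure_one_surj:
  assumes "X \<in> carrier (tensor \<Gamma> (along K \<epsilon>) M)"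
  shows "\<exists>m\<in>carrier M. X = res.pure \<one>\<^bsub>K\<^esub> m"
proof -
  obtain z where X: "X = res.cls z" and z: "Poly_Mapping.keys z \<subseteq> res.gens"
    using assms by (auto simp: res.carrier_tensor)
  have one: "\<one>\<^bsub>K\<^esub> \<in> carrier (along K \<epsilon>)" by (simp add: along_simps)
  from z have "\<exists>m\<in>carrier M. res.cls z = res.pure \<one>\<^bsub>K\<^esub> m"
  proof (rule free_Abelian_group_induct)
    show "\<exists>m\<in>carrier M. res.cls 0 = res.pure \<one>\<^bsub>K\<^esub> m"
      using res.pure_zero_right[OF one] by (metis M.zero_closed)
  next
    fix x y assume "\<exists>m\<in>carrier M. res.cls x = res.pure \<one>\<^bsub>K\<^esub> m" "\<exists>m\<in>carrier M. res.cls y = res.pure \<one>\<^bsub>K\<^esub> m"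
    then obtain m n where m: "m \<in> carrier M" "x - frag_of (\<one>\<^bsub>K\<^esub>, m) \<in> res.null"
      and n: "n \<in> carrier M" "y - frag_of (\<one>\<^bsub>K\<^esub>, n) \<in> res.null"
      by (auto simp: res.cls_eq)
    have "m = (m \<ominus>\<^bsub>M\<^esub> n) \<oplus>\<^bsub>M\<^esub> n" using m n by (simp add: M.minus_add_cancel)
    then have "frag_of (\<one>\<^bsub>K\<^esub>, m) - frag_of (\<one>\<^bsub>K\<^esub>, m \<ominus>\<^bsub>M\<^esub> n) - frag_of (\<one>\<^bsub>K\<^esub>, n) \<in> res.null"
      using res.null_add_right[OF one, of "m \<ominus>\<^bsub>M\<^esub> n" n] m n by simp
    from res.null_diff[OF res.null_add[OF this m(2)] n(2)]
    have "x - y - frag_of (\<one>\<^bsub>K\<^esub>, m \<ominus>\<^bsub>M\<^esub> n) \<in> res.null" by (simp add: algebra_simps)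
    then show "\<exists>m\<in>carrier M. res.cls (x - y) = res.pure \<one>\<^bsub>K\<^esub> m"
      using m n by (auto simp: res.cls_eq intro!: bexI[of _ "m \<ominus>\<^bsub>M\<^esub> n"])
  next
    fix p assume "p \<in> res.gens"
    then show "\<exists>m\<in>carrier M. res.cls (frag_of p) = res.pure \<one>\<^bsub>K\<^esub> m"
      by (cases p) (auto simp: along_simps pure_scalar scalar_closed lact_closed)
  qed
  then show ?thesis by (simp add: X)
qed

text \<open>The kernel of $M \to k \otimes M$ is the submodule generated by all $x v$ with \<open>x\<close> in the
  augmentation ideal: modulo any subgroup \<open>H\<close> containing these, $(c, v) \mapsto c v$ is
  balanced.\<close>
lemma residue_kernel:
  assumes m: "m \<in> carrier M" and null: "res.pure \<one>\<^bsub>K\<^esub> m = res.cls 0"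
    and H: "subgroup H (add_monoid M)"
    and IH: "\<And>x v. \<lbrakk>x \<in> max_ideal; v \<in> carrier M\<rbrakk> \<Longrightarrow> lact M x v \<in> H"
  shows "m \<in> H"
proof -
  have zero: "\<zero>\<^bsub>M\<^esub> \<in> H" using subgroup.one_closed[OF H] by simp
  let ?f = "\<lambda>(c, v). lact M (scalar c) v"
  have "?f (\<one>\<^bsub>K\<^esub>, m) \<in> H"
  proof (rule res.pure_null_into_subgroup[OF M.abelian_group_axioms H _ _ _ _ _ m null])
    fix x x' y assume "x \<in> carrier (along K \<epsilon>)" "x' \<in> carrier (along K \<epsilon>)" "y \<in> carrier M"
    then show "?f (x \<oplus>\<^bsub>along K \<epsilon>\<^esub> x', y) \<ominus>\<^bsub>M\<^esub> ?f (x, y) \<ominus>\<^bsub>M\<^esub> ?f (x', y) \<in> H"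
      by (simp add: along_simps scalar_add lact_add_left scalar_closed M.add_minus_minus_cancel lact_closed zero)
  next
    fix x y y' assume "x \<in> carrier (along K \<epsilon>)" "y \<in> carrier M" "y' \<in> carrier M"
    then show "?f (x, y \<oplus>\<^bsub>M\<^esub> y') \<ominus>\<^bsub>M\<^esub> ?f (x, y) \<ominus>\<^bsub>M\<^esub> ?f (x, y') \<in> H"
      by (simp add: along_simps lact_add_right scalar_closed M.add_minus_minus_cancel lact_closed zero)
  next
    fix c g y assume "c \<in> carrier (along K \<epsilon>)" and g: "g \<in> carrier \<Gamma>" and y: "y \<in> carrier M"
    then have c: "c \<in> carrier K" by (simp add: along_simps)
    let ?x = "scalar (c \<otimes>\<^bsub>K\<^esub> \<epsilon> g) \<ominus>\<^bsub>\<Gamma>\<^esub> scalar c \<otimes>\<^bsub>\<Gamma>\<^esub> g"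
    have "?x \<in> max_ideal"
      using c g aug_closed[OF g]
      by (simp add: max_ideal_def scalar_closed a_minus_def aug_add aug_mult aug_scalar K.r_neg)
    moreover have "lact M ?x y = lact M (scalar (c \<otimes>\<^bsub>K\<^esub> \<epsilon> g)) y \<ominus>\<^bsub>M\<^esub> lact M (scalar c) (lact M g y)"
      using c g y aug_closed[OF g] by (simp add: scalar_closed lact_diff_left lact_mult)
    ultimately show "?f (ract (along K \<epsilon>) c g, y) \<ominus>\<^bsub>M\<^esub> ?f (c, lact M g y) \<in> H"
      using IH[of ?x y] y by (simp add: along_simps)
  qed (auto simp: along_simps scalar_closed lact_closed)
  then show ?thesis using m by (simp add: scalar_one lact_one)
qed

text \<open>The only use of flatness, for the inclusion of the right ideal $g\Gamma$ into $\Gamma$. By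
  flatness $g \otimes b$ is null in $g\Gamma \otimes M$. There the map $g y \otimes m \mapsto y m$
  makes sense modulo \<open>H\<close>, the set of all $x b$ with $g x = 0$; the preimage \<open>t u\<close> of an element \<open>u\<close>
  of $g\Gamma$ may be chosen arbitrarily. Hence $t(g) b = x b$ with $g x = 0$, and
  $z = t(g) - x$ is as required.\<close>
lemma annihilator_flat:
  assumes flat: "flat \<Gamma> M" and b: "b \<in> carrier M"
    and span: "\<And>m. m \<in> carrier M \<Longrightarrow> \<exists>g\<in>carrier \<Gamma>. m = lact M g b"
    and g: "g \<in> carrier \<Gamma>" and gb: "lact M g b = \<zero>\<^bsub>M\<^esub>"
  shows "\<exists>z\<in>carrier \<Gamma>. g \<otimes>\<^bsub>\<Gamma>\<^esub> z = g \<and> lact M z b = \<zero>\<^bsub>M\<^esub>"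
proof -
  define N :: "('g, 'g) rmod" where "N = \<lparr>carrier = (\<lambda>y. g \<otimes>\<^bsub>\<Gamma>\<^esub> y) ` carrier \<Gamma>, mult = mult \<Gamma>,
    one = one \<Gamma>, ring.zero = ring.zero \<Gamma>, add = add \<Gamma>, ract = mult \<Gamma>\<rparr>"
  have N_simps: "carrier N = (\<lambda>y. g \<otimes>\<^bsub>\<Gamma>\<^esub> y) ` carrier \<Gamma>" "add N = add \<Gamma>" "\<zero>\<^bsub>N\<^esub> = \<zero>\<^bsub>\<Gamma>\<^esub>"
    "ract N = mult \<Gamma>"
    by (simp_all add: N_def)
  have sum: "g \<otimes>\<^bsub>\<Gamma>\<^esub> y \<oplus>\<^bsub>\<Gamma>\<^esub> g \<otimes>\<^bsub>\<Gamma>\<^esub> y' \<in> carrier N" if "y \<in> carrier \<Gamma>" "y' \<in> carrier \<Gamma>" for y y'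
    using that g by (auto simp: N_simps \<Gamma>.r_distr[symmetric])
  have "abelian_group N"
  proof (rule abelian_groupI)
    show "\<zero>\<^bsub>N\<^esub> \<in> carrier N" using g by (auto simp: N_simps image_iff intro!: bexI[of _ "\<zero>\<^bsub>\<Gamma>\<^esub>"])
    fix x assume "x \<in> carrier N"
    then obtain y where y: "y \<in> carrier \<Gamma>" "x = g \<otimes>\<^bsub>\<Gamma>\<^esub> y" by (auto simp: N_simps)
    then show "\<exists>x'\<in>carrier N. x' \<oplus>\<^bsub>N\<^esub> x = \<zero>\<^bsub>N\<^esub>"
      using g by (intro bexI[of _ "g \<otimes>\<^bsub>\<Gamma>\<^esub> (\<ominus>\<^bsub>\<Gamma>\<^esub> y)"])
        (simp_all add: N_simps image_eqI[OF refl] flip: \<Gamma>.r_distr, simp add: \<Gamma>.l_neg)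
  qed (use g sum in \<open>auto simp: N_simps \<Gamma>.a_ac\<close>)
  then have N: "right_module \<Gamma> N"
    by (intro right_module.intro right_module_axioms.intro)
       (use g in \<open>auto simp: N_simps \<Gamma>.ring_axioms \<Gamma>.l_distr \<Gamma>.r_distr \<Gamma>.m_assoc\<close>)
  have N': "right_module \<Gamma> (along \<Gamma> id)"
    by (intro right_module_along) (auto simp: \<Gamma>.ring_axioms ring_hom_def)
  interpret P: tensor_pair K A \<Gamma> M N by (intro tensor_pair.intro tensor_module_axioms N)
  interpret P': tensor_pair K A \<Gamma> M "along \<Gamma> id" by (intro tensor_pair.intro tensor_module_axioms N')
  have i: "id \<in> rmod_hom \<Gamma> N (along \<Gamma> id)"
    using g by (auto simp: rmod_hom_def along_simps N_simps)
  have gN: "g \<in> carrier N" using g by (auto simp: N_simps image_iff intro!: bexI[of _ "\<one>\<^bsub>\<Gamma>\<^esub>"])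
  have map: "tensor_map \<Gamma> (along \<Gamma> id) M id id (P.cls z) =
      P'.cls (frag_extend (\<lambda>(x, y). frag_of (id x, id y)) z)" if "Poly_Mapping.keys z \<subseteq> P.gens" for z
    by (rule tensor_map_class[OF P.tensor_pair_axioms P'.tensor_pair_axioms i]) (use that in auto)
  have "P'.pure g b = P'.cls 0"
    using P'.pure_balance[of "\<one>\<^bsub>\<Gamma>\<^esub>" g b] P'.pure_zero_right[of "\<one>\<^bsub>\<Gamma>\<^esub>"] g b
    by (simp add: along_simps gb)
  then have "tensor_map \<Gamma> (along \<Gamma> id) M id id (P.pure g b) =
      tensor_map \<Gamma> (along \<Gamma> id) M id id (P.cls 0)"
    using gN b by (simp add: map)
  moreover have "inj_on (tensor_map \<Gamma> (along \<Gamma> id) M id id) (carrier (tensor \<Gamma> N M))"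
    using flat N N' i unfolding flat_def by (metis inj_on_id)
  moreover have "P.cls 0 \<in> carrier (tensor \<Gamma> N M)" by (auto simp: P.carrier_tensor)
  ultimately have null: "P.pure g b = P.cls 0"
    using P.pure_closed[OF gN b] by (auto dest: inj_onD)
  define t where "t u = (SOME y. y \<in> carrier \<Gamma> \<and> g \<otimes>\<^bsub>\<Gamma>\<^esub> y = u)" for u
  have t: "t u \<in> carrier \<Gamma>" "g \<otimes>\<^bsub>\<Gamma>\<^esub> t u = u" if "u \<in> carrier N" for u
  proof -
    have "\<exists>y. y \<in> carrier \<Gamma> \<and> g \<otimes>\<^bsub>\<Gamma>\<^esub> y = u" using that by (auto simp: N_simps)
    from someI_ex[OF this] show "t u \<in> carrier \<Gamma>" "g \<otimes>\<^bsub>\<Gamma>\<^esub> t u = u" by (simp_all add: t_def)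
  qed
  \<comment> \<open>closed under multiplying \<open>x\<close> on the right, hence \<open>H\<close> contains \<open>x m\<close> for every \<open>m = h b\<close>\<close>
  define H where "H = {lact M x b | x. x \<in> carrier \<Gamma> \<and> g \<otimes>\<^bsub>\<Gamma>\<^esub> x = \<zero>\<^bsub>\<Gamma>\<^esub>}"
  have HI: "lact M x m \<in> H" if x: "x \<in> carrier \<Gamma>" "g \<otimes>\<^bsub>\<Gamma>\<^esub> x = \<zero>\<^bsub>\<Gamma>\<^esub>" and m: "m \<in> carrier M" for x m
  proof -
    obtain h where h: "h \<in> carrier \<Gamma>" "m = lact M h b" using span[OF m] by blast
    have "lact M x m = lact M (x \<otimes>\<^bsub>\<Gamma>\<^esub> h) b" using h x b by (simp add: lact_mult)
    moreover have "g \<otimes>\<^bsub>\<Gamma>\<^esub> (x \<otimes>\<^bsub>\<Gamma>\<^esub> h) = \<zero>\<^bsub>\<Gamma>\<^esub>"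
      using \<Gamma>.m_assoc[OF g x(1) h(1)] x h by simp
    ultimately show ?thesis unfolding H_def using x h by blast
  qed
  have subH: "subgroup H (add_monoid M)"
  proof (rule group.subgroupI[OF M.a_group])
    show "H \<subseteq> carrier (add_monoid M)" using b by (auto simp: H_def lact_closed)
    show "H \<noteq> {}" using HI[of "\<zero>\<^bsub>\<Gamma>\<^esub>" b] b g by auto
    fix v assume "v \<in> H"
    then obtain x where x: "x \<in> carrier \<Gamma>" "g \<otimes>\<^bsub>\<Gamma>\<^esub> x = \<zero>\<^bsub>\<Gamma>\<^esub>" "v = lact M x b" by (auto simp: H_def)
    have "inv\<^bsub>add_monoid M\<^esub> v = lact M (\<ominus>\<^bsub>\<Gamma>\<^esub> x) b"
      using x b by (simp add: lact_minus_left flip: a_inv_def)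
    then show "inv\<^bsub>add_monoid M\<^esub> v \<in> H" using HI[of "\<ominus>\<^bsub>\<Gamma>\<^esub> x" b] x b g by (simp add: \<Gamma>.r_minus)
    fix w assume "w \<in> H"
    then obtain y where y: "y \<in> carrier \<Gamma>" "g \<otimes>\<^bsub>\<Gamma>\<^esub> y = \<zero>\<^bsub>\<Gamma>\<^esub>" "w = lact M y b" by (auto simp: H_def)
    have "v \<oplus>\<^bsub>M\<^esub> w = lact M (x \<oplus>\<^bsub>\<Gamma>\<^esub> y) b" using x y b by (simp add: lact_add_left)
    then show "v \<otimes>\<^bsub>add_monoid M\<^esub> w \<in> H"
      using HI[of "x \<oplus>\<^bsub>\<Gamma>\<^esub> y" b] x y b g by (simp add: \<Gamma>.r_distr)
  qed
  let ?f = "\<lambda>(u, m). lact M (t u) m"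
  have "?f (g, b) \<in> H"
  proof (rule P.pure_null_into_subgroup[OF M.abelian_group_axioms subH _ _ _ _ gN b null])
    fix x x' y assume x: "x \<in> carrier N" "x' \<in> carrier N" and y: "y \<in> carrier M"
    have xx: "x \<oplus>\<^bsub>N\<^esub> x' \<in> carrier N" using x by simp
    let ?d = "t (x \<oplus>\<^bsub>N\<^esub> x') \<ominus>\<^bsub>\<Gamma>\<^esub> t x \<ominus>\<^bsub>\<Gamma>\<^esub> t x'"
    have c: "x \<in> carrier \<Gamma>" "x' \<in> carrier \<Gamma>" using x g by (auto simp: N_simps)
    have "g \<otimes>\<^bsub>\<Gamma>\<^esub> ?d = x \<oplus>\<^bsub>\<Gamma>\<^esub> x' \<ominus>\<^bsub>\<Gamma>\<^esub> x \<ominus>\<^bsub>\<Gamma>\<^esub> x'"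
      using t[OF x(1)] t[OF x(2)] t[OF xx] g
      by (simp add: a_minus_def \<Gamma>.r_distr \<Gamma>.r_minus) (simp add: N_simps)
    also have "\<dots> = \<zero>\<^bsub>\<Gamma>\<^esub>" using c by (rule \<Gamma>.add_minus_minus_cancel)
    finally have "lact M ?d y \<in> H" using t[OF x(1)] t[OF x(2)] t[OF xx] y by (intro HI) auto
    then show "?f (x \<oplus>\<^bsub>N\<^esub> x', y) \<ominus>\<^bsub>M\<^esub> ?f (x, y) \<ominus>\<^bsub>M\<^esub> ?f (x', y) \<in> H"
      using t[OF x(1)] t[OF x(2)] t[OF xx] y by (simp add: lact_diff_left)
  next
    fix x y y' assume x: "x \<in> carrier N" and y: "y \<in> carrier M" "y' \<in> carrier M"
    have "lact M \<zero>\<^bsub>\<Gamma>\<^esub> b \<in> H" using b g by (intro HI) auto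
    moreover have "lact M (t x) y \<oplus>\<^bsub>M\<^esub> lact M (t x) y' \<ominus>\<^bsub>M\<^esub> lact M (t x) y \<ominus>\<^bsub>M\<^esub> lact M (t x) y' = \<zero>\<^bsub>M\<^esub>"
      using t[OF x] y by (simp add: lact_closed M.add_minus_minus_cancel)
    ultimately show "?f (x, y \<oplus>\<^bsub>M\<^esub> y') \<ominus>\<^bsub>M\<^esub> ?f (x, y) \<ominus>\<^bsub>M\<^esub> ?f (x, y') \<in> H"
      using t[OF x] y b by (simp add: lact_add_right lact_zero_left)
  next
    fix x h y assume x: "x \<in> carrier N" and h: "h \<in> carrier \<Gamma>" and y: "y \<in> carrier M"
    have xh: "ract N x h \<in> carrier N" using x h by (rule P.N.ract_closed)
    let ?d = "t (ract N x h) \<ominus>\<^bsub>\<Gamma>\<^esub> t x \<otimes>\<^bsub>\<Gamma>\<^esub> h"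
    have c: "x \<in> carrier \<Gamma>" using x g by (auto simp: N_simps)
    have "g \<otimes>\<^bsub>\<Gamma>\<^esub> ?d = ract N x h \<ominus>\<^bsub>\<Gamma>\<^esub> x \<otimes>\<^bsub>\<Gamma>\<^esub> h"
      using t[OF x] t[OF xh] g h
      by (simp add: a_minus_def \<Gamma>.r_distr \<Gamma>.r_minus flip: \<Gamma>.m_assoc)
    also have "\<dots> = \<zero>\<^bsub>\<Gamma>\<^esub>" using c h by (simp add: N_simps a_minus_def \<Gamma>.r_neg)
    finally have "lact M ?d y \<in> H" using t[OF x] t[OF xh] y h by (intro HI) auto
    then show "?f (ract N x h, y) \<ominus>\<^bsub>M\<^esub> ?f (x, lact M h y) \<in> H"
      using t[OF x] t[OF xh] y h by (simp add: lact_diff_left lact_mult)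
  qed (use t in \<open>auto simp: lact_closed\<close>)
  then obtain x where x: "x \<in> carrier \<Gamma>" "g \<otimes>\<^bsub>\<Gamma>\<^esub> x = \<zero>\<^bsub>\<Gamma>\<^esub>" "lact M (t g) b = lact M x b"
    by (auto simp: H_def)
  let ?z = "t g \<ominus>\<^bsub>\<Gamma>\<^esub> x"
  have "g \<otimes>\<^bsub>\<Gamma>\<^esub> ?z = g" using t[OF gN] x g by (simp add: a_minus_def \<Gamma>.r_distr \<Gamma>.r_minus)
  moreover have "lact M ?z b = \<zero>\<^bsub>M\<^esub>"
    using t[OF gN] x b by (simp add: lact_diff_left) (simp add: a_minus_def lact_closed M.r_neg)
  ultimately show ?thesis using t[OF gN] x by blast
qed

end

section \<open>Deformations have framings\<close>

lemma deformationsD: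
  assumes "(M, f) \<in> deformations K A S G"
  shows "tensor_module K A (fst G) M" "flat (fst G) M"
    "f \<in> rmod_iso A (base_change (fst G) K (snd G) M) S"
  using assms by (auto simp: deformations_def)

locale point_artin = point K A S \<sigma> \<chi> + artin K \<Gamma> \<epsilon>
  for K :: "'k ring" and A :: "('k, 'a) module" and S :: "('a, 's) rmod"
    and \<sigma> :: "'k \<Rightarrow> 's" and \<chi> :: "'a \<Rightarrow> 'k"
    and \<Gamma> :: "('k, 'g) module" and \<epsilon> :: "'g \<Rightarrow> 'k"
begin

text \<open>The structure map of the deformation, transported to the ground field and evaluated on
  $1 \otimes m$, is a functional \<open>q\<close> with $q(g m) = \epsilon(g) q(m)$, whose kernel is controlled by
  \<open>residue_kernel\<close>. Nakayama's lemma appears as \<open>nilpotent_induct\<close> for the property that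
  multiplication by \<open>y\<close> maps the module into $\Gamma b$.\<close>
lemma framed_exists:
  assumes D: "(M, f) \<in> deformations K A S (\<Gamma>, \<epsilon>)"
  shows "\<exists>r b. framed K A \<sigma> (\<Gamma>, \<epsilon>) r (M, f) b \<and> (\<forall>a\<in>carrier A. \<epsilon> (r a) = \<chi> a)"
proof -
  interpret tensor_module K A \<Gamma> M using deformationsD(1)[OF D] by simp
  interpret residue_pair K A \<Gamma> \<epsilon> M ..
  have flat: "flat \<Gamma> M" using deformationsD(2)[OF D] by simp
  let ?k = "\<one>\<^bsub>K\<^esub>" and ?T = "tensor \<Gamma> (along K \<epsilon>) M"
  have one: "?k \<in> carrier (along K \<epsilon>)" by (simp add: along_simps)
  have f: "f \<in> rmod_iso A (base_change \<Gamma> K \<epsilon> M) S" using deformationsD(3)[OF D] by simp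
  then have f_bij: "bij_betw f (carrier ?T) (carrier S)"
    and f_add: "\<And>X Y. X \<in> carrier ?T \<Longrightarrow> Y \<in> carrier ?T \<Longrightarrow> f (X \<otimes>\<^bsub>?T\<^esub> Y) = f X \<oplus>\<^bsub>S\<^esub> f Y"
    and f_ract: "\<And>X a. X \<in> carrier ?T \<Longrightarrow> a \<in> carrier A \<Longrightarrow>
        f (ract (base_change \<Gamma> K \<epsilon> M) X a) = ract S (f X) a"
    by (simp_all add: rmod_iso_def rmod_hom_def base_change_simps)
  define p where "p m = f (res.pure ?k m)" for m
  have pure_T: "m \<in> carrier M \<Longrightarrow> res.pure ?k m \<in> carrier ?T" for m
    using res.pure_closed[OF one] .
  have "\<exists>q\<in>carrier K. p m = \<sigma> q" if "m \<in> carrier M" for m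
    using bij_betw_apply[OF f_bij pure_T[OF that]] \<sigma>_bij unfolding p_def bij_betw_def by blast
  then obtain q where q: "\<And>m. m \<in> carrier M \<Longrightarrow> q m \<in> carrier K"
    "\<And>m. m \<in> carrier M \<Longrightarrow> p m = \<sigma> (q m)" by metis
  have q_eqI: "q m = c" if "m \<in> carrier M" "p m = \<sigma> c" "c \<in> carrier K" for m c
    using \<sigma>_inj[of "q m" c] q that by simp
  have p_ract: "p (ract M m a) = \<sigma> (q m \<otimes>\<^bsub>K\<^esub> \<chi> a)" if "m \<in> carrier M" "a \<in> carrier A" for m a
    using f_ract[OF pure_T[OF that(1)] that(2)]
      base_change_ract_pure[OF res.tensor_pair_axioms, of ?k m a] that q[OF that(1)]
    by (simp add: p_def \<sigma>_ract)
  have p_add: "p (m \<oplus>\<^bsub>M\<^esub> n) = \<sigma> (q m \<oplus>\<^bsub>K\<^esub> q n)" if "m \<in> carrier M" "n \<in> carrier M" for m n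
    using f_add[OF pure_T[OF that(1)] pure_T[OF that(2)]] res.pure_add_right[OF one that]
      q[OF that(1)] q[OF that(2)] by (simp add: p_def \<sigma>_add)
  have p_lact: "p (lact M g m) = \<sigma> (\<epsilon> g \<otimes>\<^bsub>K\<^esub> q m)" if "g \<in> carrier \<Gamma>" "m \<in> carrier M" for g m
  proof -
    have eg: "\<epsilon> g \<in> carrier K" using that by (simp add: aug_closed)
    have "p (lact M g m) = p (lact M (scalar (\<epsilon> g)) m)"
      using that eg pure_lact pure_scalar by (simp add: p_def)
    also have "\<dots> = p (ract M m (\<epsilon> g \<odot>\<^bsub>A\<^esub> \<one>\<^bsub>A\<^esub>))" using central[OF eg] that by (simp add: scalar_def)
    also have "\<dots> = \<sigma> (q m \<otimes>\<^bsub>K\<^esub> \<epsilon> g)"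
      using p_ract[OF that(2) scalar_A_closed[OF eg]] eg by (simp add: \<chi>_scalar)
    finally show ?thesis using eg q that by (simp add: K.m_comm)
  qed
  have p_kernel: "m \<in> H" if "m \<in> carrier M" "q m = \<zero>\<^bsub>K\<^esub>" "subgroup H (add_monoid M)"
    "\<And>x v. \<lbrakk>x \<in> max_ideal; v \<in> carrier M\<rbrakk> \<Longrightarrow> lact M x v \<in> H" for m H
  proof -
    have "p (lact M \<zero>\<^bsub>\<Gamma>\<^esub> m) = \<sigma> \<zero>\<^bsub>K\<^esub>" using p_lact[of "\<zero>\<^bsub>\<Gamma>\<^esub>" m] that q by simp
    then have "p m = p \<zero>\<^bsub>M\<^esub>" using that q by (simp add: lact_zero_left)
    then have "res.pure ?k m = res.pure ?k \<zero>\<^bsub>M\<^esub>"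
      using f_bij pure_T that unfolding p_def bij_betw_def by (auto dest: inj_onD)
    then have "res.pure ?k m = res.cls 0" using res.pure_zero_right[OF one] by simp
    then show ?thesis using residue_kernel that by blast
  qed
  obtain b where b: "b \<in> carrier M" and pb: "p b = \<sigma> ?k"
  proof -
    have "\<sigma> ?k \<in> f ` carrier ?T"
      using bij_betw_apply[OF \<sigma>_bij, of ?k] f_bij by (simp add: bij_betw_def)
    then obtain X where X: "X \<in> carrier ?T" "\<sigma> ?k = f X" by (rule imageE)
    obtain m where "m \<in> carrier M" "X = res.pure ?k m" using pure_one_surj[OF X(1)] by blast
    then show ?thesis using that X(2) unfolding p_def by simp
  qed
  have qb: "q b = ?k" using q_eqI[OF b pb] by simp
  define N where "N = {lact M g b | g. g \<in> carrier \<Gamma>}"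
  have N_add: "v \<oplus>\<^bsub>M\<^esub> w \<in> N" if vw: "v \<in> N" "w \<in> N" for v w
  proof -
    obtain g h where gh: "g \<in> carrier \<Gamma>" "v = lact M g b" "h \<in> carrier \<Gamma>" "w = lact M h b"
      using vw unfolding N_def by blast
    then have "v \<oplus>\<^bsub>M\<^esub> w = lact M (g \<oplus>\<^bsub>\<Gamma>\<^esub> h) b" using b by (simp add: lact_add_left)
    then show ?thesis unfolding N_def using gh by blast
  qed
  have N_minus: "\<ominus>\<^bsub>M\<^esub> v \<in> N" if v: "v \<in> N" for v
  proof -
    obtain g where g: "g \<in> carrier \<Gamma>" "v = lact M g b" using v unfolding N_def by blast
    then have "\<ominus>\<^bsub>M\<^esub> v = lact M (\<ominus>\<^bsub>\<Gamma>\<^esub> g) b" using b by (simp add: lact_minus_left)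
    then show ?thesis unfolding N_def using g by blast
  qed
  have N_zero: "\<zero>\<^bsub>M\<^esub> \<in> N"
    unfolding N_def using lact_zero_left[OF b] by (metis (mono_tags, lifting) \<Gamma>.zero_closed mem_Collect_eq)
  have "\<forall>m\<in>carrier M. lact M \<one>\<^bsub>\<Gamma>\<^esub> m \<in> N"
  proof (rule nilpotent_induct[of "\<one>\<^bsub>\<Gamma>\<^esub>" "\<lambda>y. \<forall>m\<in>carrier M. lact M y m \<in> N"])
    show "\<forall>m\<in>carrier M. lact M \<zero>\<^bsub>\<Gamma>\<^esub> m \<in> N" using N_zero by (simp add: lact_zero_left)
  next
    fix y assume y: "y \<in> carrier \<Gamma>"
      and IH: "\<And>x. x \<in> max_ideal \<Longrightarrow> \<forall>m\<in>carrier M. lact M (y \<otimes>\<^bsub>\<Gamma>\<^esub> x) m \<in> N"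
    \<comment> \<open>the induction hypothesis says that \<open>H\<close> contains all multiples by the augmentation ideal\<close>
    define H where "H = {v \<in> carrier M. lact M y v \<in> N}"
    have H: "subgroup H (add_monoid M)"
    proof (rule group.subgroupI[OF M.a_group])
      show "H \<noteq> {}" using N_zero y by (auto simp: H_def lact_zero_right intro!: exI[of _ "\<zero>\<^bsub>M\<^esub>"])
      fix v assume v: "v \<in> H"
      then show "inv\<^bsub>add_monoid M\<^esub> v \<in> H"
        using N_minus y by (simp add: H_def lact_minus_right flip: a_inv_def)
      fix w assume "w \<in> H"
      then show "v \<otimes>\<^bsub>add_monoid M\<^esub> w \<in> H" using v N_add y by (simp add: H_def lact_add_right)
    qed (auto simp: H_def)
    show "\<forall>m\<in>carrier M. lact M y m \<in> N"
    proof
      fix m assume m: "m \<in> carrier M"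
      \<comment> \<open>\<open>m\<close> is split into a multiple of \<open>b\<close> and a part \<open>m - n\<close> in the kernel of the functional\<close>
      define n where "n = lact M (scalar (q m)) b"
      have n: "n \<in> carrier M" unfolding n_def using m b q by (simp add: lact_closed scalar_closed)
      have qn: "q n = q m"
        unfolding n_def using m b q p_lact[of "scalar (q m)" b]
        by (intro q_eqI) (simp_all add: lact_closed scalar_closed aug_scalar qb)
      let ?d = "m \<ominus>\<^bsub>M\<^esub> n"
      have d: "?d \<in> carrier M" using m n by simp
      have dn: "?d \<oplus>\<^bsub>M\<^esub> n = m" using m n by (rule M.minus_add_cancel)
      have "q m = q ?d \<oplus>\<^bsub>K\<^esub> q n" using p_add[OF d n] q d n m by (intro q_eqI) (simp_all add: dn)
      then have "q ?d = \<zero>\<^bsub>K\<^esub>" using q[OF m] q[OF d] qn by (simp add: K.add.r_cancel_one')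
      then have "?d \<in> H"
      proof (rule p_kernel[OF d _ H])
        fix x v assume x: "x \<in> max_ideal" and v: "v \<in> carrier M"
        have xc: "x \<in> carrier \<Gamma>" using x by (simp add: max_ideal_def)
        have "lact M (y \<otimes>\<^bsub>\<Gamma>\<^esub> x) v \<in> N" using IH[OF x] v by blast
        then show "lact M x v \<in> H" using xc y v by (simp add: H_def lact_closed lact_mult)
      qed
      then have 1: "lact M y ?d \<in> N" by (simp add: H_def)
      have "lact M y n = lact M (y \<otimes>\<^bsub>\<Gamma>\<^esub> scalar (q m)) b"
        unfolding n_def using y b q m by (simp add: lact_mult scalar_closed)
      then have 2: "lact M y n \<in> N" unfolding N_def using y q m scalar_closed \<Gamma>.m_closed by blast
      have "lact M y m = lact M y ?d \<oplus>\<^bsub>M\<^esub> lact M y n"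
        using lact_add_right[OF y d n] by (simp add: dn)
      then show "lact M y m \<in> N" using N_add[OF 1 2] by simp
    qed
  qed simp
  then have span: "\<exists>g\<in>carrier \<Gamma>. m = lact M g b" if "m \<in> carrier M" for m
    using that by (auto simp: lact_one N_def)
  \<comment> \<open>the functional takes the value $\epsilon(z)$ at $z b = 0$, so $1 - z$ is a unit, and $g (1 - z) = 0$\<close>
  have ann: "g = \<zero>\<^bsub>\<Gamma>\<^esub>" if g: "g \<in> carrier \<Gamma>" "lact M g b = \<zero>\<^bsub>M\<^esub>" for g
  proof -
    obtain z where z: "z \<in> carrier \<Gamma>" "g \<otimes>\<^bsub>\<Gamma>\<^esub> z = g" "lact M z b = \<zero>\<^bsub>M\<^esub>"
      using annihilator_flat[OF flat b span g] by blast
    have "q \<zero>\<^bsub>M\<^esub> = \<epsilon> z \<otimes>\<^bsub>K\<^esub> q b"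
      using p_lact[OF z(1) b] z b q by (intro q_eqI) (simp_all add: aug_closed)
    moreover have "q \<zero>\<^bsub>M\<^esub> = \<zero>\<^bsub>K\<^esub>"
      using p_lact[of "\<zero>\<^bsub>\<Gamma>\<^esub>" b] b q by (intro q_eqI) (simp_all add: lact_zero_left)
    ultimately have "z \<in> max_ideal" using z by (simp add: max_ideal_def qb aug_closed)
    then have u: "\<one>\<^bsub>\<Gamma>\<^esub> \<ominus>\<^bsub>\<Gamma>\<^esub> z \<in> Units \<Gamma>" by (rule one_minus_unit)
    have "g \<otimes>\<^bsub>\<Gamma>\<^esub> (\<one>\<^bsub>\<Gamma>\<^esub> \<ominus>\<^bsub>\<Gamma>\<^esub> z) = \<zero>\<^bsub>\<Gamma>\<^esub> \<otimes>\<^bsub>\<Gamma>\<^esub> (\<one>\<^bsub>\<Gamma>\<^esub> \<ominus>\<^bsub>\<Gamma>\<^esub> z)"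
      using z g by (simp add: a_minus_def \<Gamma>.r_distr \<Gamma>.r_minus \<Gamma>.r_neg)
    then show ?thesis using u g \<Gamma>.Units_r_inv[OF u] \<Gamma>.Units_inv_closed[OF u] z
      by (metis \<Gamma>.m_assoc \<Gamma>.minus_closed \<Gamma>.one_closed \<Gamma>.r_one \<Gamma>.l_null)
  qed
  have "inj_on (\<lambda>g. lact M g b) (carrier \<Gamma>)"
  proof (rule inj_onI)
    fix g h assume gh: "g \<in> carrier \<Gamma>" "h \<in> carrier \<Gamma>" "lact M g b = lact M h b"
    then have "lact M (g \<ominus>\<^bsub>\<Gamma>\<^esub> h) b = \<zero>\<^bsub>M\<^esub>"
      using b by (simp add: lact_diff_left) (simp add: a_minus_def lact_closed M.r_neg)
    then have "g \<ominus>\<^bsub>\<Gamma>\<^esub> h = \<zero>\<^bsub>\<Gamma>\<^esub>" using gh by (intro ann) auto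
    moreover have "(g \<ominus>\<^bsub>\<Gamma>\<^esub> h) \<oplus>\<^bsub>\<Gamma>\<^esub> h = g"
      using gh by (simp add: \<Gamma>.minus_add_cancel)
    ultimately show "g = h" using gh by simp
  qed
  moreover have "(\<lambda>g. lact M g b) ` carrier \<Gamma> = carrier M"
    using span b by (auto simp: lact_closed)
  ultimately interpret B: based_module K A \<Gamma> M b
    using b by unfold_locales (auto simp: bij_betw_def)
  define r where "r a = B.coord (ract M b a)" for a
  have r: "r a \<in> carrier \<Gamma>" "lact M (r a) b = ract M b a" if "a \<in> carrier A" for a
    unfolding r_def using that b by (simp_all add: B.coord_closed B.lact_coord ract_closed)
  have "f (res.pure c b) = \<sigma> c" if "c \<in> carrier K" for c
    using pure_scalar[OF that b] p_lact[OF scalar_closed[OF that] b] that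
    by (simp add: p_def aug_scalar qb)
  then have "framed K A \<sigma> (\<Gamma>, \<epsilon>) r (M, f) b"
    unfolding framed_def using B.based_module_axioms r by simp
  moreover have "\<epsilon> (r a) = \<chi> a" if "a \<in> carrier A" for a
  proof -
    have "\<sigma> (\<epsilon> (r a)) = \<sigma> (\<chi> a)"
      using p_lact[OF r(1)[OF that] b] p_ract[OF b that] r[OF that] that
      by (simp add: qb aug_closed \<chi>_closed)
    then show ?thesis using that r by (intro \<sigma>_inj) (auto simp: aug_closed \<chi>_closed)
  qed
  ultimately show ?thesis by blast
qed

end

section \<open>Comparison of framings\<close>

text \<open>$\Gamma$ as a module over itself with \<open>A\<close> acting through \<open>r\<close>, copied along an injection \<open>\<kappa>\<close> into
  the type in which deformations are to live.\<close>
definition regular ::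
  "('k, 'g) module \<Rightarrow> ('a \<Rightarrow> 'g) \<Rightarrow> ('g \<Rightarrow> 'm) \<Rightarrow> ('a, 'g, 'm) bimod" where
  "regular \<Gamma> r \<kappa> = \<lparr>carrier = \<kappa> ` carrier \<Gamma>, mult = undefined, one = undefined,
     ring.zero = \<kappa> \<zero>\<^bsub>\<Gamma>\<^esub>, add = (\<lambda>x y. \<kappa> (inv_into UNIV \<kappa> x \<oplus>\<^bsub>\<Gamma>\<^esub> inv_into UNIV \<kappa> y)),
     ract = (\<lambda>x a. \<kappa> (inv_into UNIV \<kappa> x \<otimes>\<^bsub>\<Gamma>\<^esub> r a)), lact = (\<lambda>g x. \<kappa> (g \<otimes>\<^bsub>\<Gamma>\<^esub> inv_into UNIV \<kappa> x))\<rparr>"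

lemma regular_simps:
  assumes "inj \<kappa>"
  shows "carrier (regular \<Gamma> r \<kappa>) = \<kappa> ` carrier \<Gamma>" "\<zero>\<^bsub>regular \<Gamma> r \<kappa>\<^esub> = \<kappa> \<zero>\<^bsub>\<Gamma>\<^esub>"
    "\<kappa> x \<oplus>\<^bsub>regular \<Gamma> r \<kappa>\<^esub> \<kappa> y = \<kappa> (x \<oplus>\<^bsub>\<Gamma>\<^esub> y)" "ract (regular \<Gamma> r \<kappa>) (\<kappa> x) a = \<kappa> (x \<otimes>\<^bsub>\<Gamma>\<^esub> r a)"
    "lact (regular \<Gamma> r \<kappa>) g (\<kappa> x) = \<kappa> (g \<otimes>\<^bsub>\<Gamma>\<^esub> x)"
  using assms by (simp_all add: regular_def)

lemma tensor_module_regular: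
  fixes \<kappa> :: "'g \<Rightarrow> 'm"
  assumes A: "ring A" and \<Gamma>: "k_algebra K \<Gamma>" and r: "r \<in> ring_hom A \<Gamma>"
    and r_scalar: "\<And>c. c \<in> carrier K \<Longrightarrow> r (c \<odot>\<^bsub>A\<^esub> \<one>\<^bsub>A\<^esub>) = c \<odot>\<^bsub>\<Gamma>\<^esub> \<one>\<^bsub>\<Gamma>\<^esub>"
    and \<kappa>: "inj \<kappa>"
  shows "tensor_module K A \<Gamma> (regular \<Gamma> r \<kappa>)"
proof -
  interpret A: ring A by fact
  have ring\<Gamma>: "ring \<Gamma>" using \<Gamma> by (simp add: k_algebra_def)
  interpret \<Gamma>: ring \<Gamma> by (rule ring\<Gamma>)
  interpret r: ring_hom_ring A \<Gamma> r by (rule ring_hom_ringI2) fact+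
  have ab: "abelian_group (regular \<Gamma> r \<kappa>)"
  proof (rule abelian_groupI)
    fix x assume "x \<in> carrier (regular \<Gamma> r \<kappa>)"
    then obtain y where y: "y \<in> carrier \<Gamma>" "x = \<kappa> y" by (auto simp: regular_simps[OF \<kappa>])
    then show "\<exists>x'\<in>carrier (regular \<Gamma> r \<kappa>). x' \<oplus>\<^bsub>regular \<Gamma> r \<kappa>\<^esub> x = \<zero>\<^bsub>regular \<Gamma> r \<kappa>\<^esub>"
      by (intro bexI[of _ "\<kappa> (\<ominus>\<^bsub>\<Gamma>\<^esub> y)"]) (simp_all add: regular_simps[OF \<kappa>] \<Gamma>.l_neg)
  qed (auto simp: regular_simps[OF \<kappa>] \<Gamma>.a_ac)
  have scal: "y \<otimes>\<^bsub>\<Gamma>\<^esub> (c \<odot>\<^bsub>\<Gamma>\<^esub> \<one>\<^bsub>\<Gamma>\<^esub>) = (c \<odot>\<^bsub>\<Gamma>\<^esub> \<one>\<^bsub>\<Gamma>\<^esub>) \<otimes>\<^bsub>\<Gamma>\<^esub> y"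
    if "c \<in> carrier K" "y \<in> carrier \<Gamma>" for c y
    using that k_algebra.smult_mult_right[OF \<Gamma>, of c y "\<one>\<^bsub>\<Gamma>\<^esub>"]
      k_algebra.smult_mult_left[OF \<Gamma>, of c "\<one>\<^bsub>\<Gamma>\<^esub>" y] by simp
  show ?thesis
  proof (intro tensor_module.intro right_module.intro right_module_axioms.intro
      tensor_module_axioms.intro A.ring_axioms ring\<Gamma> ab)
  qed (auto simp: regular_simps[OF \<kappa>] \<Gamma>.l_distr \<Gamma>.r_distr \<Gamma>.m_assoc r_scalar scal)
qed

text \<open>The structure of a quotient or of a copy of a module needs no verification of its own as soon
  as a surjection preserves all operations.\<close>
lemma tensor_module_image:
  assumes M: "tensor_module K A \<Gamma> M" and N: "carrier N = T ` carrier M" "\<zero>\<^bsub>N\<^esub> = T \<zero>\<^bsub>M\<^esub>"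
    and add: "\<And>x y. \<lbrakk>x \<in> carrier M; y \<in> carrier M\<rbrakk> \<Longrightarrow> T x \<oplus>\<^bsub>N\<^esub> T y = T (x \<oplus>\<^bsub>M\<^esub> y)"
    and ra: "\<And>x a. \<lbrakk>x \<in> carrier M; a \<in> carrier A\<rbrakk> \<Longrightarrow> ract N (T x) a = T (ract M x a)"
    and la: "\<And>g x. \<lbrakk>g \<in> carrier \<Gamma>; x \<in> carrier M\<rbrakk> \<Longrightarrow> lact N g (T x) = T (lact M g x)"
    and scal: "\<And>c. c \<in> carrier K \<Longrightarrow> c \<odot>\<^bsub>A\<^esub> \<one>\<^bsub>A\<^esub> \<in> carrier A"
      "\<And>c. c \<in> carrier K \<Longrightarrow> c \<odot>\<^bsub>\<Gamma>\<^esub> \<one>\<^bsub>\<Gamma>\<^esub> \<in> carrier \<Gamma>"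
  shows "tensor_module K A \<Gamma> N"
proof -
  interpret tensor_module K A \<Gamma> M by fact
  have ab: "abelian_group N"
  proof (rule abelian_groupI)
    fix x assume "x \<in> carrier N"
    then obtain y where y: "y \<in> carrier M" "x = T y" by (auto simp: N)
    then show "\<exists>x'\<in>carrier N. x' \<oplus>\<^bsub>N\<^esub> x = \<zero>\<^bsub>N\<^esub>"
      by (intro bexI[of _ "T (\<ominus>\<^bsub>M\<^esub> y)"]) (simp_all add: N add M.l_neg)
  qed (auto simp: N add M.a_ac)
  show ?thesis
  proof (intro tensor_module.intro right_module.intro right_module_axioms.intro
      tensor_module_axioms.intro R.ring_axioms \<Gamma>.ring_axioms ab)
  qed (auto simp: N add ra la ract_closed ract_add_left ract_add_right ract_mult ract_one
      lact_closed lact_add_left lact_add_right lact_mult lact_one lact_ract central scal)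
qed

context point_artin begin

lemma framed_residue:
  assumes "framed K A \<sigma> (\<Gamma>, \<epsilon>) r (M, f) b"
  shows "based_module K A \<Gamma> M b" "residue_pair K A \<Gamma> \<epsilon> M"
proof -
  show B: "based_module K A \<Gamma> M b" using assms by (simp add: framed_def)
  then interpret based_module K A \<Gamma> M b .
  show "residue_pair K A \<Gamma> \<epsilon> M" ..
qed

lemma framed_value:
  assumes F: "framed K A \<sigma> (\<Gamma>, \<epsilon>) r (M, f) b" and g: "g \<in> carrier \<Gamma>"
  shows "f (tensor_class \<Gamma> (along K \<epsilon>) M (frag_of (\<one>\<^bsub>K\<^esub>, lact M g b))) = \<sigma> (\<epsilon> g)"
proof -
  interpret based_module K A \<Gamma> M b by (rule framed_residue[OF F])
  interpret residue_pair K A \<Gamma> \<epsilon> M by (rule framed_residue[OF F])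
  show ?thesis using F g b_closed by (simp add: pure_lact framed_def aug_closed)
qed

lemma framedI:
  assumes B: "based_module K A \<Gamma> M b"
    and r: "\<And>a. a \<in> carrier A \<Longrightarrow> r a \<in> carrier \<Gamma>"
      "\<And>a. a \<in> carrier A \<Longrightarrow> ract M b a = lact M (r a) b"
    and f: "\<And>c. c \<in> carrier K \<Longrightarrow>
      f (tensor_class \<Gamma> (along K \<epsilon>) M (frag_of (\<one>\<^bsub>K\<^esub>, lact M (scalar c) b))) = \<sigma> c"
  shows "framed K A \<sigma> (\<Gamma>, \<epsilon>) r (M, f) b"
proof -
  interpret based_module K A \<Gamma> M b by (rule B)
  interpret residue_pair K A \<Gamma> \<epsilon> M ..
  show ?thesis using B r f b_closed by (simp add: framed_def pure_scalar)
qed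

text \<open>Multiplicativity comes out in the right order because \<open>A\<close> acts on the right and $\Gamma$ on the
  left: $(b a) a' = r(a) b a' = r(a) r(a') b$.\<close>
lemma framed_hom:
  assumes F: "framed K A \<sigma> (\<Gamma>, \<epsilon>) r (M, f) b"
  shows "r \<in> ring_hom A \<Gamma>"
    and "c \<in> carrier K \<Longrightarrow> r (c \<odot>\<^bsub>A\<^esub> \<one>\<^bsub>A\<^esub>) = scalar c"
proof -
  interpret based_module K A \<Gamma> M b by (rule framed_residue[OF F])
  have r: "r a \<in> carrier \<Gamma>" "ract M b a = lact M (r a) b" if "a \<in> carrier A" for a
    using F that by (auto simp: framed_def)
  show "r \<in> ring_hom A \<Gamma>"
  proof (rule ring_hom_memI)
    fix a a' assume a: "a \<in> carrier A" "a' \<in> carrier A"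
    have "lact M (r (a \<otimes>\<^bsub>A\<^esub> a')) b = ract M (ract M b a) a'"
      using a b_closed by (simp add: ract_mult flip: r(2))
    also have "\<dots> = lact M (r a) (ract M b a')" using a b_closed r by (simp only: lact_ract)
    finally have "lact M (r (a \<otimes>\<^bsub>A\<^esub> a')) b = lact M (r a) (lact M (r a') b)" using a r by simp
    then show "r (a \<otimes>\<^bsub>A\<^esub> a') = r a \<otimes>\<^bsub>\<Gamma>\<^esub> r a'"
      using a r b_closed by (intro lact_b_inj) (simp_all add: lact_mult)
    have "lact M (r (a \<oplus>\<^bsub>A\<^esub> a')) b = lact M (r a \<oplus>\<^bsub>\<Gamma>\<^esub> r a') b"
      using a b_closed r by (simp add: ract_add_right lact_add_left flip: r(2))
    then show "r (a \<oplus>\<^bsub>A\<^esub> a') = r a \<oplus>\<^bsub>\<Gamma>\<^esub> r a'"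
      using a r by (intro lact_b_inj) simp_all
  next
    show "r \<one>\<^bsub>A\<^esub> = \<one>\<^bsub>\<Gamma>\<^esub>"
      using r[of "\<one>\<^bsub>A\<^esub>"] b_closed by (intro lact_b_inj) (simp_all add: ract_one lact_one)
  qed (rule r)
  show "r (c \<odot>\<^bsub>A\<^esub> \<one>\<^bsub>A\<^esub>) = scalar c" if "c \<in> carrier K"
    using r[OF scalar_A_closed[OF that]] central[OF that b_closed] that
    by (intro lact_b_inj) (simp_all add: scalar_closed flip: scalar_def)
qed

text \<open>The special fibre of a module that is free on \<open>b\<close> consists of the elements $c \otimes b$, where
  the framing condition determines the structure map.\<close>
lemma framed_deformation:
  assumes F: "framed K A \<sigma> (\<Gamma>, \<epsilon>) r (M, f) b"
    and r\<chi>: "\<And>a. a \<in> carrier A \<Longrightarrow> \<epsilon> (r a) = \<chi> a"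
  shows "(M, f) \<in> deformations K A S (\<Gamma>, \<epsilon>)"
proof -
  interpret based_module K A \<Gamma> M b by (rule framed_residue[OF F])
  interpret residue_pair K A \<Gamma> \<epsilon> M by (rule framed_residue[OF F])
  interpret N: right_module \<Gamma> "along K \<epsilon>" by (rule res.N.right_module_axioms)
  interpret P: based_pair K A \<Gamma> M b "along K \<epsilon>" ..
  let ?T = "tensor \<Gamma> (along K \<epsilon>) M" and ?B = "base_change \<Gamma> K \<epsilon> M"
  have carr: "carrier ?T = (\<lambda>c. res.pure c b) ` carrier K"
    using P.carrier_tensor_based by (simp add: along_simps)
  have f: "f (res.pure c b) = \<sigma> c" if "c \<in> carrier K" for c using F that by (simp add: framed_def)
  have r: "r a \<in> carrier \<Gamma>" "ract M b a = lact M (r a) b" if "a \<in> carrier A" for a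
    using F that by (auto simp: framed_def)
  have "f \<in> rmod_hom A ?B S"
    unfolding rmod_hom_def base_change_simps carr
  proof (intro CollectI conjI ballI)
    show "f \<in> (\<lambda>c. res.pure c b) ` carrier K \<rightarrow> carrier S"
      using \<sigma>_bij by (auto simp: f bij_betw_def)
    fix X assume "X \<in> (\<lambda>c. res.pure c b) ` carrier K"
    then obtain c where c: "c \<in> carrier K" "X = res.pure c b" by blast
    { fix Y assume "Y \<in> (\<lambda>c. res.pure c b) ` carrier K"
      then obtain d where d: "d \<in> carrier K" "Y = res.pure d b" by blast
      have "res.pure (c \<oplus>\<^bsub>K\<^esub> d) b = X \<otimes>\<^bsub>?T\<^esub> Y"
        using res.pure_add_left[of c d b] c d b_closed by (simp add: along_simps)
      from this[symmetric] show "f (X \<otimes>\<^bsub>?T\<^esub> Y) = f X \<oplus>\<^bsub>S\<^esub> f Y" using c d by (simp add: f \<sigma>_add) }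
    fix a assume a: "a \<in> carrier A"
    have "ract ?B X a = res.pure c (lact M (r a) b)"
      using base_change_ract_pure[OF res.tensor_pair_axioms] c b_closed a r by simp
    also have "\<dots> = res.pure (c \<otimes>\<^bsub>K\<^esub> \<epsilon> (r a)) b"
      using res.pure_balance[of c "r a" b] c a r b_closed by (simp add: along_simps)
    finally show "f (ract ?B X a) = ract S (f X) a"
      using c a r by (simp add: f \<sigma>_ract r\<chi> \<chi>_closed)
  qed
  moreover have "bij_betw f (carrier ?B) (carrier S)"
    unfolding base_change_simps carr bij_betw_def
  proof
    show "inj_on f ((\<lambda>c. res.pure c b) ` carrier K)"
      by (rule inj_onI) (auto simp: f dest: \<sigma>_inj)
    show "f ` (\<lambda>c. res.pure c b) ` carrier K = carrier S"
      using \<sigma>_bij by (simp add: image_image f bij_betw_def cong: image_cong)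
  qed
  ultimately show ?thesis
    using flat tensor_module_axioms by (simp add: deformations_def rmod_iso_def)
qed

lemma framed_conj:
  assumes F: "framed K A \<sigma> (\<Gamma>, \<epsilon>) r (M, f) b"
    and u: "u \<in> Units \<Gamma>" "\<epsilon> u = \<one>\<^bsub>K\<^esub>"
    and r': "\<And>a. a \<in> carrier A \<Longrightarrow> r' a = u \<otimes>\<^bsub>\<Gamma>\<^esub> r a \<otimes>\<^bsub>\<Gamma>\<^esub> inv\<^bsub>\<Gamma>\<^esub> u"
  shows "framed K A \<sigma> (\<Gamma>, \<epsilon>) r' (M, f) (lact M u b)"
proof (rule framedI)
  interpret based_module K A \<Gamma> M b by (rule framed_residue[OF F])
  let ?v = "inv\<^bsub>\<Gamma>\<^esub> u"
  have uc: "u \<in> carrier \<Gamma>" "?v \<in> carrier \<Gamma>" "u \<otimes>\<^bsub>\<Gamma>\<^esub> ?v = \<one>\<^bsub>\<Gamma>\<^esub>" "?v \<otimes>\<^bsub>\<Gamma>\<^esub> u = \<one>\<^bsub>\<Gamma>\<^esub>" using u by auto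
  have r: "r a \<in> carrier \<Gamma>" "ract M b a = lact M (r a) b" if "a \<in> carrier A" for a
    using F that by (auto simp: framed_def)
  have "bij_betw (\<lambda>g. g \<otimes>\<^bsub>\<Gamma>\<^esub> u) (carrier \<Gamma>) (carrier \<Gamma>)"
    by (rule bij_betw_byWitness[of _ "\<lambda>g. g \<otimes>\<^bsub>\<Gamma>\<^esub> ?v"]) (auto simp: uc \<Gamma>.m_assoc)
  from bij_betw_trans[OF this b_basis]
  have "bij_betw (\<lambda>g. lact M (g \<otimes>\<^bsub>\<Gamma>\<^esub> u) b) (carrier \<Gamma>) (carrier M)" by (simp add: comp_def)
  then have "bij_betw (\<lambda>g. lact M g (lact M u b)) (carrier \<Gamma>) (carrier M)"
    using uc b_closed by (simp add: lact_mult cong: bij_betw_cong)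
  then show "based_module K A \<Gamma> M (lact M u b)"
    using uc b_closed by unfold_locales (auto simp: lact_closed)
  fix a assume a: "a \<in> carrier A"
  show "r' a \<in> carrier \<Gamma>" using a r uc by (simp add: r')
  have "lact M (r' a) (lact M u b) = lact M (u \<otimes>\<^bsub>\<Gamma>\<^esub> r a) b"
    using a r uc b_closed by (simp add: r' \<Gamma>.m_assoc flip: lact_mult)
  then show "ract M (lact M u b) a = lact M (r' a) (lact M u b)"
    using a r uc b_closed by (simp add: lact_ract lact_mult)
next
  interpret based_module K A \<Gamma> M b by (rule framed_residue[OF F])
  fix c assume c: "c \<in> carrier K"
  have "u \<in> carrier \<Gamma>" using u by auto
  then show "f (tensor_class \<Gamma> (along K \<epsilon>) M (frag_of (\<one>\<^bsub>K\<^esub>, lact M (scalar c) (lact M u b)))) = \<sigma> c"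
    using framed_value[OF F, of "scalar c \<otimes>\<^bsub>\<Gamma>\<^esub> u"] c b_closed u
    by (simp add: scalar_closed lact_mult aug_mult aug_scalar)
qed

text \<open>Two lifts of the same generator differ by a factor \<open>u\<close> of augmentation $1$, which is a unit.\<close>
lemma framed_unique:
  assumes F: "framed K A \<sigma> (\<Gamma>, \<epsilon>) r (M, f) b" and F': "framed K A \<sigma> (\<Gamma>, \<epsilon>) r' (M, f) b'"
  shows "\<exists>u\<in>Units \<Gamma>. \<forall>a\<in>carrier A. r' a = u \<otimes>\<^bsub>\<Gamma>\<^esub> r a \<otimes>\<^bsub>\<Gamma>\<^esub> inv\<^bsub>\<Gamma>\<^esub> u"
proof -
  interpret based_module K A \<Gamma> M b by (rule framed_residue[OF F])
  interpret B': based_module K A \<Gamma> M b' by (rule framed_residue[OF F'])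
  define u where "u = coord b'"
  have uc: "u \<in> carrier \<Gamma>" and ub: "lact M u b = b'"
    unfolding u_def by (simp_all add: coord_closed lact_coord B'.b_closed)
  have "\<sigma> (\<epsilon> u) = \<sigma> \<one>\<^bsub>K\<^esub>"
    using framed_value[OF F uc] framed_value[OF F', of "\<one>\<^bsub>\<Gamma>\<^esub>"] lact_one[OF B'.b_closed]
    by (simp add: ub)
  then have "\<epsilon> u = \<one>\<^bsub>K\<^esub>" using uc by (intro \<sigma>_inj) (auto simp: aug_closed)
  then have u: "u \<in> Units \<Gamma>" using unit_if_aug_nonzero[OF uc] by simp
  have "r' a = u \<otimes>\<^bsub>\<Gamma>\<^esub> r a \<otimes>\<^bsub>\<Gamma>\<^esub> inv\<^bsub>\<Gamma>\<^esub> u" if a: "a \<in> carrier A" for a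
  proof -
    have r: "r a \<in> carrier \<Gamma>" "ract M b a = lact M (r a) b"
      and r': "r' a \<in> carrier \<Gamma>" "ract M b' a = lact M (r' a) b'"
      using F F' a by (auto simp: framed_def)
    have "lact M (r' a \<otimes>\<^bsub>\<Gamma>\<^esub> u) b = lact M (r' a) b'"
      using r' uc b_closed by (simp add: lact_mult ub)
    also have "\<dots> = ract M (lact M u b) a" by (simp add: r' ub)
    also have "\<dots> = lact M (u \<otimes>\<^bsub>\<Gamma>\<^esub> r a) b" using r uc b_closed a by (simp add: lact_ract lact_mult)
    finally have "r' a \<otimes>\<^bsub>\<Gamma>\<^esub> u = u \<otimes>\<^bsub>\<Gamma>\<^esub> r a" using r r' uc by (intro lact_b_inj) auto
    then have "u \<otimes>\<^bsub>\<Gamma>\<^esub> r a \<otimes>\<^bsub>\<Gamma>\<^esub> inv\<^bsub>\<Gamma>\<^esub> u = r' a \<otimes>\<^bsub>\<Gamma>\<^esub> u \<otimes>\<^bsub>\<Gamma>\<^esub> inv\<^bsub>\<Gamma>\<^esub> u" by simp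
    also have "\<dots> = r' a" using r' u uc by (simp add: \<Gamma>.m_assoc)
    finally show ?thesis by simp
  qed
  then show ?thesis using u by blast
qed

text \<open>The special fibre consists of the elements $1 \otimes m$, so compatibility with the structure maps
  can be tested there.\<close>
lemma deform_iso_iff:
  assumes M: "tensor_module K A \<Gamma> M" and M': "tensor_module K A \<Gamma> M'"
  shows "deform_iso K A (\<Gamma>, \<epsilon>) (M, f) (M', f') \<longleftrightarrow> (\<exists>\<psi> \<in> bimod_iso A \<Gamma> M M'. \<forall>m\<in>carrier M.
    f (tensor_class \<Gamma> (along K \<epsilon>) M (frag_of (\<one>\<^bsub>K\<^esub>, m))) =
    f' (tensor_class \<Gamma> (along K \<epsilon>) M' (frag_of (\<one>\<^bsub>K\<^esub>, \<psi> m))))"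
proof -
  interpret M: tensor_module K A \<Gamma> M by fact
  interpret M': tensor_module K A \<Gamma> M' by fact
  interpret R: residue_pair K A \<Gamma> \<epsilon> M ..
  interpret R': residue_pair K A \<Gamma> \<epsilon> M' ..
  have one: "\<one>\<^bsub>K\<^esub> \<in> carrier (along K \<epsilon>)" by (simp add: along_simps)
  have map: "tensor_map \<Gamma> (along K \<epsilon>) M' id \<psi> (R.res.pure \<one>\<^bsub>K\<^esub> m) = R'.res.pure \<one>\<^bsub>K\<^esub> (\<psi> m)"
    if "\<psi> \<in> bimod_iso A \<Gamma> M M'" "m \<in> carrier M" for \<psi> m
    using that one
    by (subst tensor_map_class[OF R.res.tensor_pair_axioms R'.res.tensor_pair_axioms])
       (auto simp: bimod_iso_def rmod_iso_def rmod_hom_def)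
  show ?thesis
    unfolding deform_iso_def fst_conv snd_conv base_change_simps
  proof (rule bex_cong[OF refl])
    fix \<psi> assume \<psi>: "\<psi> \<in> bimod_iso A \<Gamma> M M'"
    show "(\<forall>X\<in>carrier (tensor \<Gamma> (along K \<epsilon>) M). f X = f' (tensor_map \<Gamma> (along K \<epsilon>) M' id \<psi> X)) \<longleftrightarrow>
      (\<forall>m\<in>carrier M. f (R.res.pure \<one>\<^bsub>K\<^esub> m) = f' (R'.res.pure \<one>\<^bsub>K\<^esub> (\<psi> m)))" (is "?L \<longleftrightarrow> ?R")
    proof
      assume ?L
      then show ?R using R.res.pure_closed[OF one] map[OF \<psi>] by metis
    next
      assume ?R
      then show ?L using R.pure_one_surj map[OF \<psi>] by metis
    qed
  qed
qed

text \<open>The isomorphism is the $\Gamma$-linear map that sends one basis element to the other.\<close>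
lemma deform_iso_if_framed:
  assumes F: "framed K A \<sigma> (\<Gamma>, \<epsilon>) r (M, f) b" and F': "framed K A \<sigma> (\<Gamma>, \<epsilon>) r' (M', f') b'"
    and r: "\<And>a. a \<in> carrier A \<Longrightarrow> r a = r' a"
  shows "deform_iso K A (\<Gamma>, \<epsilon>) (M, f) (M', f')"
proof -
  interpret B: based_module K A \<Gamma> M b by (rule framed_residue[OF F])
  interpret B': based_module K A \<Gamma> M' b' by (rule framed_residue[OF F'])
  define \<psi> where "\<psi> m = lact M' (B.coord m) b'" for m
  have rc: "r a \<in> carrier \<Gamma>" "ract M b a = lact M (r a) b" "ract M' b' a = lact M' (r a) b'"
    if "a \<in> carrier A" for a
    using F F' r that by (auto simp: framed_def)
  have \<psi>c: "\<psi> m \<in> carrier M'" if "m \<in> carrier M" for m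
    unfolding \<psi>_def using that by (simp add: B'.lact_closed B.coord_closed B'.b_closed)
  have bij: "bij_betw \<psi> (carrier M) (carrier M')"
    by (rule bij_betw_byWitness[of _ "\<lambda>m'. lact M (B'.coord m') b"])
       (auto simp: \<psi>_def B.coord_lact_b B'.coord_lact_b B.coord_closed B'.coord_closed B.lact_coord
         B'.lact_coord B.lact_closed B'.lact_closed B.b_closed B'.b_closed)
  have \<psi>_lact: "\<psi> (lact M g m) = lact M' g (\<psi> m)" if "g \<in> carrier \<Gamma>" "m \<in> carrier M" for g m
    unfolding \<psi>_def using that by (simp add: B.coord_lact B'.lact_mult B.coord_closed B'.b_closed)
  have "\<psi> (ract M m a) = ract M' (\<psi> m) a" if m: "m \<in> carrier M" and a: "a \<in> carrier A" for m a
  proof -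
    have "ract M m a = ract M (lact M (B.coord m) b) a" using m by (simp add: B.lact_coord)
    also have "\<dots> = lact M (B.coord m \<otimes>\<^bsub>\<Gamma>\<^esub> r a) b"
      using m a rc by (simp add: B.lact_ract B.coord_closed B.b_closed B.lact_mult)
    finally have "\<psi> (ract M m a) = lact M' (B.coord m \<otimes>\<^bsub>\<Gamma>\<^esub> r a) b'"
      using m a rc by (simp add: \<psi>_def B.coord_lact_b B.coord_closed)
    also have "\<dots> = ract M' (\<psi> m) a"
      using m a rc by (simp add: \<psi>_def B'.lact_ract B.coord_closed B'.b_closed B'.lact_mult)
    finally show ?thesis .
  qed
  moreover have "\<psi> (x \<oplus>\<^bsub>M\<^esub> y) = \<psi> x \<oplus>\<^bsub>M'\<^esub> \<psi> y" if "x \<in> carrier M" "y \<in> carrier M" for x y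
    unfolding \<psi>_def using that by (simp add: B.coord_add B'.lact_add_left B.coord_closed B'.b_closed)
  ultimately have "\<psi> \<in> bimod_iso A \<Gamma> M M'"
    unfolding bimod_iso_def rmod_iso_def rmod_hom_def using bij \<psi>c \<psi>_lact by blast
  moreover have "f (tensor_class \<Gamma> (along K \<epsilon>) M (frag_of (\<one>\<^bsub>K\<^esub>, m))) =
    f' (tensor_class \<Gamma> (along K \<epsilon>) M' (frag_of (\<one>\<^bsub>K\<^esub>, \<psi> m)))" if m: "m \<in> carrier M" for m
    using framed_value[OF F B.coord_closed[OF m]] framed_value[OF F' B.coord_closed[OF m]] m
    by (simp add: B.lact_coord \<psi>_def)
  ultimately show ?thesis
    unfolding deform_iso_iff[OF B.tensor_module_axioms B'.tensor_module_axioms] by blast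
qed

lemma framed_deform_iso:
  assumes F: "framed K A \<sigma> (\<Gamma>, \<epsilon>) r (M, f) b" and M': "tensor_module K A \<Gamma> M'"
    and iso: "deform_iso K A (\<Gamma>, \<epsilon>) (M, f) (M', f')"
  shows "\<exists>b'. framed K A \<sigma> (\<Gamma>, \<epsilon>) r (M', f') b'"
proof -
  interpret B: based_module K A \<Gamma> M b by (rule framed_residue[OF F])
  interpret M': tensor_module K A \<Gamma> M' by fact
  obtain \<psi> where \<psi>: "\<psi> \<in> bimod_iso A \<Gamma> M M'" and f: "\<And>m. m \<in> carrier M \<Longrightarrow>
      f (tensor_class \<Gamma> (along K \<epsilon>) M (frag_of (\<one>\<^bsub>K\<^esub>, m))) =
      f' (tensor_class \<Gamma> (along K \<epsilon>) M' (frag_of (\<one>\<^bsub>K\<^esub>, \<psi> m)))"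
    using iso unfolding deform_iso_iff[OF B.tensor_module_axioms M'] by blast
  have bij: "bij_betw \<psi> (carrier M) (carrier M')"
    and \<psi>_ract: "\<And>m a. m \<in> carrier M \<Longrightarrow> a \<in> carrier A \<Longrightarrow> \<psi> (ract M m a) = ract M' (\<psi> m) a"
    and \<psi>_lact: "\<And>g m. g \<in> carrier \<Gamma> \<Longrightarrow> m \<in> carrier M \<Longrightarrow> \<psi> (lact M g m) = lact M' g (\<psi> m)"
    using \<psi> by (simp_all add: bimod_iso_def rmod_iso_def rmod_hom_def)
  have "framed K A \<sigma> (\<Gamma>, \<epsilon>) r (M', f') (\<psi> b)"
  proof (rule framedI)
    have "bij_betw (\<lambda>g. lact M' g (\<psi> b)) (carrier \<Gamma>) (carrier M')"
      using bij_betw_trans[OF B.b_basis bij] B.b_closed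
      by (simp add: comp_def \<psi>_lact cong: bij_betw_cong)
    then show "based_module K A \<Gamma> M' (\<psi> b)"
      using bij_betw_apply[OF bij B.b_closed] by unfold_locales auto
  next
    fix c assume c: "c \<in> carrier K"
    show "f' (tensor_class \<Gamma> (along K \<epsilon>) M' (frag_of (\<one>\<^bsub>K\<^esub>, lact M' (scalar c) (\<psi> b)))) = \<sigma> c"
      using f[of "lact M (scalar c) b"] framed_value[OF F scalar_closed[OF c]] c B.b_closed
      by (simp add: B.lact_closed \<psi>_lact scalar_closed aug_scalar)
  next
    fix a assume a: "a \<in> carrier A"
    then show "r a \<in> carrier \<Gamma>" using F by (simp add: framed_def)
    with a show "ract M' (\<psi> b) a = lact M' (r a) (\<psi> b)"
      using F B.b_closed \<psi>_lact[of "r a" b] \<psi>_ract[of b a] by (simp add: framed_def)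
  qed
  then show ?thesis by blast
qed

text \<open>On a free module of rank one the special fibre is identified with the ground field by
  $c \otimes b \mapsto c$.\<close>
lemma framing_exists:
  assumes B: "based_module K A \<Gamma> M b"
    and r: "\<And>a. a \<in> carrier A \<Longrightarrow> r a \<in> carrier \<Gamma>"
      "\<And>a. a \<in> carrier A \<Longrightarrow> ract M b a = lact M (r a) b"
  shows "\<exists>f. framed K A \<sigma> (\<Gamma>, \<epsilon>) r (M, f) b"
proof -
  interpret based_module K A \<Gamma> M b by (rule B)
  interpret residue_pair K A \<Gamma> \<epsilon> M ..
  interpret N: right_module \<Gamma> "along K \<epsilon>" by (rule res.N.right_module_axioms)
  interpret P: based_pair K A \<Gamma> M b "along K \<epsilon>" ..
  define f where "f X = \<sigma> (THE c. c \<in> carrier K \<and> X = res.pure c b)" for X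
  have "f (res.pure c b) = \<sigma> c" if "c \<in> carrier K" for c
  proof -
    have "(THE c'. c' \<in> carrier K \<and> res.pure c b = res.pure c' b) = c"
    proof (rule the_equality)
      fix c' assume "c' \<in> carrier K \<and> res.pure c b = res.pure c' b"
      then show "c' = c" using that by (intro P.pure_b_inj) (simp_all add: along_simps)
    qed (use that in simp)
    then show ?thesis by (simp add: f_def)
  qed
  then have "framed K A \<sigma> (\<Gamma>, \<epsilon>) r (M, f) b"
    unfolding framed_def using B r by simp
  then show ?thesis by blast
qed

lemma framed_regular:
  fixes \<kappa> :: "'g \<Rightarrow> 'm"
  assumes r: "r \<in> ring_hom A \<Gamma>"
    and r_scalar: "\<And>c. c \<in> carrier K \<Longrightarrow> r (c \<odot>\<^bsub>A\<^esub> \<one>\<^bsub>A\<^esub>) = scalar c"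
    and \<kappa>: "inj \<kappa>"
  shows "\<exists>f. framed K A \<sigma> (\<Gamma>, \<epsilon>) r (regular \<Gamma> r \<kappa>, f) (\<kappa> \<one>\<^bsub>\<Gamma>\<^esub>)"
proof (rule framing_exists)
  let ?M = "regular \<Gamma> r \<kappa>" and ?b = "\<kappa> \<one>\<^bsub>\<Gamma>\<^esub>"
  have ringA: "ring A" using A_alg unfolding k_algebra_def by blast
  have M: "tensor_module K A \<Gamma> ?M"
    using r_scalar by (intro tensor_module_regular ringA alg r \<kappa>) (simp add: scalar_def)
  have "bij_betw (\<lambda>g. \<kappa> g) (carrier \<Gamma>) (\<kappa> ` carrier \<Gamma>)"
    using \<kappa> by (auto simp: bij_betw_def intro: inj_on_subset)
  then have bij: "bij_betw (\<lambda>g. lact ?M g ?b) (carrier \<Gamma>) (carrier ?M)"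
    unfolding regular_simps(1)[OF \<kappa>] by (simp add: regular_simps(5)[OF \<kappa>] cong: bij_betw_cong)
  have b: "?b \<in> carrier ?M" unfolding regular_simps(1)[OF \<kappa>] by (rule imageI) simp
  show "based_module K A \<Gamma> ?M ?b"
    by (rule based_module.intro[OF M based_module_axioms.intro[OF b bij]])
  fix a assume a: "a \<in> carrier A"
  show rc: "r a \<in> carrier \<Gamma>" using r a by (rule ring_hom_closed)
  show "ract ?M ?b a = lact ?M (r a) ?b" using rc by (simp add: regular_simps[OF \<kappa>])
qed

end

section \<open>Base change\<close>

text \<open>Every element of $\Delta \otimes_\Gamma M$ is uniquely $d \otimes b$, and in this coordinate \<open>d\<close>
  all operations are those of $\Delta$. The canonical map from $k \otimes_\Delta (\Delta \otimes_\Gamma M)$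
  is defined through arbitrary representatives of two nested classes. Its effect is computed by
  applying \<open>contract\<close> on both sides: the two resulting homomorphisms from a free abelian group to
  the ground field agree on generators.\<close>
context point_artin begin

lemma framed_base_change:
  assumes F: "framed K A \<sigma> (\<Gamma>, \<epsilon>) r (M, f) b"
    and H: "artin K \<Delta> \<delta>" and \<phi>: "\<phi> \<in> art_hom K (\<Gamma>, \<epsilon>) (\<Delta>, \<delta>)"
  shows "framed K A \<sigma> (\<Delta>, \<delta>) (\<lambda>a. \<phi> (r a))
    (deform_base_change K (\<Gamma>, \<epsilon>) (\<Delta>, \<delta>) \<phi> (M, f))
    (tensor_class \<Gamma> (along \<Delta> \<phi>) M (frag_of (\<one>\<^bsub>\<Delta>\<^esub>, b)))"
proof -
  interpret based_module K A \<Gamma> M b by (rule framed_residue[OF F])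
  interpret H: artin K \<Delta> \<delta> by (rule H)
  have \<phi>_ring: "\<phi> \<in> ring_hom \<Gamma> \<Delta>"
    and \<phi>_smult: "\<And>c x. c \<in> carrier K \<Longrightarrow> x \<in> carrier \<Gamma> \<Longrightarrow> \<phi> (c \<odot>\<^bsub>\<Gamma>\<^esub> x) = c \<odot>\<^bsub>\<Delta>\<^esub> \<phi> x"
    and \<delta>\<phi>: "\<And>x. x \<in> carrier \<Gamma> \<Longrightarrow> \<delta> (\<phi> x) = \<epsilon> x"
    using \<phi> by (auto simp: art_hom_def alg_hom_def)
  interpret \<phi>: ring_hom_ring \<Gamma> \<Delta> \<phi>
    by (rule ring_hom_ringI2[OF \<Gamma>.ring_axioms H.\<Gamma>.ring_axioms \<phi>_ring])
  interpret P: based_pair K A \<Gamma> M b "along \<Delta> \<phi>"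
    by (intro based_pair.intro based_module_axioms right_module_along \<Gamma>.ring_axioms
        H.\<Gamma>.ring_axioms \<phi>_ring)
  interpret R: based_pair K A \<Gamma> M b "along K \<epsilon>"
    by (intro based_pair.intro based_module_axioms right_module_along \<Gamma>.ring_axioms
        K.ring_axioms aug_ring_hom)
  let ?B = "base_change \<Gamma> \<Delta> \<phi> M"
  define T where "T d = P.pure d b" for d
  let ?\<beta> = "T \<one>\<^bsub>\<Delta>\<^esub>"
  have r: "r a \<in> carrier \<Gamma>" "ract M b a = lact M (r a) b" if "a \<in> carrier A" for a
    using F that by (auto simp: framed_def)
  have B_carrier: "carrier ?B = T ` carrier \<Delta>"
    using P.carrier_tensor_based by (simp add: base_change_simps along_simps T_def)
  have T_inj: "d = d'" if "d \<in> carrier \<Delta>" "d' \<in> carrier \<Delta>" "T d = T d'" for d d'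
    using that P.pure_b_inj by (simp add: T_def along_simps)
  have B_zero: "\<zero>\<^bsub>?B\<^esub> = T \<zero>\<^bsub>\<Delta>\<^esub>"
    using P.pure_zero_left[OF b_closed] by (simp add: base_change_simps P.one_tensor T_def along_simps)
  have B_add: "T d \<oplus>\<^bsub>?B\<^esub> T d' = T (d \<oplus>\<^bsub>\<Delta>\<^esub> d')" if "d \<in> carrier \<Delta>" "d' \<in> carrier \<Delta>" for d d'
    using P.pure_add_left[of d d' b] that b_closed
    by (simp add: base_change_simps T_def along_simps)
  have B_ract: "ract ?B (T d) a = T (d \<otimes>\<^bsub>\<Delta>\<^esub> \<phi> (r a))" if "d \<in> carrier \<Delta>" "a \<in> carrier A" for d a
    using base_change_ract_pure[OF P.tensor_pair_axioms, of d b a] P.pure_balance[of d "r a" b]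
      that r b_closed by (simp add: T_def along_simps)
  have B_lact: "lact ?B d (T d') = T (d \<otimes>\<^bsub>\<Delta>\<^esub> d')" if "d \<in> carrier \<Delta>" "d' \<in> carrier \<Delta>" for d d'
  proof -
    have "(\<lambda>x. d \<otimes>\<^bsub>\<Delta>\<^esub> x) \<in> rmod_hom \<Gamma> (along \<Delta> \<phi>) (along \<Delta> \<phi>)"
      using that by (auto simp: rmod_hom_def along_simps H.\<Gamma>.r_distr H.\<Gamma>.m_assoc)
    from tensor_map_class[OF P.tensor_pair_axioms P.tensor_pair_axioms this, of id "frag_of (d', b)"]
    show ?thesis using that b_closed by (simp add: base_change_def T_def along_simps)
  qed
  have ringA: "ring A" using A_alg unfolding k_algebra_def by blast
  have \<phi>r: "(\<lambda>a. \<phi> (r a)) \<in> ring_hom A \<Delta>"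
    using ring_hom_trans[OF framed_hom(1)[OF F] \<phi>_ring] by (simp add: comp_def)
  have "tensor_module K A \<Delta> (regular \<Delta> (\<lambda>a. \<phi> (r a)) id)"
    by (rule tensor_module_regular[OF ringA H.alg \<phi>r])
       (simp_all add: framed_hom(2)[OF F] scalar_def \<phi>_smult)
  then have B_module: "tensor_module K A \<Delta> ?B"
    by (rule tensor_module_image[where T = T])
       (auto simp: B_carrier B_zero B_add B_ract B_lact regular_def scalar_A_closed H.scalar_closed
         simp flip: H.scalar_def)
  have "bij_betw T (carrier \<Delta>) (carrier ?B)"
    by (auto simp: bij_betw_def inj_on_def B_carrier dest: T_inj)
  then have bij: "bij_betw (\<lambda>d. lact ?B d ?\<beta>) (carrier \<Delta>) (carrier ?B)"
    by (simp add: B_lact cong: bij_betw_cong)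
  have \<beta>: "?\<beta> \<in> carrier ?B" by (simp add: B_carrier)
  interpret B: based_module K A \<Delta> ?B ?\<beta>
    by (rule based_module.intro[OF B_module based_module_axioms.intro[OF \<beta> bij]])
  interpret Q: based_pair K A \<Delta> ?B ?\<beta> "along K \<delta>"
    by (intro based_pair.intro B.based_module_axioms right_module_along H.\<Gamma>.ring_axioms
        K.ring_axioms H.aug_ring_hom)
  have B_coord: "B.coord (T d) = d" if "d \<in> carrier \<Delta>" for d
    using that B_lact[OF that, of "\<one>\<^bsub>\<Delta>\<^esub>"] by (intro B.coord_eqI) simp_all
  let ?E = "\<lambda>c. frag_extend (\<lambda>(d, m). frag_of (c \<otimes>\<^bsub>K\<^esub> \<delta> d, m))"
  let ?F = "\<lambda>(c, Y). ?E c (SOME y. y \<in> Y)"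
  have addK: "hom X (add_monoid (along K \<epsilon>)) = hom X (add_monoid K)"
    "hom X' (add_monoid (along K \<delta>)) = hom X' (add_monoid K)" for X X' 
    by (simp_all add: hom_def along_simps)
  have group_K: "group (add_monoid K)" by (rule K.a_group)
  have E_hom: "?E c \<in> hom (free_Abelian_group P.gens) (free_Abelian_group R.gens)"
    if "c \<in> carrier K" for c
    by (rule frag_extend_is_hom) (use that in \<open>auto simp: along_simps H.aug_closed\<close>)
  \<comment> \<open>the inner representatives: both sides are additive in \<open>z\<close> and agree on pairs\<close>
  have contract_E: "R.contract (?E c z) = c \<otimes>\<^bsub>K\<^esub> \<delta> (P.contract z)"
    if c: "c \<in> carrier K" and z: "Poly_Mapping.keys z \<subseteq> P.gens" for c z
  proof (rule hom_free_eq[OF group_K _ _ _ z])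
    show "(\<lambda>z. R.contract (?E c z)) \<in> hom (free_Abelian_group P.gens) (add_monoid K)"
      using hom_compose[OF E_hom[OF c] R.contract_hom] by (simp add: addK comp_def)
    have *: "P.contract z \<in> carrier \<Delta>" if "Poly_Mapping.keys z \<subseteq> P.gens" for z
      using P.contract_closed[OF that that] by (simp add: along_simps)
    show "(\<lambda>z. c \<otimes>\<^bsub>K\<^esub> \<delta> (P.contract z)) \<in> hom (free_Abelian_group P.gens) (add_monoid K)"
      using c by (auto simp: hom_def P.contract_add * H.aug_closed H.aug_add K.r_distr along_simps)
    fix p assume "p \<in> P.gens"
    then obtain d m where p: "p = (d, m)" "d \<in> carrier \<Delta>" "m \<in> carrier M"
      by (auto simp: along_simps)
    then have "R.contract (?E c (frag_of p)) = (c \<otimes>\<^bsub>K\<^esub> \<delta> d) \<otimes>\<^bsub>K\<^esub> \<epsilon> (coord m)"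
      using c by (simp add: R.contract_of along_simps H.aug_closed)
    also have "\<dots> = c \<otimes>\<^bsub>K\<^esub> \<delta> (d \<otimes>\<^bsub>\<Delta>\<^esub> \<phi> (coord m))"
      using p c by (simp add: H.aug_mult \<delta>\<phi> coord_closed H.aug_closed aug_closed K.m_assoc)
    also have "d \<otimes>\<^bsub>\<Delta>\<^esub> \<phi> (coord m) = P.contract (frag_of p)"
      using p by (simp add: P.contract_of along_simps)
    finally show "R.contract (?E c (frag_of p)) = c \<otimes>\<^bsub>K\<^esub> \<delta> (P.contract (frag_of p))" .
  qed
  have repr: "Poly_Mapping.keys (SOME y. y \<in> T d) \<subseteq> P.gens \<and> P.contract (SOME y. y \<in> T d) = d"
    if d: "d \<in> carrier \<Delta>" for d
  proof -
    let ?y = "SOME y. y \<in> T d"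
    have k: "Poly_Mapping.keys (frag_of (d, b)) \<subseteq> P.gens" using d b_closed by (simp add: along_simps)
    have "frag_of (d, b) \<in> T d" by (simp add: T_def P.cls_mem P.null_zero)
    then have y: "?y \<in> P.cls (frag_of (d, b))" unfolding T_def by (rule someI)
    then have "Poly_Mapping.keys (?y - frag_of (d, b)) \<subseteq> P.gens" by (intro P.null_keys) (simp add: P.cls_mem)
    from keys_add_subset[OF this k] P.contract_cls[OF y k]
    show ?thesis using d by (simp add: P.contract_of_b along_simps)
  qed
  have reduce: "reduce_base_change K (\<Gamma>, \<epsilon>) (\<Delta>, \<delta>) M (Q.pure c ?\<beta>) = R.pure c b"
    if c: "c \<in> carrier K" for c
  proof -
    let ?x = "SOME x. x \<in> Q.pure c ?\<beta>"
    have k: "Poly_Mapping.keys (frag_of (c, ?\<beta>)) \<subseteq> Q.gens" using c \<beta> by (simp add: along_simps)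
    have "frag_of (c, ?\<beta>) \<in> Q.pure c ?\<beta>" by (simp add: Q.cls_mem Q.null_zero)
    then have x: "?x \<in> Q.pure c ?\<beta>" by (rule someI)
    then have "Poly_Mapping.keys (?x - frag_of (c, ?\<beta>)) \<subseteq> Q.gens" by (intro Q.null_keys) (simp add: Q.cls_mem)
    from keys_add_subset[OF this k] have xk: "Poly_Mapping.keys ?x \<subseteq> Q.gens" by simp
    have Fk: "Poly_Mapping.keys (?F p) \<subseteq> R.gens" if pq: "p \<in> Q.gens" for p
    proof -
      obtain c' d where p: "p = (c', T d)" "c' \<in> carrier K" "d \<in> carrier \<Delta>"
        using pq unfolding along_simps B_carrier by blast
      show ?thesis using hom_in_carrier[OF E_hom[OF p(2)]] repr[OF p(3)] p by simp
    qed
    \<comment> \<open>the outer representatives, by the same comparison on generators\<close>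
    have "R.contract (frag_extend ?F ?x) = Q.contract ?x"
    proof (rule hom_free_eq[OF group_K _ _ _ xk])
      show "(\<lambda>x. R.contract (frag_extend ?F x)) \<in> hom (free_Abelian_group Q.gens) (add_monoid K)"
        using hom_compose[OF frag_extend_is_hom[OF Fk] R.contract_hom] by (simp add: addK comp_def)
      show "Q.contract \<in> hom (free_Abelian_group Q.gens) (add_monoid K)"
        using Q.contract_hom by (simp add: addK)
      fix p assume "p \<in> Q.gens"
      then obtain c' d where p: "p = (c', T d)" "c' \<in> carrier K" "d \<in> carrier \<Delta>"
        unfolding along_simps B_carrier by blast
      then show "R.contract (frag_extend ?F (frag_of p)) = Q.contract (frag_of p)"
        using contract_E[OF p(2), of "SOME y. y \<in> T d"] repr[OF p(3)]
        by (simp add: Q.contract_of along_simps B_carrier B_coord)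
    qed
    also have "\<dots> = c" using Q.contract_cls[OF x k] c by (simp add: Q.contract_of_b along_simps)
    finally have "R.cls (frag_extend ?F ?x) = R.pure c b"
      using R.cls_contract[OF keys_frag_extend[OF Fk xk]] by simp
    then show ?thesis by (simp add: reduce_base_change_def)
  qed
  have "framed K A \<sigma> (\<Delta>, \<delta>) (\<lambda>a. \<phi> (r a))
    (deform_base_change K (\<Gamma>, \<epsilon>) (\<Delta>, \<delta>) \<phi> (M, f)) ?\<beta>"
    unfolding framed_def deform_base_change_def fst_conv snd_conv
  proof (intro conjI ballI B.based_module_axioms)
    fix a assume a: "a \<in> carrier A"
    show "\<phi> (r a) \<in> carrier \<Delta>" using r a by simp
    then show "ract ?B ?\<beta> a = lact ?B (\<phi> (r a)) ?\<beta>" using a by (simp add: B_ract B_lact)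
  next
    fix c assume "c \<in> carrier K"
    then show "f (reduce_base_change K (\<Gamma>, \<epsilon>) (\<Delta>, \<delta>) M (Q.pure c ?\<beta>)) = \<sigma> c"
      using F by (simp add: reduce framed_def)
  qed
  then show ?thesis by (simp add: T_def)
qed

end

section \<open>Correspondences that descend to a bijection of quotients\<close>

text \<open>Totality of \<open>P\<close> on both sides and its compatibility with \<open>E\<close> and \<open>R\<close> force \<open>E\<close> and \<open>R\<close> to be
  equivalence relations: their classes are the fibres of \<open>P\<close>.\<close>
locale quotient_correspondence =
  fixes X :: "'x set" and Y :: "'y set" and P :: "'x \<Rightarrow> 'y \<Rightarrow> bool"
    and E :: "'x rel" and R :: "'y rel"
  assumes E: "E \<subseteq> X \<times> X" and R: "R \<subseteq> Y \<times> Y"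
    and left_total: "x \<in> X \<Longrightarrow> \<exists>y\<in>Y. P x y"
    and right_total: "y \<in> Y \<Longrightarrow> \<exists>x\<in>X. P x y"
    and E_move: "\<lbrakk>y \<in> Y; P x y; (x, x') \<in> E\<rbrakk> \<Longrightarrow> P x' y"
    and E_intro: "\<lbrakk>x \<in> X; x' \<in> X; y \<in> Y; P x y; P x' y\<rbrakk> \<Longrightarrow> (x, x') \<in> E"
    and R_move: "\<lbrakk>x \<in> X; P x y; (y, y') \<in> R\<rbrakk> \<Longrightarrow> P x y'"
    and R_intro: "\<lbrakk>x \<in> X; y \<in> Y; y' \<in> Y; P x y; P x y'\<rbrakk> \<Longrightarrow> (y, y') \<in> R"
begin

lemma class_left_eq: "\<lbrakk>x \<in> X; y \<in> Y; P x y\<rbrakk> \<Longrightarrow> E `` {x} = {x'\<in>X. P x' y}"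
  using E E_move E_intro by blast

lemma class_right_eq: "\<lbrakk>x \<in> X; y \<in> Y; P x y\<rbrakk> \<Longrightarrow> R `` {y} = {y'\<in>Y. P x y'}"
  using R R_move R_intro by blast

lemma class_left:
  assumes y: "y \<in> Y" shows "{x\<in>X. P x y} \<in> X // E"
proof -
  obtain x where x: "x \<in> X" "P x y" using right_total[OF y] by blast
  show ?thesis using quotientI[OF x(1), of E] class_left_eq[OF x(1) y x(2)] by simp
qed

lemma class_cases:
  assumes C: "C \<in> X // E"
  obtains x y where "x \<in> X" "y \<in> Y" "P x y" "C = {x\<in>X. P x y}"
proof -
  obtain x where x: "x \<in> X" "C = E `` {x}" using C by (rule quotientE)
  then obtain y where "y \<in> Y" "P x y" using left_total by blast
  then show ?thesis using that x class_left_eq by blast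
qed

lemma class_image:
  assumes y: "y \<in> Y" shows "{y'\<in>Y. \<exists>x\<in>{x\<in>X. P x y}. P x y'} = R `` {y}"
proof -
  obtain x where x: "x \<in> X" "P x y" using right_total[OF y] by blast
  show ?thesis using class_right_eq[OF x(1) y x(2)] x y R_intro by blast
qed

lemma bij_betw_quotients: "bij_betw (\<lambda>C. {y\<in>Y. \<exists>x\<in>C. P x y}) (X // E) (Y // R)"
  unfolding bij_betw_def
proof
  show "inj_on (\<lambda>C. {y\<in>Y. \<exists>x\<in>C. P x y}) (X // E)"
  proof (rule inj_onI)
    fix C C' assume C: "C \<in> X // E" and C': "C' \<in> X // E"
      and eq: "{y\<in>Y. \<exists>x\<in>C. P x y} = {y\<in>Y. \<exists>x\<in>C'. P x y}"
    obtain x y where x: "x \<in> X" "y \<in> Y" "P x y" "C = {x\<in>X. P x y}" by (rule class_cases[OF C])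
    obtain x' y' where x': "x' \<in> X" "y' \<in> Y" "P x' y'" "C' = {x\<in>X. P x y'}"
      by (rule class_cases[OF C'])
    have "R `` {y} = R `` {y'}" using eq class_image[OF x(2)] class_image[OF x'(2)] x x' by simp
    moreover have "y \<in> R `` {y}" using class_right_eq[OF x(1-3)] x by blast
    ultimately have "(y', y) \<in> R" by blast
    then have "P x' y" using R_move x' by blast
    then show "C = C'" using class_left_eq[OF x'(1) x(2)] class_left_eq[OF x'(1-3)] x x' by simp
  qed
  show "(\<lambda>C. {y\<in>Y. \<exists>x\<in>C. P x y}) ` (X // E) = Y // R"
  proof (intro equalityI subsetI)
    fix Z assume "Z \<in> (\<lambda>C. {y\<in>Y. \<exists>x\<in>C. P x y}) ` (X // E)"
    then obtain C where C: "C \<in> X // E" and Z: "Z = {y\<in>Y. \<exists>x\<in>C. P x y}" by blast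
    obtain x y where "x \<in> X" and y: "y \<in> Y" and "P x y" and "C = {x\<in>X. P x y}"
      by (rule class_cases[OF C])
    then have "Z = R `` {y}" using Z class_image[OF y] by simp
    then show "Z \<in> Y // R" using quotientI[OF y] by simp
  next
    fix Z assume "Z \<in> Y // R"
    then obtain y where y: "y \<in> Y" "Z = R `` {y}" by (rule quotientE)
    show "Z \<in> (\<lambda>C. {y\<in>Y. \<exists>x\<in>C. P x y}) ` (X // E)"
      by (rule image_eqI[OF _ class_left[OF y(1)]]) (simp only: class_image[OF y(1)] y(2))
  qed
qed

end

section \<open>The simple module of the quotient by an idempotent\<close>

locale idempotent_quotient =
  fixes K :: "'k ring" and A :: "('k, 'a) module" and e :: 'a and \<epsilon> :: "'a set \<Rightarrow> 'k"
  assumes K_field: "field K" and A_alg: "k_algebra K A"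
    and e_closed: "e \<in> carrier A" and e_idem: "e \<otimes>\<^bsub>A\<^esub> e = e"
    and art: "artinian_local K (idem_quot A e, \<epsilon>)"
begin

abbreviation B where "B \<equiv> idem_quot A e"
definition proj where "proj a = Idl\<^bsub>A\<^esub> {e} +>\<^bsub>A\<^esub> a"
definition chi where "chi a = \<epsilon> (proj a)"

lemma ring_A: "ring A" and module_A: "module K A"
  using A_alg unfolding k_algebra_def by blast+

sublocale A: ring A by (rule ring_A)

sublocale B: artin K B \<epsilon>
  using artin_if_artinian_local[OF art] by simp

lemma ideal_e: "ideal (Idl\<^bsub>A\<^esub> {e}) A"
  using e_closed by (intro A.genideal_ideal) simp

sublocale I: ideal "Idl\<^bsub>A\<^esub> {e}" A by (rule ideal_e)

lemma carrier_B: "carrier B = proj ` carrier A"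
  by (auto simp: idem_quot_def quot_algebra_def FactRing_def A_RCOSETS_def' proj_def)

lemma proj_closed: "a \<in> carrier A \<Longrightarrow> proj a \<in> carrier B"
  by (simp add: carrier_B)

lemma proj_hom: "proj \<in> ring_hom A B"
  using I.rcos_ring_hom
  by (simp add: idem_quot_def quot_algebra_def ring_hom_def proj_def[abs_def] FactRing_def)

lemmas proj_add = ring_hom_add[OF proj_hom]
lemmas proj_mult = ring_hom_mult[OF proj_hom]
lemmas proj_one = ring_hom_one[OF proj_hom]

lemma proj_eq:
  "\<lbrakk>a \<in> carrier A; a' \<in> carrier A\<rbrakk> \<Longrightarrow> proj a = proj a' \<longleftrightarrow> a \<ominus>\<^bsub>A\<^esub> a' \<in> Idl\<^bsub>A\<^esub> {e}"
  using A.quotient_eq_iff_same_a_r_cos[OF ideal_e] by (simp add: proj_def)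

lemma smult_A_mult: "\<lbrakk>c \<in> carrier K; x \<in> carrier A\<rbrakk> \<Longrightarrow> c \<odot>\<^bsub>A\<^esub> x = (c \<odot>\<^bsub>A\<^esub> \<one>\<^bsub>A\<^esub>) \<otimes>\<^bsub>A\<^esub> x"
  using k_algebra.smult_mult_left[OF A_alg, of c "\<one>\<^bsub>A\<^esub>" x] by simp

text \<open>The scalar action on cosets is a union over all representatives. It is well defined because the
  ideal absorbs the scalars, which lie in \<open>A\<close>.\<close>
lemma proj_smult:
  assumes c: "c \<in> carrier K" and x: "x \<in> carrier A"
  shows "c \<odot>\<^bsub>B\<^esub> proj x = proj (c \<odot>\<^bsub>A\<^esub> x)"
proof -
  have sc: "c \<odot>\<^bsub>A\<^esub> y \<in> carrier A" if "y \<in> carrier A" for y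
    using that c module.smult_closed[OF module_A] by blast
  have "proj (c \<odot>\<^bsub>A\<^esub> y) = proj (c \<odot>\<^bsub>A\<^esub> x)" if "y \<in> proj x" for y
  proof -
    obtain i where i: "i \<in> Idl\<^bsub>A\<^esub> {e}" "y = i \<oplus>\<^bsub>A\<^esub> x"
      using \<open>y \<in> proj x\<close> by (auto simp: proj_def a_r_coset_def')
    have ic: "i \<in> carrier A" using i(1) by (rule I.Icarr)
    have "c \<odot>\<^bsub>A\<^esub> i \<in> Idl\<^bsub>A\<^esub> {e}"
      using I.I_l_closed[OF i(1) sc[OF A.one_closed]] smult_A_mult[OF c ic] by simp
    moreover have "c \<odot>\<^bsub>A\<^esub> y \<ominus>\<^bsub>A\<^esub> c \<odot>\<^bsub>A\<^esub> x = c \<odot>\<^bsub>A\<^esub> i"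
      using sc[OF ic] sc[OF x] module.smult_r_distr[OF module_A c ic x]
      by (simp add: i a_minus_def A.a_assoc A.r_neg)
    ultimately show ?thesis using sc[OF x] sc[of y] ic x i by (simp add: proj_eq)
  qed
  moreover have "x \<in> proj x" using x I.a_rcos_self by (simp add: proj_def)
  ultimately have "(\<Union>y\<in>proj x. proj (c \<odot>\<^bsub>A\<^esub> y)) = proj (c \<odot>\<^bsub>A\<^esub> x)" by blast
  then show ?thesis by (simp add: idem_quot_def quot_algebra_def coset_smult_def proj_def)
qed

lemma proj_scalar: "c \<in> carrier K \<Longrightarrow> proj (c \<odot>\<^bsub>A\<^esub> \<one>\<^bsub>A\<^esub>) = B.scalar c"
  using proj_smult[of c "\<one>\<^bsub>A\<^esub>"] by (simp add: proj_one B.scalar_def)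

lemma proj_e: "proj e = \<zero>\<^bsub>B\<^esub>"
  using I.a_rcos_const[OF A.genideal_self'[OF e_closed]]
  by (simp add: proj_def idem_quot_def quot_algebra_def FactRing_def)

definition point_iso where "point_iso c = B.max_ideal +>\<^bsub>B\<^esub> B.scalar c"

text \<open>The radical is the augmentation ideal, so a coset of it is determined by the augmentation of any
  representative.\<close>
lemma point: "point K A (simple_quot A e) point_iso chi"
proof (rule point.intro)
  interpret J: ideal B.max_ideal B by (rule B.max_ideal_ideal)
  let ?L = "B Quot B.max_ideal"
  have rad: "jacobson_radical B = B.max_ideal" by (rule B.jacobson_radical_max_ideal)
  have S: "carrier (simple_quot A e) = carrier ?L" "add (simple_quot A e) = add ?L"
    "ract (simple_quot A e) X a = X \<otimes>\<^bsub>?L\<^esub> (B.max_ideal +>\<^bsub>B\<^esub> proj a)" for X a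
    by (simp_all add: simple_quot_def Let_def rad proj_def)
  have L: "carrier ?L = (\<lambda>x. B.max_ideal +>\<^bsub>B\<^esub> x) ` carrier B"
    by (auto simp: FactRing_def A_RCOSETS_def')
  have eq: "B.max_ideal +>\<^bsub>B\<^esub> x = B.max_ideal +>\<^bsub>B\<^esub> y \<longleftrightarrow> \<epsilon> x = \<epsilon> y"
    if xy: "x \<in> carrier B" "y \<in> carrier B" for x y
  proof -
    have "\<epsilon> (x \<ominus>\<^bsub>B\<^esub> y) = \<epsilon> x \<ominus>\<^bsub>K\<^esub> \<epsilon> y" using xy by (simp add: a_minus_def B.aug_add)
    moreover have "\<epsilon> x \<ominus>\<^bsub>K\<^esub> \<epsilon> y = \<zero>\<^bsub>K\<^esub> \<longleftrightarrow> \<epsilon> x = \<epsilon> y"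
    proof
      have c: "\<epsilon> x \<in> carrier K" "\<epsilon> y \<in> carrier K" using xy by (simp_all add: B.aug_closed)
      have "(\<epsilon> x \<ominus>\<^bsub>K\<^esub> \<epsilon> y) \<oplus>\<^bsub>K\<^esub> \<epsilon> y = \<epsilon> x" using c by (rule B.K.minus_add_cancel)
      then show "\<epsilon> x = \<epsilon> y" if "\<epsilon> x \<ominus>\<^bsub>K\<^esub> \<epsilon> y = \<zero>\<^bsub>K\<^esub>" using that c by simp
      show "\<epsilon> x \<ominus>\<^bsub>K\<^esub> \<epsilon> y = \<zero>\<^bsub>K\<^esub>" if "\<epsilon> x = \<epsilon> y" using that c by (simp add: a_minus_def B.K.r_neg)
    qed
    moreover have "x \<ominus>\<^bsub>B\<^esub> y \<in> B.max_ideal \<longleftrightarrow> \<epsilon> (x \<ominus>\<^bsub>B\<^esub> y) = \<zero>\<^bsub>K\<^esub>"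
      unfolding B.max_ideal_def using B.\<Gamma>.minus_closed[OF xy] by blast
    ultimately show ?thesis
      using B.\<Gamma>.quotient_eq_iff_same_a_r_cos[OF B.max_ideal_ideal xy] by metis
  qed
  have coset: "B.max_ideal +>\<^bsub>B\<^esub> x = point_iso (\<epsilon> x)" if x: "x \<in> carrier B" for x
  proof -
    have c: "\<epsilon> x \<in> carrier K" using x by (rule B.aug_closed)
    show ?thesis unfolding point_iso_def eq[OF x B.scalar_closed[OF c]] B.aug_scalar[OF c] ..
  qed
  show "field K" by (rule K_field)
  show "k_algebra K A" by (rule A_alg)
  show "bij_betw point_iso (carrier K) (carrier (simple_quot A e))"
    unfolding bij_betw_def
  proof
    show "inj_on point_iso (carrier K)"
    proof (rule inj_onI)
      fix c d assume c: "c \<in> carrier K" and d: "d \<in> carrier K" and "point_iso c = point_iso d"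
      then have "\<epsilon> (B.scalar c) = \<epsilon> (B.scalar d)"
        unfolding point_iso_def eq[OF B.scalar_closed[OF c] B.scalar_closed[OF d]] by blast
      then show "c = d" unfolding B.aug_scalar[OF c] B.aug_scalar[OF d] .
    qed
    show "point_iso ` carrier K = carrier (simple_quot A e)"
    proof (intro equalityI subsetI)
      fix X assume "X \<in> carrier (simple_quot A e)"
      then obtain x where x: "x \<in> carrier B" "X = B.max_ideal +>\<^bsub>B\<^esub> x" unfolding S L by blast
      show "X \<in> point_iso ` carrier K"
        unfolding x(2) coset[OF x(1)] using B.aug_closed[OF x(1)] by blast
    next
      fix X assume "X \<in> point_iso ` carrier K"
      then show "X \<in> carrier (simple_quot A e)"
        unfolding S L point_iso_def using B.scalar_closed by blast
    qed
  qed
  fix c assume c: "c \<in> carrier K"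
  note sc = B.scalar_closed[OF c] and ec = B.aug_scalar[OF c]
  { fix d assume d: "d \<in> carrier K"
    note sd = B.scalar_closed[OF d] and ed = B.aug_scalar[OF d]
    have "point_iso c \<oplus>\<^bsub>simple_quot A e\<^esub> point_iso d =
        B.max_ideal +>\<^bsub>B\<^esub> (B.scalar c \<oplus>\<^bsub>B\<^esub> B.scalar d)"
      unfolding S point_iso_def FactRing_def using J.a_rcos_sum[OF sc sd] by simp
    also have "\<dots> = point_iso (c \<oplus>\<^bsub>K\<^esub> d)"
      unfolding coset[OF B.\<Gamma>.add.m_closed[OF sc sd]] B.aug_add[OF sc sd] ec ed ..
    finally show "point_iso (c \<oplus>\<^bsub>K\<^esub> d) = point_iso c \<oplus>\<^bsub>simple_quot A e\<^esub> point_iso d" ..  }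
  { fix a assume a: "a \<in> carrier A"
    note pa = proj_closed[OF a]
    have "ract (simple_quot A e) (point_iso c) a = B.max_ideal +>\<^bsub>B\<^esub> (B.scalar c \<otimes>\<^bsub>B\<^esub> proj a)"
      unfolding S(3) point_iso_def FactRing_def using J.rcoset_mult_add[OF sc pa] by simp
    also have "\<dots> = point_iso (c \<otimes>\<^bsub>K\<^esub> chi a)"
      unfolding coset[OF B.\<Gamma>.m_closed[OF sc pa]] B.aug_mult[OF sc pa] ec chi_def ..
    finally show "ract (simple_quot A e) (point_iso c) a = point_iso (c \<otimes>\<^bsub>K\<^esub> chi a)" . }
  show "chi (c \<odot>\<^bsub>A\<^esub> \<one>\<^bsub>A\<^esub>) = c" using c by (simp add: chi_def proj_scalar B.aug_scalar)
next
  fix a assume "a \<in> carrier A"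
  then show "chi a \<in> carrier K" by (simp add: chi_def proj_closed B.aug_closed)
qed

text \<open>The image of \<open>e\<close> is an idempotent of augmentation $\epsilon(0) = 0$, hence zero, so the kernel of
  \<open>r\<close> contains the ideal generated by \<open>e\<close>.\<close>
lemma descend:
  assumes G: "artin K \<Gamma> \<delta>" and r: "r \<in> ring_hom A \<Gamma>"
    and r_scalar: "\<And>c. c \<in> carrier K \<Longrightarrow> r (c \<odot>\<^bsub>A\<^esub> \<one>\<^bsub>A\<^esub>) = c \<odot>\<^bsub>\<Gamma>\<^esub> \<one>\<^bsub>\<Gamma>\<^esub>"
    and r_aug: "\<And>a. a \<in> carrier A \<Longrightarrow> \<delta> (r a) = chi a"
  shows "\<exists>\<rho>\<in>art_hom K (B, \<epsilon>) (\<Gamma>, \<delta>). \<forall>a\<in>carrier A. \<rho> (proj a) = r a"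
proof -
  interpret G: artin K \<Gamma> \<delta> by (rule G)
  interpret r: ring_hom_ring A \<Gamma> r by (rule ring_hom_ringI2[OF ring_A G.\<Gamma>.ring_axioms r])
  have "r e = \<zero>\<^bsub>\<Gamma>\<^esub>"
  proof (rule G.idempotent_in_max_ideal)
    have "\<delta> (r e) = \<zero>\<^bsub>K\<^esub>" using r_aug[OF e_closed] by (simp add: chi_def proj_e)
    then show "r e \<in> G.max_ideal" using e_closed by (simp add: G.max_ideal_def)
    show "r e \<otimes>\<^bsub>\<Gamma>\<^esub> r e = r e" using e_closed e_idem by (simp flip: r.hom_mult)
  qed
  then have "e \<in> a_kernel A \<Gamma> r" unfolding a_kernel_def' using e_closed by blast
  then have kernel: "Idl\<^bsub>A\<^esub> {e} \<subseteq> a_kernel A \<Gamma> r"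
    by (intro A.genideal_minimal r.kernel_is_ideal) blast
  have well: "r a = r a'" if "a \<in> carrier A" "a' \<in> carrier A" "proj a = proj a'" for a a'
  proof -
    have "a \<ominus>\<^bsub>A\<^esub> a' \<in> a_kernel A \<Gamma> r"
      using proj_eq[OF that(1,2)] that(3) kernel by blast
    then have z: "r (a \<ominus>\<^bsub>A\<^esub> a') = \<zero>\<^bsub>\<Gamma>\<^esub>" unfolding a_kernel_def' by blast
    have "(a \<ominus>\<^bsub>A\<^esub> a') \<oplus>\<^bsub>A\<^esub> a' = a" using that by (simp add: A.minus_add_cancel)
    then have "r a = r (a \<ominus>\<^bsub>A\<^esub> a') \<oplus>\<^bsub>\<Gamma>\<^esub> r a'" using that r.hom_add[of "a \<ominus>\<^bsub>A\<^esub> a'" a'] by simp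
    then show ?thesis using that z by simp
  qed
  define \<rho> where "\<rho> = restrict (\<lambda>X. r (SOME a. a \<in> carrier A \<and> proj a = X)) (carrier B)"
  have \<rho>: "\<rho> (proj a) = r a" if a: "a \<in> carrier A" for a
  proof -
    have "\<exists>a'. a' \<in> carrier A \<and> proj a' = proj a" using a by blast
    from someI_ex[OF this] show ?thesis
      using a by (auto simp: \<rho>_def proj_closed intro: well)
  qed
  have r_smult: "r (c \<odot>\<^bsub>A\<^esub> a) = c \<odot>\<^bsub>\<Gamma>\<^esub> r a" if "c \<in> carrier K" "a \<in> carrier A" for c a
  proof -
    have "c \<odot>\<^bsub>A\<^esub> \<one>\<^bsub>A\<^esub> \<in> carrier A" using that module.smult_closed[OF module_A] by blast
    then show ?thesis using that smult_A_mult[OF that] G.scalar_left[of c "r a"]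
      by (simp add: r_scalar G.scalar_def)
  qed
  have sc: "c \<odot>\<^bsub>A\<^esub> a \<in> carrier A" if "c \<in> carrier K" "a \<in> carrier A" for c a
    using that module.smult_closed[OF module_A] by blast
  have "\<rho> \<in> ring_hom B \<Gamma>"
    by (rule ring_hom_memI)
       (auto simp: carrier_B \<rho> simp flip: proj_mult proj_add proj_one)
  moreover have "\<rho> \<in> extensional (carrier B)" by (simp add: \<rho>_def)
  ultimately have "\<rho> \<in> art_hom K (B, \<epsilon>) (\<Gamma>, \<delta>)"
    unfolding art_hom_def alg_hom_def
    by (auto simp: carrier_B proj_smult \<rho> r_smult sc r_aug chi_def)
  then show ?thesis using \<rho> by blast
qed

end

section \<open>Deformations and homomorphisms\<close>

lemma framed_cong:
  assumes "framed K A \<sigma> G r D b" and "\<And>a. a \<in> carrier A \<Longrightarrow> r' a = r a"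
  shows "framed K A \<sigma> G r' D b"
  using assms unfolding framed_def by simp

context idempotent_quotient begin

definition framed_by ::
  "('k, 'g) aug_alg \<Rightarrow> ('k, 'a, 'g, 'm, 'a set set) deform \<Rightarrow> ('a set \<Rightarrow> 'g) \<Rightarrow> bool" where
  "framed_by G D \<rho> \<longleftrightarrow> (\<exists>b. framed K A point_iso G (\<lambda>a. \<rho> (proj a)) D b)"

definition iso_rel ::
  "('k, 'g) aug_alg \<Rightarrow> ('k, 'a, 'g, 'm, 'a set set) deform rel" where
  "iso_rel G = {(D, D'). D \<in> deformations K A (simple_quot A e) G \<and>
     D' \<in> deformations K A (simple_quot A e) G \<and> deform_iso K A G D D'}"

lemma point_artin:
  assumes "artinian_local K G"
  shows "point_artin K A (simple_quot A e) point_iso chi (fst G) (snd G)"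
  using point artin_if_artinian_local[OF assms] by (rule point_artin.intro)

lemma art_homD:
  assumes \<rho>: "\<rho> \<in> art_hom K (B, \<epsilon>) G"
  shows "\<rho> \<in> ring_hom B (fst G)" "\<rho> \<in> extensional (carrier B)"
    "\<And>c. c \<in> carrier K \<Longrightarrow> \<rho> (proj (c \<odot>\<^bsub>A\<^esub> \<one>\<^bsub>A\<^esub>)) = c \<odot>\<^bsub>fst G\<^esub> \<one>\<^bsub>fst G\<^esub>"
    "\<And>a. a \<in> carrier A \<Longrightarrow> snd G (\<rho> (proj a)) = chi a"
proof -
  show h: "\<rho> \<in> ring_hom B (fst G)" "\<rho> \<in> extensional (carrier B)"
    using \<rho> by (simp_all add: art_hom_def alg_hom_def)
  show "snd G (\<rho> (proj a)) = chi a" if "a \<in> carrier A" for a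
    using \<rho> proj_closed[OF that] by (simp add: art_hom_def chi_def)
  show "\<rho> (proj (c \<odot>\<^bsub>A\<^esub> \<one>\<^bsub>A\<^esub>)) = c \<odot>\<^bsub>fst G\<^esub> \<one>\<^bsub>fst G\<^esub>" if c: "c \<in> carrier K" for c
    unfolding proj_scalar[OF c] B.scalar_def
    using \<rho> c ring_hom_one[OF h(1)] by (simp add: art_hom_def alg_hom_def)
qed

lemma framed_by_deformation:
  assumes G: "artinian_local K G" and \<rho>: "\<rho> \<in> art_hom K (B, \<epsilon>) G" and F: "framed_by G D \<rho>"
  shows "D \<in> deformations K A (simple_quot A e) G"
proof -
  interpret point_artin K A "simple_quot A e" point_iso chi "fst G" "snd G" by (rule point_artin[OF G])
  obtain b where "framed K A point_iso (fst G, snd G) (\<lambda>a. \<rho> (proj a)) (fst D, snd D) b"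
    using F by (auto simp: framed_by_def)
  from framed_deformation[OF this art_homD(4)[OF \<rho>]] show ?thesis by simp
qed

lemma deformation_framed_by:
  assumes G: "artinian_local K G" and D: "D \<in> deformations K A (simple_quot A e) G"
  shows "\<exists>\<rho>\<in>art_hom K (B, \<epsilon>) G. framed_by G D \<rho>"
proof -
  interpret point_artin K A "simple_quot A e" point_iso chi "fst G" "snd G" by (rule point_artin[OF G])
  have "(fst D, snd D) \<in> deformations K A (simple_quot A e) (fst G, snd G)" using D by simp
  from framed_exists[OF this] obtain r b
    where F: "framed K A point_iso (fst G, snd G) r (fst D, snd D) b"
      and r: "\<And>a. a \<in> carrier A \<Longrightarrow> snd G (r a) = chi a" by blast
  have "\<exists>\<rho>\<in>art_hom K (B, \<epsilon>) (fst G, snd G). \<forall>a\<in>carrier A. \<rho> (proj a) = r a"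
    using framed_hom[OF F] r by (intro descend artin_axioms) (simp_all add: scalar_def)
  then obtain \<rho> where \<rho>: "\<rho> \<in> art_hom K (B, \<epsilon>) G" "\<And>a. a \<in> carrier A \<Longrightarrow> \<rho> (proj a) = r a"
    by auto
  then have "framed K A point_iso G (\<lambda>a. \<rho> (proj a)) D b"
    using F by (auto intro: framed_cong[of K A point_iso G r D b])
  then show ?thesis using \<rho> by (auto simp: framed_by_def)
qed

lemma hom_framed_by:
  fixes G :: "('k, 'g) aug_alg" and \<kappa> :: "'g \<Rightarrow> 'm"
  assumes G: "artinian_local K G" and \<rho>: "\<rho> \<in> art_hom K (B, \<epsilon>) G" and \<kappa>: "inj \<kappa>"
  shows "\<exists>D \<in> deformations K A (simple_quot A e) G :: ('k, 'a, 'g, 'm, 'a set set) deform set.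
    framed_by G D \<rho>"
proof -
  interpret point_artin K A "simple_quot A e" point_iso chi "fst G" "snd G" by (rule point_artin[OF G])
  have "(\<lambda>a. \<rho> (proj a)) \<in> ring_hom A (fst G)"
    using ring_hom_trans[OF proj_hom art_homD(1)[OF \<rho>]] by (simp add: comp_def)
  from framed_regular[OF this _ \<kappa>] art_homD(3)[OF \<rho>]
  obtain f where "framed K A point_iso (fst G, snd G) (\<lambda>a. \<rho> (proj a))
      (regular (fst G) (\<lambda>a. \<rho> (proj a)) \<kappa>, f) (\<kappa> \<one>\<^bsub>fst G\<^esub>)"
    by (auto simp: scalar_def)
  then have "framed_by G (regular (fst G) (\<lambda>a. \<rho> (proj a)) \<kappa>, f) \<rho>" by (auto simp: framed_by_def)
  then show ?thesis using framed_by_deformation[OF G \<rho>] by blast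
qed

lemma framed_by_inner:
  assumes G: "artinian_local K G" and F: "framed_by G D \<rho>" and in': "(\<rho>, \<rho>') \<in> inner_rel K (B, \<epsilon>) G"
  shows "framed_by G D \<rho>'"
proof -
  interpret point_artin K A "simple_quot A e" point_iso chi "fst G" "snd G" by (rule point_artin[OF G])
  obtain b where b: "framed K A point_iso (fst G, snd G) (\<lambda>a. \<rho> (proj a)) (fst D, snd D) b"
    using F by (auto simp: framed_by_def)
  obtain u where u: "u \<in> Units (fst G)"
    and \<rho>': "\<rho>' = compose (carrier B) (\<lambda>x. u \<otimes>\<^bsub>fst G\<^esub> x \<otimes>\<^bsub>fst G\<^esub> inv\<^bsub>fst G\<^esub> u) \<rho>"
    using in' by (auto simp: inner_rel_def)
  \<comment> \<open>the new basis element must still lift the generator, which requires augmentation one\<close>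
  obtain v where v: "v \<in> Units (fst G)" "snd G v = \<one>\<^bsub>K\<^esub>"
    and vu: "\<And>x. x \<in> carrier (fst G) \<Longrightarrow>
      v \<otimes>\<^bsub>fst G\<^esub> x \<otimes>\<^bsub>fst G\<^esub> inv\<^bsub>fst G\<^esub> v = u \<otimes>\<^bsub>fst G\<^esub> x \<otimes>\<^bsub>fst G\<^esub> inv\<^bsub>fst G\<^esub> u"
    using normalise_unit[OF u] by blast
  have "\<rho>' (proj a) = v \<otimes>\<^bsub>fst G\<^esub> \<rho> (proj a) \<otimes>\<^bsub>fst G\<^esub> inv\<^bsub>fst G\<^esub> v" if a: "a \<in> carrier A" for a
  proof -
    have "\<rho> (proj a) \<in> carrier (fst G)" using b a by (simp add: framed_def)
    then show ?thesis using proj_closed[OF a] by (simp add: \<rho>' compose_def vu)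
  qed
  from framed_conj[OF b v this]
  show ?thesis by (auto simp: framed_by_def)
qed

lemma framed_by_unique:
  assumes G: "artinian_local K G"
    and \<rho>: "\<rho> \<in> art_hom K (B, \<epsilon>) G" "\<rho>' \<in> art_hom K (B, \<epsilon>) G"
    and F: "framed_by G D \<rho>" "framed_by G D \<rho>'"
  shows "(\<rho>, \<rho>') \<in> inner_rel K (B, \<epsilon>) G"
proof -
  interpret point_artin K A "simple_quot A e" point_iso chi "fst G" "snd G" by (rule point_artin[OF G])
  obtain b b' where "framed K A point_iso (fst G, snd G) (\<lambda>a. \<rho> (proj a)) (fst D, snd D) b"
    "framed K A point_iso (fst G, snd G) (\<lambda>a. \<rho>' (proj a)) (fst D, snd D) b'"
    using F by (auto simp: framed_by_def)
  from framed_unique[OF this] obtain u where u: "u \<in> Units (fst G)"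
    and eq: "\<And>a. a \<in> carrier A \<Longrightarrow>
      \<rho>' (proj a) = u \<otimes>\<^bsub>fst G\<^esub> \<rho> (proj a) \<otimes>\<^bsub>fst G\<^esub> inv\<^bsub>fst G\<^esub> u" by blast
  have "\<rho>' = compose (carrier B) (\<lambda>x. u \<otimes>\<^bsub>fst G\<^esub> x \<otimes>\<^bsub>fst G\<^esub> inv\<^bsub>fst G\<^esub> u) \<rho>"
  proof (rule extensionalityI[OF art_homD(2)[OF \<rho>(2)]])
    fix X assume X: "X \<in> carrier B"
    then obtain a where "a \<in> carrier A" "X = proj a" unfolding carrier_B by blast
    then show "\<rho>' X = compose (carrier B) (\<lambda>x. u \<otimes>\<^bsub>fst G\<^esub> x \<otimes>\<^bsub>fst G\<^esub> inv\<^bsub>fst G\<^esub> u) \<rho> X"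
      using eq X by (simp add: compose_def)
  qed (rule compose_extensional)
  then show ?thesis using \<rho> u by (auto simp: inner_rel_def)
qed

lemma iso_if_framed_by:
  assumes G: "artinian_local K G" and F: "framed_by G D \<rho>" "framed_by G D' \<rho>"
  shows "deform_iso K A G D D'"
proof -
  interpret point_artin K A "simple_quot A e" point_iso chi "fst G" "snd G" by (rule point_artin[OF G])
  obtain b b' where "framed K A point_iso (fst G, snd G) (\<lambda>a. \<rho> (proj a)) (fst D, snd D) b"
    "framed K A point_iso (fst G, snd G) (\<lambda>a. \<rho> (proj a)) (fst D', snd D') b'"
    using F by (auto simp: framed_by_def)
  from deform_iso_if_framed[OF this refl] show ?thesis by simp
qed

lemma framed_by_iso:
  assumes G: "artinian_local K G" and F: "framed_by G D \<rho>" and iso: "deform_iso K A G D D'"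
    and D': "D' \<in> deformations K A (simple_quot A e) G"
  shows "framed_by G D' \<rho>"
proof -
  interpret point_artin K A "simple_quot A e" point_iso chi "fst G" "snd G" by (rule point_artin[OF G])
  obtain b where b: "framed K A point_iso (fst G, snd G) (\<lambda>a. \<rho> (proj a)) (fst D, snd D) b"
    using F by (auto simp: framed_by_def)
  have "tensor_module K A (fst G) (fst D')"
    using D' deformationsD(1)[of "fst D'" "snd D'"] by simp
  from framed_deform_iso[OF b this, of "snd D'"] iso show ?thesis by (simp add: framed_by_def)
qed

lemma framed_by_base_change:
  assumes G: "artinian_local K G" and H: "artinian_local K H" and \<phi>: "\<phi> \<in> art_hom K G H"
    and F: "framed_by G D \<rho>"
  shows "framed_by H (deform_base_change K G H \<phi> D) (compose (carrier B) \<phi> \<rho>)"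
proof -
  interpret point_artin K A "simple_quot A e" point_iso chi "fst G" "snd G" by (rule point_artin[OF G])
  obtain b where b: "framed K A point_iso (fst G, snd G) (\<lambda>a. \<rho> (proj a)) (fst D, snd D) b"
    using F by (auto simp: framed_by_def)
  have "\<phi> \<in> art_hom K (fst G, snd G) (fst H, snd H)" using \<phi> by simp
  from framed_base_change[OF b artin_if_artinian_local[OF H] this]
  obtain b' where "framed K A point_iso H (\<lambda>a. \<phi> (\<rho> (proj a))) (deform_base_change K G H \<phi> D) b'"
    by auto
  then have "framed K A point_iso H (\<lambda>a. compose (carrier B) \<phi> \<rho> (proj a))
      (deform_base_change K G H \<phi> D) b'"
    by (rule framed_cong) (simp add: compose_def proj_closed)
  then show ?thesis by (auto simp: framed_by_def)
qed

lemma compose_art_hom: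
  assumes \<phi>: "\<phi> \<in> art_hom K G H" and \<rho>: "\<rho> \<in> art_hom K (B, \<epsilon>) G"
  shows "compose (carrier B) \<phi> \<rho> \<in> art_hom K (B, \<epsilon>) H"
proof -
  have c: "\<rho> x \<in> carrier (fst G)" if "x \<in> carrier B" for x
    using art_homD(1)[OF \<rho>] that by (rule ring_hom_closed)
  have \<phi>h: "\<phi> \<in> ring_hom (fst G) (fst H)" using \<phi> by (simp add: art_hom_def alg_hom_def)
  have s: "c \<odot>\<^bsub>B\<^esub> x \<in> carrier B" if "c \<in> carrier K" "x \<in> carrier B" for c x
    using that module.smult_closed[OF B.module] by blast
  have "compose (carrier B) \<phi> \<rho> \<in> ring_hom B (fst H)"
    using ring_hom_trans[OF art_homD(1)[OF \<rho>] \<phi>h] unfolding ring_hom_def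
    by (auto simp: compose_def)
  then show ?thesis
    using \<phi> \<rho> c s unfolding art_hom_def alg_hom_def
    by (simp add: compose_def)
qed

lemma correspondence:
  fixes G :: "('k, 'g) aug_alg" and \<kappa> :: "'g \<Rightarrow> 'm"
  assumes G: "artinian_local K G" and \<kappa>: "inj \<kappa>"
  shows "quotient_correspondence
    (deformations K A (simple_quot A e) G :: ('k, 'a, 'g, 'm, 'a set set) deform set)
    (art_hom K (B, \<epsilon>) G) (framed_by G) (iso_rel G) (inner_rel K (B, \<epsilon>) G)"
proof
  fix D D' :: "('k, 'a, 'g, 'm, 'a set set) deform" and \<rho>
  assume "framed_by G D \<rho>" "(D, D') \<in> iso_rel G"
  then show "framed_by G D' \<rho>" using framed_by_iso[OF G] unfolding iso_rel_def by blast
next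
  fix D D' :: "('k, 'a, 'g, 'm, 'a set set) deform" and \<rho>
  assume "D \<in> deformations K A (simple_quot A e) G" "D' \<in> deformations K A (simple_quot A e) G"
    "framed_by G D \<rho>" "framed_by G D' \<rho>"
  then show "(D, D') \<in> iso_rel G" using iso_if_framed_by[OF G] unfolding iso_rel_def by blast
next
  show "iso_rel G \<subseteq> deformations K A (simple_quot A e) G \<times> deformations K A (simple_quot A e) G"
    unfolding iso_rel_def by blast
  show "inner_rel K (B, \<epsilon>) G \<subseteq> art_hom K (B, \<epsilon>) G \<times> art_hom K (B, \<epsilon>) G"
    unfolding inner_rel_def by blast
next
  fix D :: "('k, 'a, 'g, 'm, 'a set set) deform" and \<rho> \<rho>'
  assume "framed_by G D \<rho>" "(\<rho>, \<rho>') \<in> inner_rel K (B, \<epsilon>) G"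
  then show "framed_by G D \<rho>'" by (rule framed_by_inner[OF G])
next
  fix D :: "('k, 'a, 'g, 'm, 'a set set) deform" and \<rho> \<rho>'
  assume "\<rho> \<in> art_hom K (B, \<epsilon>) G" "\<rho>' \<in> art_hom K (B, \<epsilon>) G"
    "framed_by G D \<rho>" "framed_by G D \<rho>'"
  then show "(\<rho>, \<rho>') \<in> inner_rel K (B, \<epsilon>) G" by (rule framed_by_unique[OF G])
qed (fact deformation_framed_by[OF G] hom_framed_by[OF G _ \<kappa>])+

end

theorem corollaryC:
  fixes K :: "'k ring" and A :: "('k, 'a) module" and e :: 'a
    and \<epsilon> :: "'a set \<Rightarrow> 'k"
    and Q :: "('k, 'a, 'r) under_dga"
    and \<iota> :: "'a \<Rightarrow> 'r" and \<kappa> :: "'g \<Rightarrow> 'm"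
  assumes "field K" and "char_zero K"
    and "k_algebra K A"
    and "e \<in> carrier A" and "e \<otimes>\<^bsub>A\<^esub> e = e"
    and "artinian_local K (idem_quot A e, \<epsilon>)"
    and size_dga: "inj_on \<iota> (carrier A)"
    and "derived_quotient K A e Q"
    and "cohomologically_locally_finite K (fst Q)"
    and size_mod: "inj \<kappa>"
  shows "\<exists>\<eta> :: ('k, 'g) aug_alg \<Rightarrow> ('k, 'a, 'g, 'm, 'a set set) deform set \<Rightarrow> ('a set \<Rightarrow> 'g) set.
    (\<forall>G. artinian_local K G \<longrightarrow>
       bij_betw (\<eta> G) (Def_cl K A (simple_quot A e) G)
         (hom_mod_inner K (idem_quot A e, \<epsilon>) G)) \<and>
    (\<forall>G H \<phi> C. artinian_local K G \<and> artinian_local K H \<and> \<phi> \<in> art_hom K G H \<and>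
       C \<in> Def_cl K A (simple_quot A e) G \<longrightarrow>
       Def_cl_map K A (simple_quot A e) G H \<phi> C \<in> Def_cl K A (simple_quot A e) H \<and>
       \<eta> H (Def_cl_map K A (simple_quot A e) G H \<phi> C) =
         hom_mod_inner_map K (idem_quot A e, \<epsilon>) H \<phi> (\<eta> G C))"
proof -
  interpret idempotent_quotient K A e \<epsilon>
    using assms by (intro idempotent_quotient.intro) auto
  let ?X = "\<lambda>G. deformations K A (simple_quot A e) G :: ('k, 'a, 'g, 'm, 'a set set) deform set"
  let ?Y = "\<lambda>G :: ('k, 'g) aug_alg. art_hom K (B, \<epsilon>) G"
  let ?R = "\<lambda>G :: ('k, 'g) aug_alg. inner_rel K (B, \<epsilon>) G"
  define \<eta> where "\<eta> G C = {\<rho> \<in> ?Y G. \<exists>D\<in>C. framed_by G D \<rho>}"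
    for G and C :: "('k, 'a, 'g, 'm, 'a set set) deform set"
  have Def: "Def_cl K A (simple_quot A e) G = ?X G // iso_rel G" for G
    by (simp add: Def_cl_def iso_rel_def)
  note corr = correspondence[OF _ size_mod]
  have bij: "bij_betw (\<eta> G) (Def_cl K A (simple_quot A e) G) (hom_mod_inner K (B, \<epsilon>) G)"
    if G: "artinian_local K G" for G
    unfolding Def hom_mod_inner_def \<eta>_def
    by (rule quotient_correspondence.bij_betw_quotients[OF corr[OF G]])
  have nat: "Def_cl_map K A (simple_quot A e) G H \<phi> C \<in> Def_cl K A (simple_quot A e) H \<and>
      \<eta> H (Def_cl_map K A (simple_quot A e) G H \<phi> C) = hom_mod_inner_map K (B, \<epsilon>) H \<phi> (\<eta> G C)"
    if G: "artinian_local K G" and H: "artinian_local K H" and \<phi>: "\<phi> \<in> art_hom K G H"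
      and C: "C \<in> Def_cl K A (simple_quot A e) G"
    for G H \<phi> and C :: "('k, 'a, 'g, 'm, 'a set set) deform set"
  proof -
    interpret G: quotient_correspondence "?X G" "?Y G" "framed_by G" "iso_rel G" "?R G"
      by (rule corr[OF G])
    interpret H: quotient_correspondence "?X H" "?Y H" "framed_by H" "iso_rel H" "?R H"
      by (rule corr[OF H])
    let ?push = "compose (carrier B) \<phi>"
    obtain D \<rho> where D: "D \<in> ?X G" and \<rho>: "\<rho> \<in> ?Y G" and F: "framed_by G D \<rho>"
      and C_eq: "C = {D\<in>?X G. framed_by G D \<rho>}"
      using G.class_cases[OF C[unfolded Def]] by blast
    have push: "?push \<rho>' \<in> ?Y H" if "\<rho>' \<in> ?Y G" for \<rho>' using \<phi> that by (rule compose_art_hom)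
    have map: "Def_cl_map K A (simple_quot A e) G H \<phi> C = {D'\<in>?X H. framed_by H D' (?push \<rho>)}"
    proof (intro equalityI subsetI)
      fix D' assume "D' \<in> Def_cl_map K A (simple_quot A e) G H \<phi> C"
      then obtain D0 :: "('k, 'a, 'g, 'm, 'a set set) deform"
        where D': "D' \<in> ?X H" and D0: "framed_by G D0 \<rho>"
        and iso: "deform_iso K A H (deform_base_change K G H \<phi> D0) D'"
        unfolding Def_cl_map_def C_eq by blast
      show "D' \<in> {D'\<in>?X H. framed_by H D' (?push \<rho>)}"
        using framed_by_iso[OF H framed_by_base_change[OF G H \<phi> D0] iso D'] D' by blast
    next
      fix D' assume D': "D' \<in> {D'\<in>?X H. framed_by H D' (?push \<rho>)}"
      then have "deform_iso K A H (deform_base_change K G H \<phi> D) D'"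
        using iso_if_framed_by[OF H framed_by_base_change[OF G H \<phi> F]] by blast
      then show "D' \<in> Def_cl_map K A (simple_quot A e) G H \<phi> C"
        using D' D F unfolding Def_cl_map_def C_eq by blast
    qed
    have "\<eta> G C = ?R G `` {\<rho>}"
      unfolding \<eta>_def C_eq by (rule G.class_image[OF \<rho>])
    also have "\<dots> = {\<rho>'\<in>?Y G. framed_by G D \<rho>'}" by (rule G.class_right_eq[OF D \<rho> F])
    finally have \<eta>C: "\<eta> G C = {\<rho>'\<in>?Y G. framed_by G D \<rho>'}" .
    \<comment> \<open>the base change itself lives in another type; \<open>D'\<close> is a copy of it in the given one\<close>
    obtain D' where D': "D' \<in> ?X H" "framed_by H D' (?push \<rho>)" using H.right_total[OF push[OF \<rho>]] by blast
    have iso: "deform_iso K A H (deform_base_change K G H \<phi> D) D'"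
      by (rule iso_if_framed_by[OF H framed_by_base_change[OF G H \<phi> F] D'(2)])
    have orbit: "?R H `` {?push \<rho>'} = ?R H `` {?push \<rho>}" if "\<rho>' \<in> \<eta> G C" for \<rho>'
    proof -
      have \<rho>': "\<rho>' \<in> ?Y G" "framed_by G D \<rho>'" using that unfolding \<eta>C by auto
      have "framed_by H D' (?push \<rho>')"
        by (rule framed_by_iso[OF H framed_by_base_change[OF G H \<phi> \<rho>'(2)] iso D'(1)])
      then show ?thesis
        using H.class_right_eq[OF D'(1) push[OF \<rho>'(1)]]
          H.class_right_eq[OF D'(1) push[OF \<rho>] D'(2)] by simp
    qed
    have "\<rho> \<in> \<eta> G C" using \<rho> F unfolding \<eta>C by blast
    then have "hom_mod_inner_map K (B, \<epsilon>) H \<phi> (\<eta> G C) = ?R H `` {?push \<rho>}"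
      unfolding hom_mod_inner_map_def fst_conv using orbit by blast
    also have "\<dots> = \<eta> H (Def_cl_map K A (simple_quot A e) G H \<phi> C)"
      unfolding map \<eta>_def by (rule H.class_image[OF push[OF \<rho>], symmetric])
    finally show ?thesis
      unfolding Def map using H.class_left[OF push[OF \<rho>]] by simp
  qed
  show ?thesis
    using bij nat by (intro exI[of _ \<eta>] conjI allI impI) blast+
qed

end
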